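(* Let $\mu=\mu_1+\mu_2$ be the graph-directed self-similar measure on $\mathbb{R}$ defined in the context from contraction ratios $\rho,r\in(0,1)$ with $\rho+2r-\rho r\le1$ and probability weights $p_{e_1},\dots,p_{e_5}>0$. For $q\ge0$, $\alpha\in\mathbb{R}$ put $Q_{i,\rho}:=p_{e_i}^q\rho^{-\alpha}$, $\overline Q_{i,\rho}:=1-Q_{i,\rho}$ for $i=1,5$; $Q_{i,r}:=p_{e_i}^qr^{-\alpha}$, $\overline Q_{i,r}:=1-Q_{i,r}$ for $i=2,3,4$; $Q_{1,3,2,5,\rho,r}:=(p_{e_1e_3}+p_{e_2e_5})^q(\rho r)^{-\alpha}$; and $$H(q,\alpha):=\overline Q_{4,r}\bigl(\overline Q_{1,\rho}\overline Q_{3,r}-Q_{1,3,2,5,\rho,r}\bigr)-Q_{2,r}Q_{4,r}Q_{5,\rho}.$$ Then for $q\ge0$ there exists a unique real number $\alpha=\alpha(q)$ satisfying $H(q,\alpha)=0$, and $\tau(q)=\alpha$. In particular, for $q>0$ and $\alpha=\alpha(q)$, if $H_\alpha(q,\alpha)\ne0$ (where $H_\alpha=\partial H/\partial\alpha$), then $\tau$ is differentiable at $q$; moreover $$\begin{aligned}\tau'(q)=&\Bigl\{Q_{4,r}\ln(p_{e_4})\bigl(\overline Q_{1,\rho}\overline Q_{3,r}-Q_{1,3,2,5,\rho,r}\bigr)+Q_{2,r}Q_{4,r}Q_{5,\rho}\ln(p_{e_2e_4e_5})\\&+\overline Q_{4,r}\bigl(Q_{1,\rho}\overline Q_{3,r}\ln(p_{e_1})+Q_{3,r}\overline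 Q_{1,\rho}\ln(p_{e_3})+Q_{1,3,2,5,\rho,r}\ln(p_{e_1e_3}+p_{e_2e_5})\bigr)\Bigr\}\\&\cdot\Bigl\{Q_{4,r}\ln(r)\bigl(\overline Q_{1,\rho}\overline Q_{3,r}-Q_{1,3,2,5,\rho,r}\bigr)+Q_{2,r}Q_{4,r}Q_{5,\rho}\ln(\rho r^2)\\&+\overline Q_{4,r}\bigl(Q_{1,\rho}\overline Q_{3,r}\ln(\rho)+Q_{3,r}\overline Q_{1,\rho}\ln(r)+Q_{1,3,2,5,\rho,r}\ln(\rho r)\bigr)\Bigr\}^{-1}.\end{aligned}$$ With $\varphi_\ell$ and $\nu_1$ as in the context: if $\nu_1$ is non-lattice, then for each $\ell\in\{1,3,4\}$ there exists a non-negative constant $c_\ell$ such that $\lim_{x\to\infty}e^{(1+\alpha)x}\varphi_\ell(e^{-x})=c_\ell$; if $\nu_1$ is lattice, then for each $\ell\in\{1,3,4\}$ there exists a periodic function $q_\ell$ such that $\lim_{x\to\infty}\bigl(e^{(1+\alpha)x}\varphi_\ell(e^{-x})-q_\ell(x)\bigr)=0$.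
   Context: **$L^q$-spectrum.** $\tau(q):=\liminf_{h\to0^+}\frac{\ln\sup\sum_i\mu(B_h(x_i))^q}{\ln h}$, the supremum being over all families of disjoint balls $B_h(x_i)$ of radius $h$ centered in $\mathrm{supp}(\mu)$. **The measure.** The graph-directed system has vertices $V=\{1,2\}$ and edges $e_1,\dots,e_5$ with $e_1,e_3$ from $1$ to $1$, $e_2$ from $1$ to $2$, $e_4$ from $2$ to $2$, $e_5$ from $2$ to $1$, and similitudes on $\mathbb{R}$: $S_{e_1}(x)=S_{e_5}(x)=\rho x$, $S_{e_2}(x)=rx+\rho(1-r)$, $S_{e_3}(x)=S_{e_4}(x)=rx+(1-r)$. The weights satisfy $p_{e_1}+p_{e_2}+p_{e_3}=1$ and $p_{e_4}+p_{e_5}=1$. $\mu_1,\mu_2$ are the unique Borel probability measures with $\mu_1=p_{e_1}\mu_1\circ S_{e_1}^{-1}+p_{e_2}\mu_2\circ S_{e_2}^{-1}+p_{e_3}\mu_1\circ S_{e_3}^{-1}$ and $\mu_2=p_{e_4}\mu_2\circ S_{e_4}^{-1}+p_{e_5}\mu_1\circ S_{e_5}^{-1}$. Notation: $p_{ee'}=p_ep_{e'}$, etc. **Cells.** $\Omega_1=\Omega_2=(0,1)$; $B_{1,1}=S_{e_1}(\Omega_1)\cup S_{e_2}(\Omega_2)$, $B_{1,3}=S_{e_5}(\Omega_1)$, $B_{1,4}=S_{e_4}(\Omega_2)$; $\Gamma=\{1,3,4\}$ (with $\Gamma_1=\{1\}$, $\Gamma_2=\{3,4\}$ the cells in $\Omega_1,\Omega_2$).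 $\varphi_\ell(h):=\int_{B_{1,\ell}}\mu(B_h(x))^q\,dx$. **$\nu_1$.** With $\alpha=\alpha(q)$, let $\mathbf{M}_{\boldsymbol\alpha}=[\mu_{\ell\ell'}]_{\ell,\ell'\in\Gamma}$ be the matrix of discrete measures $\mu_{11}=p_{e_1}^q\rho^{-\alpha}\delta_{-\ln\rho}$, $\mu_{13}=((p_{e_1e_3}+p_{e_2e_5})/p_{e_5})^qr^{-\alpha}\delta_{-\ln r}$, $\mu_{14}=p_{e_2}^qr^{-\alpha}\delta_{-\ln r}$, $\mu_{31}=\sum_{k\ge2}(p_{e_5}p_{e_3}^{k-2})^q(\rho r^{k-2})^{-\alpha}\delta_{-\ln(\rho r^{k-2})}$, $\mu_{43}=\mu_{44}=p_{e_4}^qr^{-\alpha}\delta_{-\ln r}$, all other entries $0$. Let $N$ be this matrix with row and column $1$ removed, $u$ the first row without its first entry, $v$ the first column without its first entry; $\nu_1:=\mu_{11}+u*\sum_{n\ge0}N^{*n}*v$ (entries multiplied by convolution). $\nu_1$ is lattice if its support lies in a discrete subgroup of $\mathbb{R}$, non-lattice otherwise.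
   Formalization: Uniqueness of α(q), which fails over all reals for q>1, is stated among α with Q_{4,r}<1, where the series in ν_1 has finite mass; τ(q), τ'(q) and the asymptotics refer to this zero. For q=0, φ_ℓ is read with 0^0=0. *)

theory Defs
  imports "HOL-Probability.Probability"
begin

section \<open>Borel measures on the line\<close>

definition msum :: "'i set \<Rightarrow> ('i \<Rightarrow> real measure) \<Rightarrow> real measure" where
  "msum I F = measure_of UNIV (sets borel) (\<lambda>A. \<integral>\<^sup>+ i. emeasure (F i) A \<partial>count_space I)"

definition madd :: "real measure \<Rightarrow> real measure \<Rightarrow> real measure" where
  "madd M N = measure_of UNIV (sets borel) (\<lambda>A. emeasure M A + emeasure N A)"

definition msupp :: "real measure \<Rightarrow> real set" where
  "msupp M = {x. \<forall>U. open U \<longrightarrow> x \<in> U \<longrightarrow> emeasure M U > 0}"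

definition lattice_measure :: "real measure \<Rightarrow> bool" where
  "lattice_measure M \<longleftrightarrow>
     (\<exists>G. 0 \<in> G \<and> (\<forall>x\<in>G. \<forall>y\<in>G. x + y \<in> G) \<and> (\<forall>x\<in>G. - x \<in> G) \<and> topological_space_class.discrete G \<and> msupp M \<subseteq> G)"

lemma emeasure_msum:
  assumes "\<And>i. i \<in> I \<Longrightarrow> sets (F i) = sets borel" and A: "A \<in> sets borel"
  shows "emeasure (msum I F) A = (\<integral>\<^sup>+ i. emeasure (F i) A \<partial>count_space I)"
proof -
  let ?m = "\<lambda>A. \<integral>\<^sup>+ i. emeasure (F i) A \<partial>count_space I"
  have "countably_additive (sets borel) ?m"
  proof (rule countably_additiveI)
    fix B :: "nat \<Rightarrow> real set"
    assume B: "range B \<subseteq> sets borel" "disjoint_family B"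
    have "(\<Sum>n. ?m (B n)) = (\<integral>\<^sup>+ i. (\<Sum>n. emeasure (F i) (B n)) \<partial>count_space I)"
      by (rule nn_integral_suminf[symmetric]) simp
    also have "\<dots> = ?m (\<Union> (range B))"
      by (rule nn_integral_cong) (use B assms(1) in \<open>auto intro!: suminf_emeasure\<close>)
    finally show "(\<Sum>n. ?m (B n)) = ?m (\<Union> (range B))" .
  qed
  moreover have "sigma_algebra UNIV (sets (borel :: real measure))"
    using sets.sigma_algebra_axioms[of "borel :: real measure"] by simp
  ultimately show ?thesis
    using A unfolding msum_def by (intro emeasure_measure_of_sigma) (auto simp: positive_def)
qed

lemma emeasure_madd:
  assumes "sets M = sets borel" "sets N = sets borel" and A: "A \<in> sets borel"
  shows "emeasure (madd M N) A = emeasure M A + emeasure N A"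
proof -
  let ?m = "\<lambda>A. emeasure M A + emeasure N A"
  have "countably_additive (sets borel) ?m"
  proof (rule countably_additiveI)
    fix B :: "nat \<Rightarrow> real set"
    assume B: "range B \<subseteq> sets borel" "disjoint_family B"
    then show "(\<Sum>n. ?m (B n)) = ?m (\<Union> (range B))"
      using assms(1,2) by (simp add: suminf_add[symmetric] suminf_emeasure)
  qed
  moreover have "sigma_algebra UNIV (sets (borel :: real measure))"
    using sets.sigma_algebra_axioms[of "borel :: real measure"] by simp
  ultimately show ?thesis
    using A unfolding madd_def by (intro emeasure_measure_of_sigma) (auto simp: positive_def)
qed


section \<open>The $L^q$-spectrum\<close>

text \<open>
  A family of disjoint balls of one radius \<open>h > 0\<close> is given by its set of centres. Restricting to
  finite families does not change the supremum, since the terms are nonnegative; for a finite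
  measure with bounded support the supremum is finite. For \<open>q = 0\<close>, \<open>0 powr 0 = 0\<close> is irrelevant
  here, as a ball centred in the support has positive measure.
\<close>

definition packing_sup :: "real measure \<Rightarrow> real \<Rightarrow> real \<Rightarrow> real" where
  "packing_sup M q h =
     (SUP X \<in> {X. finite X \<and> X \<subseteq> msupp M \<and> disjoint_family_on (\<lambda>x. ball x h) X}.
        \<Sum>x\<in>X. measure M (ball x h) powr q)"

definition Lq_spectrum :: "real measure \<Rightarrow> real \<Rightarrow> ereal" where
  "Lq_spectrum M q = Liminf (at_right 0) (\<lambda>h. ereal (ln (packing_sup M q h) / ln h))"


section \<open>The graph-directed system\<close>

datatype edge = E1 | E2 | E3 | E4 | E5

fun S :: "real \<Rightarrow> real \<Rightarrow> edge \<Rightarrow> real \<Rightarrow> real" where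
  "S \<rho> r E1 x = \<rho> * x"
| "S \<rho> r E2 x = r * x + \<rho> * (1 - r)"
| "S \<rho> r E3 x = r * x + (1 - r)"
| "S \<rho> r E4 x = r * x + (1 - r)"
| "S \<rho> r E5 x = \<rho> * x"

definition graph_directed_measures ::
    "real \<Rightarrow> real \<Rightarrow> (edge \<Rightarrow> real) \<Rightarrow> real measure \<Rightarrow> real measure \<Rightarrow> bool" where
  "graph_directed_measures \<rho> r p \<mu>1 \<mu>2 \<longleftrightarrow>
     prob_space \<mu>1 \<and> sets \<mu>1 = sets borel \<and> prob_space \<mu>2 \<and> sets \<mu>2 = sets borel \<and>
     (\<forall>A \<in> sets borel.
        measure \<mu>1 A = p E1 * measure \<mu>1 (S \<rho> r E1 -` A) + p E2 * measure \<mu>2 (S \<rho> r E2 -` A)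
                      + p E3 * measure \<mu>1 (S \<rho> r E3 -` A) \<and>
        measure \<mu>2 A = p E4 * measure \<mu>2 (S \<rho> r E4 -` A) + p E5 * measure \<mu>1 (S \<rho> r E5 -` A))"

text \<open>The cells $B_{1,1}$, $B_{1,3}$, $B_{1,4}$; the type \<open>cell\<close> is the index set $\Gamma$.\<close>

datatype cell = C1 | C3 | C4

fun cell_set :: "real \<Rightarrow> real \<Rightarrow> cell \<Rightarrow> real set" where
  "cell_set \<rho> r C1 = S \<rho> r E1 ` {0<..<1} \<union> S \<rho> r E2 ` {0<..<1}"
| "cell_set \<rho> r C3 = S \<rho> r E5 ` {0<..<1}"
| "cell_set \<rho> r C4 = S \<rho> r E4 ` {0<..<1}"

text \<open>
  For \<open>q = 0\<close> the integrand is the indicator function of $\mu(B_h(x)) > 0$, because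
  \<open>0 powr 0 = 0\<close>; this is the convention $0^0 = 0$ under which the asymptotics also cover \<open>q = 0\<close>.
\<close>

definition \<phi> :: "real \<Rightarrow> real \<Rightarrow> real measure \<Rightarrow> real \<Rightarrow> cell \<Rightarrow> real \<Rightarrow> real" where
  "\<phi> \<rho> r M q l h = (LINT x : cell_set \<rho> r l | lborel. measure M (ball x h) powr q)"


section \<open>The function $H$ and the derivative formula\<close>

text \<open>
  \<open>Q w s q \<alpha>\<close> is $w^q s^{-\alpha}$. Hence $Q_{i,\rho}$ is \<open>Q (p Ei) \<rho> q \<alpha>\<close>, $Q_{i,r}$ is
  \<open>Q (p Ei) r q \<alpha>\<close>, and $Q_{1,3,2,5,\rho,r}$ is \<open>Q (p E1 * p E3 + p E2 * p E5) (\<rho> * r) q \<alpha>\<close>.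
\<close>

definition Q :: "real \<Rightarrow> real \<Rightarrow> real \<Rightarrow> real \<Rightarrow> real" where
  "Q w s q \<alpha> = w powr q * s powr (- \<alpha>)"

definition H :: "real \<Rightarrow> real \<Rightarrow> (edge \<Rightarrow> real) \<Rightarrow> real \<Rightarrow> real \<Rightarrow> real" where
  "H \<rho> r p q \<alpha> =
     (1 - Q (p E4) r q \<alpha>) *
       ((1 - Q (p E1) \<rho> q \<alpha>) * (1 - Q (p E3) r q \<alpha>)
         - Q (p E1 * p E3 + p E2 * p E5) (\<rho> * r) q \<alpha>)
     - Q (p E2) r q \<alpha> * Q (p E4) r q \<alpha> * Q (p E5) \<rho> q \<alpha>"

definition tau_deriv :: "real \<Rightarrow> real \<Rightarrow> (edge \<Rightarrow> real) \<Rightarrow> real \<Rightarrow> real \<Rightarrow> real" where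
  "tau_deriv \<rho> r p q \<alpha> =
     (let Q1 = Q (p E1) \<rho> q \<alpha>; Q2 = Q (p E2) r q \<alpha>; Q3 = Q (p E3) r q \<alpha>;
          Q4 = Q (p E4) r q \<alpha>; Q5 = Q (p E5) \<rho> q \<alpha>;
          w = p E1 * p E3 + p E2 * p E5; Q1325 = Q w (\<rho> * r) q \<alpha>
      in (Q4 * ln (p E4) * ((1 - Q1) * (1 - Q3) - Q1325)
          + Q2 * Q4 * Q5 * ln (p E2 * p E4 * p E5)
          + (1 - Q4) * (Q1 * (1 - Q3) * ln (p E1) + Q3 * (1 - Q1) * ln (p E3) + Q1325 * ln w))
         / (Q4 * ln r * ((1 - Q1) * (1 - Q3) - Q1325)
          + Q2 * Q4 * Q5 * ln (\<rho> * r\<^sup>2)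
          + (1 - Q4) * (Q1 * (1 - Q3) * ln \<rho> + Q3 * (1 - Q1) * ln r + Q1325 * ln (\<rho> * r))))"


section \<open>The measure $\nu_1$\<close>

definition atom :: "real \<Rightarrow> real \<Rightarrow> real measure" where
  "atom c x = scale_measure (ennreal c) (return borel x)"

fun renewal_entry :: "real \<Rightarrow> real \<Rightarrow> (edge \<Rightarrow> real) \<Rightarrow> real \<Rightarrow> real \<Rightarrow> cell \<Rightarrow> cell \<Rightarrow> real measure" where
  "renewal_entry \<rho> r p q \<alpha> C1 C1 = atom (p E1 powr q * \<rho> powr (- \<alpha>)) (- ln \<rho>)"
| "renewal_entry \<rho> r p q \<alpha> C1 C3 =
     atom (((p E1 * p E3 + p E2 * p E5) / p E5) powr q * r powr (- \<alpha>)) (- ln r)"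
| "renewal_entry \<rho> r p q \<alpha> C1 C4 = atom (p E2 powr q * r powr (- \<alpha>)) (- ln r)"
| "renewal_entry \<rho> r p q \<alpha> C3 C1 =
     msum {k::nat. 2 \<le> k}
       (\<lambda>k. atom ((p E5 * p E3 ^ (k - 2)) powr q * (\<rho> * r ^ (k - 2)) powr (- \<alpha>))
                 (- ln (\<rho> * r ^ (k - 2))))"
| "renewal_entry \<rho> r p q \<alpha> C4 C3 = atom (p E4 powr q * r powr (- \<alpha>)) (- ln r)"
| "renewal_entry \<rho> r p q \<alpha> C4 C4 = atom (p E4 powr q * r powr (- \<alpha>)) (- ln r)"
| "renewal_entry \<rho> r p q \<alpha> _ _ = null_measure borel"

text \<open>Convolution powers of the block of \<open>A\<close> with rows and columns in \<open>J\<close>.\<close>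

fun conv_power :: "cell set \<Rightarrow> (cell \<Rightarrow> cell \<Rightarrow> real measure) \<Rightarrow> nat \<Rightarrow> cell \<Rightarrow> cell \<Rightarrow> real measure" where
  "conv_power J A 0 i j = (if i = j then return borel 0 else null_measure borel)"
| "conv_power J A (Suc n) i j = msum J (\<lambda>k. conv_power J A n i k \<star> A k j)"

definition \<nu>\<^sub>1 :: "real \<Rightarrow> real \<Rightarrow> (edge \<Rightarrow> real) \<Rightarrow> real \<Rightarrow> real \<Rightarrow> real measure" where
  "\<nu>\<^sub>1 \<rho> r p q \<alpha> =
     (let A = renewal_entry \<rho> r p q \<alpha>; J = {C3, C4}
      in madd (A C1 C1)
           (msum (UNIV \<times> J \<times> J) (\<lambda>(n, i, j). A C1 i \<star> (conv_power J A n i j \<star> A j C1))))"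


section \<open>The admissible range of $\alpha$\<close>

text \<open>
  The nonzero diagonal entry of $N$ has mass $Q_{4,r}$, so $\sum_n N^{*n}$ in $\nu_1$ has finite
  mass precisely when $Q_{4,r} < 1$. Only in this range is a zero of $H(q, \cdot)$ unique: on the
  whole line there are at least two zeros for every \<open>q > 1\<close>, the additional ones having
  $Q_{4,r} > 1$, as \<open>H_not_unique_zero\<close> below records. The zero with $Q_{4,r} < 1$ is the smallest one,
  because $Q_{4,r}$ increases with $\alpha$.
\<close>

lemma powr_add_strict_superadditive:
  fixes a b q :: real
  assumes "a > 0" "b > 0" "q > 1"
  shows "a powr q + b powr q < (a + b) powr q"
proof -
  have *: "x powr q = x * x powr (q - 1)" if "x > 0" for x :: real
    using that by (simp add: powr_mult_base)
  have "a * a powr (q - 1) < a * (a + b) powr (q - 1)"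
    using assms by (intro mult_strict_left_mono powr_less_mono2) auto
  moreover have "b * b powr (q - 1) < b * (a + b) powr (q - 1)"
    using assms by (intro mult_strict_left_mono powr_less_mono2) auto
  moreover have "(a + b) powr q = a * (a + b) powr (q - 1) + b * (a + b) powr (q - 1)"
    using assms by (simp add: *[of "a + b"] distrib_right)
  ultimately show ?thesis
    using assms by (simp only: *[of a] *[of b])
qed

lemma H_not_unique_zero:
  fixes \<rho> r q :: real and p :: "edge \<Rightarrow> real"
  assumes \<rho>: "0 < \<rho>" "\<rho> < 1" and r: "0 < r" "r < 1" and p: "\<And>e. p e > 0" and q: "q > 1"
  shows "\<exists>\<alpha> \<beta>. Q (p E4) r q \<alpha> < 1 \<and> 1 < Q (p E4) r q \<beta> \<and> H \<rho> r p q \<alpha> = 0 \<and> H \<rho> r p q \<beta> = 0"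
proof -
  define a0 where "a0 = q * ln (p E4) / ln r"
  note pos = p[of E1] p[of E2] p[of E3] p[of E4] p[of E5]
  have pos6: "p E1 * p E3 + p E2 * p E5 > 0"
    using pos by (simp add: add_pos_pos)
  have \<rho>r: "0 < \<rho> * r" "\<rho> * r < 1"
    using \<rho> r mult_strict_mono[of \<rho> 1 r 1] by auto
  have Q_pos: "Q w s q a > 0" if "w > 0" "s > 0" for w s a
    using that by (simp add: Q_def)
  have Q_mono: "Q w s q a < Q w s q b" if "w > 0" "0 < s" "s < 1" "a < b" for w s a b
    using that unfolding Q_def by (intro mult_strict_left_mono powr_less_mono') auto
  have Q_cont: "continuous_on UNIV (Q w s q)" if "s > 0" for w s
    unfolding Q_def using that by (auto intro!: continuous_intros)
  have Q_lim: "(Q w s q \<longlongrightarrow> 0) at_bot" if "0 < s" "s < 1" for w s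
  proof -
    have "filterlim (\<lambda>a. (- ln s) * a) at_bot at_bot"
      using that by (intro filterlim_tendsto_pos_mult_at_bot[OF tendsto_const _ filterlim_ident]) auto
    then have "((\<lambda>a. w powr q * exp ((- ln s) * a)) \<longlongrightarrow> w powr q * 0) at_bot"
      by (intro tendsto_mult tendsto_const filterlim_compose[OF exp_at_bot])
    moreover have "Q w s q = (\<lambda>a. w powr q * exp ((- ln s) * a))"
      using that by (auto simp: Q_def powr_def[of s] mult.commute)
    ultimately show ?thesis by simp
  qed
  have H_cont: "continuous_on UNIV (H \<rho> r p q)"
    unfolding H_def using \<rho> r \<rho>r
    by (intro continuous_intros Q_cont) auto
  have H_lim: "(H \<rho> r p q \<longlongrightarrow> (1 - 0) * ((1 - 0) * (1 - 0) - 0) - 0 * 0 * 0) at_bot"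
    unfolding H_def using \<rho> r \<rho>r by (intro tendsto_intros Q_lim) auto
  have Q4_a0: "Q (p E4) r q a0 = 1"
    using pos r by (simp add: Q_def a0_def powr_def exp_add[symmetric])
  have H_a0: "H \<rho> r p q a0 < 0"
    unfolding H_def Q4_a0 using Q_pos[OF pos(2) r(1), of a0] Q_pos[OF pos(5) \<rho>(1), of a0] by simp
  have "eventually (\<lambda>a. H \<rho> r p q a > 0) at_bot"
    using order_tendstoD(1)[OF H_lim, of 0] by simp
  then obtain a1 where a1: "a1 < a0" "H \<rho> r p q a1 > 0"
    by (metis (no_types, lifting) eventually_at_bot_linorder linorder_not_le lt_ex order_less_imp_le
        order_le_less_trans)
  obtain \<alpha> where \<alpha>: "a1 \<le> \<alpha>" "\<alpha> \<le> a0" "H \<rho> r p q \<alpha> = 0"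
    using IVT2'[of "H \<rho> r p q" a0 0 a1] a1 H_a0 continuous_on_subset[OF H_cont] by force
  have "\<alpha> < a0" using \<alpha> H_a0 by (cases "\<alpha> = a0") auto

  define c where "c = (p E1 * p E3 + p E2 * p E5) powr q - (p E1 * p E3) powr q"
  define e where "e = (p E4 powr q) * (c - (p E2 * p E5) powr q)"
  define K where "K = (p E1 powr q + p E3 powr q + c + p E4 powr q) / e"
  have c: "c > (p E2 * p E5) powr q"
    using powr_add_strict_superadditive[of "p E1 * p E3" "p E2 * p E5" q] pos q
    by (simp add: c_def)
  then have c0: "c > 0" by (meson le_less_trans powr_ge_zero)
  have e: "e > 0" using c pos by (simp add: e_def)
  have H_ge: "H \<rho> r p q a > 0" if a: "a \<ge> 0" "r powr (- a) > K" for a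
  proof -
    define x where "x = \<rho> powr (- a)"
    define y where "y = r powr (- a)"
    have x: "x \<ge> 1" and y: "y \<ge> 1"
      using \<rho> r a by (auto simp: x_def y_def powr_minus one_le_inverse_iff powr_le1)
    have xy: "x * y \<ge> x" "x * y \<ge> y" "x * y > 0"
      using x y by (auto simp: mult_le_cancel_left1 mult_le_cancel_right1)
    have s1: "p E1 powr q * x \<le> p E1 powr q * (x * y)"
      and s2: "p E3 powr q * y \<le> p E3 powr q * (x * y)"
      and s3: "p E4 powr q * y \<le> p E4 powr q * (x * y)"
      using xy by (auto intro!: mult_left_mono simp del: mult_le_cancel_left1 mult_le_cancel_right1)
    have n1: "0 \<le> p E4 powr q * p E1 powr q * (x * y)"
      and n2: "0 \<le> p E4 powr q * p E3 powr q * y\<^sup>2"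
      using x y by (simp_all only: zero_le_mult_iff powr_ge_zero zero_le_power2) auto
    have "H \<rho> r p q a = 1 - p E1 powr q * x - p E3 powr q * y - c * (x * y) - p E4 powr q * y
       + p E4 powr q * p E1 powr q * (x * y) + p E4 powr q * p E3 powr q * y\<^sup>2 + e * y * (x * y)"
      using pos \<rho> r
      by (simp add: H_def Q_def c_def e_def x_def y_def powr_mult algebra_simps power2_eq_square)
    also have "\<dots> \<ge> 1 - p E1 powr q * (x * y) - p E3 powr q * (x * y) - c * (x * y)
       - p E4 powr q * (x * y) + e * y * (x * y)"
      using s1 s2 s3 n1 n2 by linarith
    moreover have "(p E1 powr q + p E3 powr q + c + p E4 powr q) * (x * y) < e * y * (x * y)"
      using a(2) e xy(3) unfolding K_def y_def[symmetric]
      by (intro mult_strict_right_mono) (simp_all add: field_simps)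
    ultimately show ?thesis by (simp add: algebra_simps)
  qed
  define a2 where "a2 = max (max 0 a0) (ln (\<bar>K\<bar> + 1) / - ln r)"
  have "ln (\<bar>K\<bar> + 1) \<le> - a2 * ln r"
  proof -
    have "ln (\<bar>K\<bar> + 1) / - ln r \<le> a2" by (simp add: a2_def)
    then show ?thesis using r by (simp add: field_simps)
  qed
  then have "exp (ln (\<bar>K\<bar> + 1)) \<le> exp (- a2 * ln r)"
    by (simp only: exp_le_cancel_iff)
  then have "\<bar>K\<bar> + 1 \<le> r powr (- a2)"
    using r by (simp add: powr_def)
  then have "r powr (- a2) > K" by linarith
  then have H_a2: "H \<rho> r p q a2 > 0" and "a0 \<le> a2"
    by (auto intro!: H_ge simp: a2_def)
  then obtain \<beta> where \<beta>: "a0 \<le> \<beta>" "H \<rho> r p q \<beta> = 0"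
    using IVT'[of "H \<rho> r p q" a0 0 a2] H_a0 continuous_on_subset[OF H_cont] by force
  have "a0 < \<beta>" using \<beta> H_a0 by (cases "\<beta> = a0") auto
  show ?thesis
    using Q_mono[OF pos(4) r \<open>\<alpha> < a0\<close>] Q_mono[OF pos(4) r \<open>a0 < \<beta>\<close>] Q4_a0 \<alpha>(3) \<beta>(2) by auto
qed

end

theory Submission
  imports Defs "HOL-Real_Asymp.Real_Asymp"
begin

text \<open>
  The maps overlap exactly: $S_{e_1} \circ S_{e_3} = S_{e_2} \circ S_{e_5}$. The overlap disappears if
  the line is cut one level deeper. Let $\ell = \rho + r - \rho r$ be the right end of
  $S_{e_1}[0,1] \cup S_{e_2}[0,1]$. Every combination $a\mu_1 + b\mu_2$ lives on four closed intervals
  with disjoint interiors, and inside these intervals it is an affine image of a multiple of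
  $\mu_1|_{(0,\ell)}$, of $\mu_1$, of $\mu_2$, and of $a p_{e_3}\mu_1 + b p_{e_4}\mu_2$, respectively.
  The two compositions above give the same interval, and their weights add up to the factor
  $p_{e_1}p_{e_3} + p_{e_2}p_{e_5}$ in the definition of $H$. The price is the last interval: there the
  ratio $a : b$ changes, unless $a = 0$ or $b = 0$.

  Raise the mass of $B_h(x)$ to the power $q$ and integrate: over $(0,\ell)$ and over $(0,1)$ for
  $\mu_1$, over $(0,1)$ for $\mu_2$. With $x = -\ln h$ and after multiplication with $e^{(1+\alpha)x}$
  these three functions satisfy a finite system of renewal equations (\<open>Z_renewal\<close>). Its matrix has a
  positive eigenvector with eigenvalue $1$ exactly because $H(q,\alpha) = 0$ (\<open>mass_eig\<close>). The error
  terms come from balls that are not contained in one of the four intervals. They are nonnegative, as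
  dropping mass only makes an integral smaller; and they are $O(e^{-\varepsilon x})$ with
  $\varepsilon > 0$, because a ball with an error is centred near one of finitely many endpoints, and
  there the mass decays like $h^\kappa$ with $q\kappa > \alpha$. The latter is the meaning of
  $Q_{1,\rho}, Q_{3,r}, Q_{4,r} < 1$: all endpoints are images of $0$ and $1$, and near $0$ or $1$ only
  one of the maps $S_{e_1}, S_{e_3}, S_{e_4}$ is iterated.

  The renewal theorem for such a system (\<open>renewal_lattice\<close>, \<open>renewal_dense\<close>) rests on two observations.
  A lower bound for the solution on a window as long as the largest step persists forever, up to an
  exponentially small loss (\<open>persistence\<close>). And if the solution is close to its limes superior at $x$,
  then, being an average of earlier values, it is also close to it at $x - s$ for every length $s$ of a
  path (\<open>near_limsup_propagates\<close>). The lengths of paths are the sums $M(-\ln\rho) + K(-\ln r)$ up to a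
  constant; they eventually become dense, or they eventually exhaust the multiples of some $d > 0$. So
  the solution is close to its limes superior on a whole window, and hence forever. In the dense case the
  gaps between the lengths are bridged by monotonicity of the ball masses in $h$.

  The same two observations bound the solution between positive constants, so the integrals are
  comparable to $h^{1+\alpha}$, and a comparison of packings with integrals gives $\tau(q) = \alpha$. The
  functions $\varphi_\ell$ belong to $\mu_1 + \mu_2$. Those of the first two cells are finite
  combinations of solutions of the renewal system, up to $O(e^{-\varepsilon x})$. For the last cell one
  unfolds the change of the ratio $a : b$ again and again; the $n$-th remainder is of order
  $\max(Q_{3,r}, Q_{4,r})^n$. Finally, $\nu_1$ charges $-\ln\rho$ and $-\ln\rho - \ln r$ and is carried
  by the group that they generate, so it is lattice exactly if this group is cyclic.
\<close>


section \<open>Asymptotic periodicity\<close>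

definition subgroup_reals :: "real set \<Rightarrow> bool" where
  "subgroup_reals G \<longleftrightarrow> 0 \<in> G \<and> (\<forall>x\<in>G. \<forall>y\<in>G. x + y \<in> G) \<and> (\<forall>x\<in>G. - x \<in> G)"

text \<open>
  For \<open>G = UNIV\<close> this is convergence at infinity, for $G = d\mathbb{Z}$ it is approach to a
  $d$-periodic function. Treating both at once lets the lattice and the non-lattice case share their
  proofs.
\<close>

definition asym_periodic :: "real set \<Rightarrow> (real \<Rightarrow> real) \<Rightarrow> bool" where
  "asym_periodic G Y \<longleftrightarrow> (\<exists>f. (\<forall>x. \<forall>g\<in>G. f (x + g) = f x) \<and> ((\<lambda>x. Y x - f x) \<longlongrightarrow> 0) at_top)"

text \<open>
  The limes superior at infinity along the coset $x + G$, jointly over all components of \<open>D\<close>.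
\<close>

definition coset_limsup :: "real set \<Rightarrow> ('i \<Rightarrow> real \<Rightarrow> real) \<Rightarrow> real \<Rightarrow> real" where
  "coset_limsup G D x = Inf {b. \<exists>X. \<forall>i. \<forall>y\<ge>X. y - x \<in> G \<longrightarrow> D i y \<le> b}"

lemma subgroup_realsD:
  assumes "subgroup_reals G"
  shows "0 \<in> G" "x \<in> G \<Longrightarrow> y \<in> G \<Longrightarrow> x + y \<in> G" "x \<in> G \<Longrightarrow> - x \<in> G"
    "x \<in> G \<Longrightarrow> y \<in> G \<Longrightarrow> x - y \<in> G"
proof -
  show "0 \<in> G" "x \<in> G \<Longrightarrow> y \<in> G \<Longrightarrow> x + y \<in> G" "x \<in> G \<Longrightarrow> - x \<in> G"
    using assms unfolding subgroup_reals_def by auto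
  show "x \<in> G \<Longrightarrow> y \<in> G \<Longrightarrow> x - y \<in> G"
    using assms unfolding subgroup_reals_def by (metis diff_conv_add_uminus)
qed

lemma subgroup_reals_mult:
  assumes "subgroup_reals G" "g \<in> G"
  shows "real n * g \<in> G"
  by (induction n) (use assms subgroup_realsD in \<open>auto simp: distrib_right\<close>)

lemma subgroup_reals_unbounded:
  assumes "subgroup_reals G" "g \<in> G" "g > 0"
  obtains y where "y \<ge> X" "y - x \<in> G"
proof -
  obtain n where "real n * g > X - x"
    using ex_less_of_nat_mult[OF assms(3)] by blast
  then show ?thesis
    using subgroup_reals_mult[OF assms(1,2), of n] that[of "x + real n * g"] by auto
qed

lemma coset_limsup_periodic:
  assumes "subgroup_reals G" "g \<in> G"
  shows "coset_limsup G D (x + g) = coset_limsup G D x"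
proof -
  have "y - (x + g) \<in> G \<longleftrightarrow> y - x \<in> G" for y
    using subgroup_realsD(2)[OF assms(1) _ assms(2), of "y - (x + g)"]
      subgroup_realsD(4)[OF assms(1) _ assms(2), of "y - x"]
    by (auto simp: algebra_simps)
  then show ?thesis unfolding coset_limsup_def by simp
qed

lemma
  fixes D :: "'i \<Rightarrow> real \<Rightarrow> real"
  assumes G: "subgroup_reals G" "g \<in> G" "g > 0"
  shows coset_limsup_le: "(\<And>i y. y \<ge> X \<Longrightarrow> y - x \<in> G \<Longrightarrow> \<bar>D i y\<bar> \<le> B) \<Longrightarrow>
      (\<And>i y. y \<ge> X \<Longrightarrow> y - x \<in> G \<Longrightarrow> D i y \<le> b) \<Longrightarrow> coset_limsup G D x \<le> b"
    and coset_limsup_ge: "(\<And>i y. y \<ge> X \<Longrightarrow> y - x \<in> G \<Longrightarrow> \<bar>D i y\<bar> \<le> B) \<Longrightarrow>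
      (\<And>i y. y \<ge> X \<Longrightarrow> y - x \<in> G \<Longrightarrow> D i y \<ge> b) \<Longrightarrow> coset_limsup G D x \<ge> b"
    and coset_limsup_less: "(\<And>i y. y \<ge> X \<Longrightarrow> y - x \<in> G \<Longrightarrow> \<bar>D i y\<bar> \<le> B) \<Longrightarrow> coset_limsup G D x < b \<Longrightarrow>
      \<exists>X. \<forall>i. \<forall>y\<ge>X. y - x \<in> G \<longrightarrow> D i y \<le> b"
proof -
  let ?T = "{b. \<exists>X. \<forall>i. \<forall>y\<ge>X. y - x \<in> G \<longrightarrow> D i y \<le> b}"
  have low: "b \<ge> c" if b: "b \<in> ?T" and c: "\<And>i y. y \<ge> X \<Longrightarrow> y - x \<in> G \<Longrightarrow> D i y \<ge> c" for b c
  proof -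
    obtain X' where X': "\<And>i y. y \<ge> X' \<Longrightarrow> y - x \<in> G \<Longrightarrow> D i y \<le> b" using b by auto
    obtain y where "y \<ge> max X X'" "y - x \<in> G"
      using subgroup_reals_unbounded[OF G] by blast
    then show ?thesis using X'[of y] c[of y] by (meson max.bounded_iff order_trans)
  qed
  have bdd: "bdd_below ?T" if "\<And>i y. y \<ge> X \<Longrightarrow> y - x \<in> G \<Longrightarrow> \<bar>D i y\<bar> \<le> B"
  proof (rule bdd_belowI[of _ "- B"], rule low)
    fix i y assume "y \<ge> X" "y - x \<in> G"
    from that[OF this, of i] show "D i y \<ge> - B" by linarith
  qed
  have ne: "B \<in> ?T" if "\<And>i y. y \<ge> X \<Longrightarrow> y - x \<in> G \<Longrightarrow> \<bar>D i y\<bar> \<le> B"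
    using that by (auto simp: abs_le_iff)
  show "coset_limsup G D x \<le> b" if "\<And>i y. y \<ge> X \<Longrightarrow> y - x \<in> G \<Longrightarrow> \<bar>D i y\<bar> \<le> B"
      "\<And>i y. y \<ge> X \<Longrightarrow> y - x \<in> G \<Longrightarrow> D i y \<le> b"
  proof -
    have "b \<in> ?T" using that(2) by blast
    then show ?thesis unfolding coset_limsup_def using bdd[OF that(1)] by (rule cInf_lower)
  qed
  show "coset_limsup G D x \<ge> b" if "\<And>i y. y \<ge> X \<Longrightarrow> y - x \<in> G \<Longrightarrow> \<bar>D i y\<bar> \<le> B"
      "\<And>i y. y \<ge> X \<Longrightarrow> y - x \<in> G \<Longrightarrow> D i y \<ge> b"
    unfolding coset_limsup_def
  proof (rule cInf_greatest)
    show "?T \<noteq> {}" using ne[OF that(1)] by blast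
    show "b \<le> b'" if "b' \<in> ?T" for b' by (rule low[OF that]) fact
  qed
  show "\<exists>X. \<forall>i. \<forall>y\<ge>X. y - x \<in> G \<longrightarrow> D i y \<le> b" if "\<And>i y. y \<ge> X \<Longrightarrow> y - x \<in> G \<Longrightarrow> \<bar>D i y\<bar> \<le> B"
      and less: "coset_limsup G D x < b"
  proof -
    have "?T \<noteq> {}" using ne[OF that(1)] by blast
    then obtain b' where "b' \<in> ?T" "b' < b"
      using cInf_lessD[OF _ less[unfolded coset_limsup_def]] by blast
    then obtain X' where "\<And>i y. y \<ge> X' \<Longrightarrow> y - x \<in> G \<Longrightarrow> D i y \<le> b'" by blast
    then have "\<forall>i. \<forall>y\<ge>X'. y - x \<in> G \<longrightarrow> D i y \<le> b"
      using \<open>b' < b\<close> by (metis less_imp_le order_trans)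
    then show ?thesis by blast
  qed
qed

lemma asym_periodic_cong_o:
  assumes "asym_periodic G Y" "((\<lambda>x. Y' x - Y x) \<longlongrightarrow> 0) at_top"
  shows "asym_periodic G Y'"
proof -
  obtain f where f: "\<forall>x. \<forall>g\<in>G. f (x + g) = f x" "((\<lambda>x. Y x - f x) \<longlongrightarrow> 0) at_top"
    using assms(1) unfolding asym_periodic_def by blast
  have "((\<lambda>x. Y' x - f x) \<longlongrightarrow> 0) at_top" using tendsto_add[OF assms(2) f(2)] by simp
  then show ?thesis using f(1) unfolding asym_periodic_def by blast
qed

lemma asym_periodic_add:
  assumes "asym_periodic G Y" "asym_periodic G Y'"
  shows "asym_periodic G (\<lambda>x. Y x + Y' x)"
proof -
  obtain f f' where f: "\<forall>x. \<forall>g\<in>G. f (x + g) = f x" "((\<lambda>x. Y x - f x) \<longlongrightarrow> 0) at_top"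
    and f': "\<forall>x. \<forall>g\<in>G. f' (x + g) = f' x" "((\<lambda>x. Y' x - f' x) \<longlongrightarrow> 0) at_top"
    using assms unfolding asym_periodic_def by blast
  have "((\<lambda>x. (Y x + Y' x) - (f x + f' x)) \<longlongrightarrow> 0) at_top"
    using tendsto_add[OF f(2) f'(2)] by (simp add: algebra_simps)
  then show ?thesis using f(1) f'(1) unfolding asym_periodic_def by (intro exI[of _ "\<lambda>x. f x + f' x"]) auto
qed

lemma asym_periodic_cmult:
  assumes "asym_periodic G Y"
  shows "asym_periodic G (\<lambda>x. c * Y x)"
proof -
  obtain f where f: "\<forall>x. \<forall>g\<in>G. f (x + g) = f x" "((\<lambda>x. Y x - f x) \<longlongrightarrow> 0) at_top"
    using assms unfolding asym_periodic_def by blast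
  have "((\<lambda>x. c * Y x - c * f x) \<longlongrightarrow> 0) at_top"
    using tendsto_mult_left[OF f(2), of c] by (simp add: algebra_simps)
  then show ?thesis using f(1) unfolding asym_periodic_def by (intro exI[of _ "\<lambda>x. c * f x"]) auto
qed

lemma asym_periodic_shift:
  assumes "asym_periodic G Y"
  shows "asym_periodic G (\<lambda>x. Y (x - t))"
proof -
  obtain f where f: "\<forall>x. \<forall>g\<in>G. f (x + g) = f x" "((\<lambda>x. Y x - f x) \<longlongrightarrow> 0) at_top"
    using assms unfolding asym_periodic_def by blast
  have "filterlim (\<lambda>x. x - t) at_top (at_top :: real filter)" by real_asymp
  from filterlim_compose[OF f(2) this] have "((\<lambda>x. Y (x - t) - f (x - t)) \<longlongrightarrow> 0) at_top" .
  moreover have "f (x + g - t) = f (x - t)" if "g \<in> G" for x g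
    using f(1)[rule_format, OF that, of "x - t"] by (simp add: algebra_simps)
  ultimately show ?thesis unfolding asym_periodic_def by (intro exI[of _ "\<lambda>x. f (x - t)"]) auto
qed

text \<open>
  A periodic function for \<open>Y\<close> itself is its limes superior along the cosets: it is within \<open>2 * \<eta>\<close> of
  the periodic function of every approximation, since a coset is unbounded above.
\<close>

lemma asym_periodic_uniform_limit:
  assumes G: "subgroup_reals G" "g \<in> G" "g > 0"
    and approx: "\<And>\<eta>. \<eta> > 0 \<Longrightarrow> \<exists>Y'. asym_periodic G Y' \<and> eventually (\<lambda>x. \<bar>Y x - Y' x\<bar> \<le> \<eta>) at_top"
  shows "asym_periodic G Y"
  unfolding asym_periodic_def
proof (intro exI[of _ "coset_limsup G (\<lambda>_::unit. Y)"] conjI allI ballI)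
  let ?f = "coset_limsup G (\<lambda>_::unit. Y)"
  show "?f (x + h) = ?f x" if "h \<in> G" for x h using coset_limsup_periodic[OF G(1) that] .
  show "((\<lambda>x. Y x - ?f x) \<longlongrightarrow> 0) at_top"
  proof (rule tendstoI)
    fix e :: real assume e: "e > 0"
    define \<eta> where "\<eta> = e / 5"
    have \<eta>: "\<eta> > 0" unfolding \<eta>_def using e by simp
    obtain Y' f' where Y': "eventually (\<lambda>x. \<bar>Y x - Y' x\<bar> \<le> \<eta>) at_top"
      and per: "\<And>x g. g \<in> G \<Longrightarrow> f' (x + g) = f' x" and f': "((\<lambda>x. Y' x - f' x) \<longlongrightarrow> 0) at_top"
      using approx[OF \<eta>] unfolding asym_periodic_def by blast
    have "eventually (\<lambda>x. dist (Y' x - f' x) 0 < \<eta>) at_top" using tendstoD[OF f' \<eta>] .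
    with Y' have "eventually (\<lambda>x. \<bar>Y x - f' x\<bar> \<le> 2 * \<eta>) at_top"
      by eventually_elim (simp add: dist_real_def)
    then obtain X where X: "\<And>x. x \<ge> X \<Longrightarrow> \<bar>Y x - f' x\<bar> \<le> 2 * \<eta>"
      unfolding eventually_at_top_linorder by blast
    have coset: "\<bar>Y y - f' x\<bar> \<le> 2 * \<eta>" if "y \<ge> X" "y - x \<in> G" for x y
      using X[OF that(1)] per[OF that(2), of x] by simp
    have f_le: "?f x \<le> f' x + 2 * \<eta>" for x
    proof (rule coset_limsup_le[OF G, of X x _ "\<bar>f' x\<bar> + 2 * \<eta>"])
      fix y assume "y \<ge> X" "y - x \<in> G"
      from coset[OF this] show "\<bar>Y y\<bar> \<le> \<bar>f' x\<bar> + 2 * \<eta>" "Y y \<le> f' x + 2 * \<eta>" by linarith+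
    qed
    have f_ge: "?f x \<ge> f' x - 2 * \<eta>" for x
    proof (rule coset_limsup_ge[OF G, of X x _ "\<bar>f' x\<bar> + 2 * \<eta>"])
      fix y assume "y \<ge> X" "y - x \<in> G"
      from coset[OF this] show "\<bar>Y y\<bar> \<le> \<bar>f' x\<bar> + 2 * \<eta>" "Y y \<ge> f' x - 2 * \<eta>" by linarith+
    qed
    show "eventually (\<lambda>x. dist (Y x - ?f x) 0 < e) at_top"
      unfolding eventually_at_top_linorder
    proof (intro exI[of _ X] allI impI)
      fix x assume "x \<ge> X"
      from X[OF this] f_le[of x] f_ge[of x] have "\<bar>Y x - ?f x\<bar> \<le> 4 * \<eta>" by linarith
      also have "\<dots> < e" unfolding \<eta>_def using e by simp
      finally show "dist (Y x - ?f x) 0 < e" by (simp add: dist_real_def)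
    qed
  qed
qed


section \<open>A renewal theorem for finite systems\<close>

lemma exp_decay: "e > 0 \<Longrightarrow> ((\<lambda>x::real. C * exp (- e * x)) \<longlongrightarrow> 0) at_top"
  by real_asymp

text \<open>
  A finite system in which the component \<open>i\<close> at \<open>x\<close> is, up to an error, the average with weights
  \<open>w i k\<close> of the components \<open>dst i k\<close> at \<open>x - len k\<close>. The group \<open>G\<close> contains all steps, so the system
  splits into independent systems on the cosets of \<open>G\<close>.
\<close>

locale renewal_system =
  fixes w :: "'i::finite \<Rightarrow> 'k::finite \<Rightarrow> real" and dst :: "'i \<Rightarrow> 'k \<Rightarrow> 'i"
    and len :: "'k \<Rightarrow> real" and G :: "real set"
  assumes w_nonneg: "w i k \<ge> 0" and w_sum: "(\<Sum>k\<in>UNIV. w i k) = 1"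
    and len_pos: "len k > 0" and G: "subgroup_reals G" and len_in: "len k \<in> G"
begin

definition memory :: real where "memory = Max (range len)"

definition gap :: real where "gap = Min (range len)"

lemma len_le: "len k \<le> memory" and len_ge: "gap \<le> len k"
  unfolding memory_def gap_def by auto

lemma gap_pos: "gap > 0" and memory_pos: "memory > 0"
proof -
  show "gap > 0" unfolding gap_def using len_pos by (auto simp: Min_gr_iff)
  then show "memory > 0" using len_le len_ge by (meson order_less_le_trans)
qed

definition solves :: "real \<Rightarrow> real \<Rightarrow> ('i \<Rightarrow> real \<Rightarrow> real) \<Rightarrow> bool" where
  "solves C \<epsilon> D \<longleftrightarrow>
     (\<forall>i x. \<bar>D i x - (\<Sum>k\<in>UNIV. w i k * D (dst i k) (x - len k))\<bar> \<le> C * exp (- \<epsilon> * x))"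

inductive reach :: "'i \<Rightarrow> real \<Rightarrow> 'i \<Rightarrow> bool" where
  reach_refl: "reach i 0 i"
| reach_step: "w i k > 0 \<Longrightarrow> reach (dst i k) s j \<Longrightarrow> reach i (len k + s) j"

lemma reach_trans: "reach i s j \<Longrightarrow> reach j t k \<Longrightarrow> reach i (s + t) k"
proof (induction rule: reach.induct)
  case (reach_step i k s j)
  then show ?case using reach.reach_step[of i k "s + t"] by (simp add: add.assoc)
qed auto

text \<open>
  Compare \<open>D\<close> with a barrier that has the value \<open>\<theta>\<close> at the beginning of the window and
  decreases by exactly as much as the errors can add up to. The average of the barrier over one step back
  exceeds its present value by at least the error, because every step is at least \<open>gap\<close> long.
\<close>

lemma persistence:
  assumes C: "C \<ge> 0" and \<epsilon>: "\<epsilon> > 0"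
    and super: "\<And>i x. x \<ge> x0 \<Longrightarrow>
      D i x \<ge> (\<Sum>k\<in>UNIV. w i k * D (dst i k) (x - len k)) - C * exp (- \<epsilon> * x)"
    and window: "\<And>i t. t \<in> G \<Longrightarrow> 0 \<le> t \<Longrightarrow> t \<le> memory \<Longrightarrow> D i (x0 - t) \<ge> \<theta>"
    and t: "t \<in> G" "t \<ge> 0"
  shows "D i (x0 + t) \<ge> \<theta> - C * exp (\<epsilon> * memory) / (exp (\<epsilon> * gap) - 1) * exp (- \<epsilon> * x0)"
proof -
  have eg: "exp (\<epsilon> * gap) > 1" using gap_pos \<epsilon> by simp
  define K where "K = C / (exp (\<epsilon> * gap) - 1)"
  have K: "K \<ge> 0" unfolding K_def using C eg by simp
  \<comment> \<open>the barrier\<close>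
  define L where "L y = \<theta> - K * exp (- \<epsilon> * (x0 - memory)) + K * exp (- \<epsilon> * y)" for y
  have key: "D i (x0 + t) \<ge> L (x0 + t)" if "t \<in> G" "- memory \<le> t" "t \<le> real n * gap" for n i t
    using that
  proof (induction n arbitrary: i t)
    case 0
    have "exp (- \<epsilon> * (x0 + t)) \<le> exp (- \<epsilon> * (x0 - memory))"
      using 0 \<epsilon> by (simp add: mult_left_mono)
    then have "L (x0 + t) \<le> \<theta>" unfolding L_def using mult_left_mono[OF _ K] by fastforce
    moreover have "D i (x0 - (- t)) \<ge> \<theta>"
      using 0 by (intro window) (auto intro: subgroup_realsD[OF G])
    ultimately show ?case by simp
  next
    case (Suc n)
    show ?case
    proof (cases "t \<le> real n * gap")
      case True then show ?thesis using Suc by blast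
    next
      case False
      then have t0: "t \<ge> 0" using gap_pos mult_nonneg_nonneg[of "real n" gap] by linarith
      have *: "D (dst i k) (x0 + t - len k) \<ge> L (x0 + t - len k)" for k
      proof -
        have "D (dst i k) (x0 + (t - len k)) \<ge> L (x0 + (t - len k))"
          using Suc.prems t0 len_le[of k] len_ge[of k]
          by (intro Suc.IH) (auto intro: subgroup_realsD[OF G] len_in simp: distrib_right)
        then show ?thesis by (simp add: algebra_simps)
      qed
      have "(\<Sum>k\<in>UNIV. w i k * D (dst i k) (x0 + t - len k))
          \<ge> (\<Sum>k\<in>UNIV. w i k * (L (x0 + t) + C * exp (- \<epsilon> * (x0 + t))))"
      proof (intro sum_mono mult_left_mono w_nonneg)
        fix k
        have "exp (\<epsilon> * gap) \<le> exp (\<epsilon> * len k)" using len_ge \<epsilon> by simp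
        then have le: "K * exp (- \<epsilon> * (x0 + t)) * exp (\<epsilon> * gap) \<le> K * exp (- \<epsilon> * (x0 + t)) * exp (\<epsilon> * len k)"
          using K by (intro mult_left_mono) auto
        have ne: "exp (\<epsilon> * gap) - 1 \<noteq> 0" using eg by linarith
        have C_eq: "C = K * (exp (\<epsilon> * gap) - 1)"
          unfolding K_def by (rule nonzero_eq_divide_eq[THEN iffD1, OF ne refl, symmetric])
        have "K * exp (- \<epsilon> * (x0 + t)) * exp (\<epsilon> * gap)
            = K * exp (- \<epsilon> * (x0 + t)) + C * exp (- \<epsilon> * (x0 + t))"
          unfolding C_eq by (simp add: algebra_simps)
        moreover have "exp (- \<epsilon> * (x0 + t - len k)) = exp (- \<epsilon> * (x0 + t)) * exp (\<epsilon> * len k)"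
          by (simp add: exp_add[symmetric] algebra_simps)
        ultimately have "L (x0 + t) + C * exp (- \<epsilon> * (x0 + t)) \<le> L (x0 + t - len k)"
          unfolding L_def using le by simp
        then show "L (x0 + t) + C * exp (- \<epsilon> * (x0 + t)) \<le> D (dst i k) (x0 + t - len k)"
          using * order_trans by blast
      qed
      also have "(\<Sum>k\<in>UNIV. w i k * (L (x0 + t) + C * exp (- \<epsilon> * (x0 + t))))
          = L (x0 + t) + C * exp (- \<epsilon> * (x0 + t))"
        by (simp add: sum_distrib_right[symmetric] w_sum)
      finally show ?thesis using super[of "x0 + t" i] t0 by simp
    qed
  qed
  obtain n where "real n * gap > t" using ex_less_of_nat_mult[OF gap_pos] by blast
  then have "D i (x0 + t) \<ge> L (x0 + t)" using key[of t n] t memory_pos by simp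
  moreover have "L (x0 + t) \<ge> \<theta> - K * exp (- \<epsilon> * (x0 - memory))"
    unfolding L_def using K by simp
  moreover have "exp (- \<epsilon> * (x0 - memory)) = exp (\<epsilon> * memory) * exp (- \<epsilon> * x0)"
    by (simp add: exp_add[symmetric] algebra_simps)
  ultimately show ?thesis unfolding K_def by simp
qed

text \<open>
  For every component \<open>i\<close> there are finitely many paths from \<open>i\<close> such that a bound for \<open>D\<close> at their
  ends gives a bound, worse by \<open>\<eta>\<close>, on all of a window of length \<open>memory\<close>.
\<close>

definition hits_windows :: "('i \<Rightarrow> real \<Rightarrow> real) \<Rightarrow> bool" where
  "hits_windows D \<longleftrightarrow> (\<forall>i. \<forall>\<eta>>0. \<exists>s0 R X. finite R \<and> (\<forall>(s, j)\<in>R. reach i s j) \<and>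
     (\<forall>x\<ge>X. \<forall>j. \<forall>t\<in>G. 0 \<le> t \<longrightarrow> t \<le> memory \<longrightarrow>
        (\<exists>s. (s, j) \<in> R \<and> D j (x - s0 - t) \<ge> D j (x - s) - \<eta>)))"

text \<open>
  If an average of numbers that are at most \<open>\<beta> + \<delta>'\<close> is at least \<open>\<beta> - \<delta>'\<close>, then each
  of them with weight \<open>w\<close> is at least $\beta - O(\delta' / w)$. Apply this along the path.
\<close>

lemma near_limsup_propagates:
  assumes sol: "solves C \<epsilon> D" and C: "C \<ge> 0" and \<epsilon>: "\<epsilon> > 0"
    and \<beta>: "\<And>\<eta>. \<eta> > 0 \<Longrightarrow> \<exists>X. \<forall>i. \<forall>x\<ge>X. D i x \<le> \<beta> + \<eta>"
    and r: "reach i s j" and \<eta>: "\<eta> > 0"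
  shows "\<exists>\<delta>>0. \<exists>X. \<forall>x\<ge>X. D i x \<ge> \<beta> - \<delta> \<longrightarrow> D j (x - s) \<ge> \<beta> - \<eta>"
  using r
proof (induction rule: reach.induct)
  case (reach_refl i)
  then show ?case using \<eta> by (intro exI[of _ \<eta>]) auto
next
  case (reach_step i k s j)
  then obtain \<delta> X where IH: "\<delta> > 0" "\<And>x. x \<ge> X \<Longrightarrow> D (dst i k) x \<ge> \<beta> - \<delta> \<Longrightarrow> D j (x - s) \<ge> \<beta> - \<eta>"
    by blast
  \<comment> \<open>one share each for the value at \<open>x\<close>, for the error, and for the other components\<close>
  define \<delta>' where "\<delta>' = w i k * \<delta> / 3"
  have \<delta>': "\<delta>' > 0" unfolding \<delta>'_def using IH reach_step by simp
  obtain X1 where X1: "\<And>i x. x \<ge> X1 \<Longrightarrow> D i x \<le> \<beta> + \<delta>'" using \<beta>[OF \<delta>'] by blast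
  have "((\<lambda>x. C * exp (- \<epsilon> * x)) \<longlongrightarrow> 0) at_top"
    using \<epsilon> by real_asymp
  then have "eventually (\<lambda>x. C * exp (- \<epsilon> * x) < \<delta>') at_top"
    using \<delta>' order_tendstoD(2) by blast
  then obtain X2 where X2: "\<And>x. x \<ge> X2 \<Longrightarrow> C * exp (- \<epsilon> * x) < \<delta>'"
    unfolding eventually_at_top_linorder by blast
  have "D j (x - (len k + s)) \<ge> \<beta> - \<eta>" if x: "x \<ge> max (X + memory) (max (X1 + memory) X2)" "D i x \<ge> \<beta> - \<delta>'" for x
  proof -
    have "D i x - (\<Sum>l\<in>UNIV. w i l * D (dst i l) (x - len l)) \<le> \<delta>'"
    proof -
      have "D i x - (\<Sum>l\<in>UNIV. w i l * D (dst i l) (x - len l)) \<le> C * exp (- \<epsilon> * x)"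
        using sol unfolding solves_def by (meson abs_le_D1)
      then show ?thesis using X2[of x] x by simp
    qed
    moreover have "(\<Sum>l\<in>UNIV. w i l * D (dst i l) (x - len l))
        = w i k * D (dst i k) (x - len k) + (\<Sum>l\<in>UNIV - {k}. w i l * D (dst i l) (x - len l))"
      by (simp add: sum.remove[of UNIV k])
    moreover have "(\<Sum>l\<in>UNIV - {k}. w i l * D (dst i l) (x - len l)) \<le> (\<Sum>l\<in>UNIV - {k}. w i l * (\<beta> + \<delta>'))"
    proof (intro sum_mono mult_left_mono w_nonneg X1)
      show "X1 \<le> x - len l" for l using x len_le[of l] by simp
    qed
    moreover have "(\<Sum>l\<in>UNIV - {k}. w i l * (\<beta> + \<delta>')) = (1 - w i k) * (\<beta> + \<delta>')"
      using w_sum[of i] by (simp only: sum_distrib_right[symmetric]) (simp add: sum.remove[of UNIV k])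
    ultimately have "w i k * D (dst i k) (x - len k) \<ge> \<beta> - \<delta>' - \<delta>' - (1 - w i k) * (\<beta> + \<delta>')"
      using x by linarith
    moreover have "w i k * \<delta>' \<ge> 0" using \<delta>' w_nonneg by simp
    ultimately have "w i k * D (dst i k) (x - len k) \<ge> w i k * \<beta> - 3 * \<delta>'"
      by (simp add: algebra_simps)
    then have "w i k * D (dst i k) (x - len k) \<ge> w i k * (\<beta> - \<delta>)"
      unfolding \<delta>'_def by (simp add: algebra_simps)
    then have "D (dst i k) (x - len k) \<ge> \<beta> - \<delta>" using reach_step by simp
    moreover have "x - len k \<ge> X" using x len_le[of k] by simp
    ultimately show ?thesis using IH(2)[of "x - len k"] by (simp add: algebra_simps)
  qed
  then show ?case using \<delta>' by blast
qed

lemma finite_uniform_threshold: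
  fixes \<beta> :: real and f :: "'a \<Rightarrow> real \<Rightarrow> real"
  assumes "finite A" "\<And>a. a \<in> A \<Longrightarrow> \<exists>\<delta>>0. \<exists>X. \<forall>x\<ge>X. f a x \<ge> \<beta> - \<delta> \<longrightarrow> P a x"
  shows "\<exists>\<delta>>0. \<exists>X::real. \<forall>x\<ge>X. \<forall>a\<in>A. f a x \<ge> \<beta> - \<delta> \<longrightarrow> P a x"
  using assms
proof (induction rule: finite_induct)
  case empty
  then show ?case by (intro exI[of _ 1]) auto
next
  case (insert a A)
  then obtain \<delta> X \<delta>' X' where 1: "\<delta> > 0" "\<And>x b. x \<ge> X \<Longrightarrow> b \<in> A \<Longrightarrow> f b x \<ge> \<beta> - \<delta> \<Longrightarrow> P b x"
    and 2: "\<delta>' > 0" "\<And>x. x \<ge> X' \<Longrightarrow> f a x \<ge> \<beta> - \<delta>' \<Longrightarrow> P a x"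
    by (metis insert_iff)
  then show ?case
    by (intro exI[of _ "min \<delta> \<delta>'"] conjI exI[of _ "max X X'"]) auto
qed

text \<open>
  Suppose the limes superior \<open>\<beta>\<close> is positive. A value near \<open>\<beta>\<close> propagates to finitely many earlier
  points, hence to a window, hence, by persistence, to the rest of the coset, on which \<open>D\<close> then stays
  above \<open>\<beta> / 4\<close>. Different cosets may behave differently, so this contradicts only the assumption
  that no coset keeps \<open>D\<close> away from \<open>0\<close> from above.
\<close>

lemma solution_limsup_le_0:
  assumes sol: "solves C \<epsilon> D" and C: "C \<ge> 0" and \<epsilon>: "\<epsilon> > 0"
    and bdd: "\<And>i x. x \<ge> 0 \<Longrightarrow> \<bar>D i x\<bar> \<le> B"
    and hits: "hits_windows D"
    and coset: "\<And>x \<theta> X. \<theta> > 0 \<Longrightarrow> \<exists>i. \<exists>y\<ge>X. y - x \<in> G \<and> D i y < \<theta>"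
    and \<eta>: "\<eta> > 0"
  shows "\<exists>X. \<forall>i. \<forall>x\<ge>X. D i x \<le> \<eta>"
proof (rule ccontr)
  assume contra: "\<not> ?thesis"
  define T where "T = {b. \<exists>X. \<forall>i. \<forall>x\<ge>X. D i x \<le> b}"
  define \<beta> where "\<beta> = Inf T"
  have "B \<in> T" unfolding T_def using bdd by (auto simp: abs_le_iff)
  have T_ge: "b \<ge> \<eta>" if "b \<in> T" for b
    using that contra unfolding T_def by (smt (verit) mem_Collect_eq)
  have bddT: "bdd_below T" using T_ge by (rule bdd_belowI)
  have \<beta>_pos: "\<beta> > 0" using \<eta> cInf_greatest[of T \<eta>] T_ge \<open>B \<in> T\<close> unfolding \<beta>_def by force
  have upper: "\<exists>X. \<forall>i. \<forall>x\<ge>X. D i x \<le> \<beta> + \<eta>'" if "\<eta>' > 0" for \<eta>'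
  proof -
    obtain b where "b \<in> T" "b < \<beta> + \<eta>'"
      using cInf_lessD[of T "\<beta> + \<eta>'"] \<open>B \<in> T\<close> \<open>\<eta>' > 0\<close> unfolding \<beta>_def by force
    then show ?thesis unfolding T_def by (smt (verit) mem_Collect_eq)
  qed
  have "\<forall>i. \<exists>s0 R X. finite R \<and> (\<forall>(s, j)\<in>R. reach i s j) \<and>
     (\<forall>x\<ge>X. \<forall>j. \<forall>t\<in>G. 0 \<le> t \<longrightarrow> t \<le> memory \<longrightarrow>
        (\<exists>s. (s, j) \<in> R \<and> D j (x - s0 - t) \<ge> D j (x - s) - \<beta> / 4))"
    using hits \<beta>_pos unfolding hits_windows_def by simp
  then obtain s0 R X0 where R: "\<And>i. finite (R i)" "\<And>i s j. (s, j) \<in> R i \<Longrightarrow> reach i s j"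
    and hit: "\<And>i x j t. x \<ge> X0 i \<Longrightarrow> t \<in> G \<Longrightarrow> 0 \<le> t \<Longrightarrow> t \<le> memory \<Longrightarrow>
        \<exists>s. (s, j) \<in> R i \<and> D j (x - s0 i - t) \<ge> D j (x - s) - \<beta> / 4"
    by (metis (no_types, lifting) case_prodD)
  let ?A = "SIGMA i:UNIV. R i"
  have "\<exists>\<delta>>0. \<exists>X::real. \<forall>x\<ge>X. \<forall>a\<in>?A.
      D (fst a) x \<ge> \<beta> - \<delta> \<longrightarrow> D (snd (snd a)) (x - fst (snd a)) \<ge> \<beta> - \<beta> / 4"
  proof (rule finite_uniform_threshold[where f = "\<lambda>a. D (fst a)"])
    show "finite ?A" using R by auto
    fix a assume "a \<in> ?A"
    then show "\<exists>\<delta>>0. \<exists>X. \<forall>x\<ge>X. D (fst a) x \<ge> \<beta> - \<delta> \<longrightarrow> D (snd (snd a)) (x - fst (snd a)) \<ge> \<beta> - \<beta> / 4"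
      using near_limsup_propagates[OF sol C \<epsilon> upper, of "fst a" "fst (snd a)" "snd (snd a)" "\<beta> / 4"]
        R(2) \<beta>_pos by auto
  qed
  then obtain \<delta> X1 where \<delta>: "\<delta> > 0" and spread: "\<And>x i s j. x \<ge> X1 \<Longrightarrow> (s, j) \<in> R i \<Longrightarrow>
      D i x \<ge> \<beta> - \<delta> \<Longrightarrow> D j (x - s) \<ge> \<beta> - \<beta> / 4"
    by fastforce
  define K where "K = C * exp (\<epsilon> * memory) / (exp (\<epsilon> * gap) - 1)"
  have "((\<lambda>x. K * exp (- \<epsilon> * x)) \<longlongrightarrow> 0) at_top" using \<epsilon> by real_asymp
  then have "eventually (\<lambda>x. K * exp (- \<epsilon> * x) < \<beta> / 4) at_top"
    using \<beta>_pos order_tendstoD(2) by (metis divide_pos_pos zero_less_numeral)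
  then obtain X2 where X2: "\<And>x. x \<ge> X2 \<Longrightarrow> K * exp (- \<epsilon> * x) < \<beta> / 4"
    unfolding eventually_at_top_linorder by blast
  define X where "X = Max (range (\<lambda>i. max (X0 i) (max X1 (X2 + s0 i))))"
  have X: "X \<ge> X0 i" "X \<ge> X1" "X \<ge> X2 + s0 i" for i
  proof -
    have "X \<ge> max (X0 i) (max X1 (X2 + s0 i))" unfolding X_def by (rule Max_ge) auto
    then show "X \<ge> X0 i" "X \<ge> X1" "X \<ge> X2 + s0 i" by auto
  qed
  have "\<beta> - \<delta> \<notin> T" using cInf_lower[OF _ bddT, of "\<beta> - \<delta>"] \<delta> unfolding \<beta>_def by fastforce
  then obtain i x where x: "x \<ge> X" "D i x \<ge> \<beta> - \<delta>" unfolding T_def by (auto simp: not_le) (meson less_imp_le)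
  define x0 where "x0 = x - s0 i"
  have window: "D j (x0 - t) \<ge> \<beta> / 2" if t: "t \<in> G" "0 \<le> t" "t \<le> memory" for j t
  proof -
    obtain s where s: "(s, j) \<in> R i" "D j (x - s0 i - t) \<ge> D j (x - s) - \<beta> / 4"
      using hit[of i x t j] x X(1)[of i] t by auto
    then show ?thesis using spread[of x s j i] x X(2) unfolding x0_def by (auto simp: field_simps)
  qed
  have super: "D i x \<ge> (\<Sum>k\<in>UNIV. w i k * D (dst i k) (x - len k)) - C * exp (- \<epsilon> * x)" for i x
  proof -
    have "\<bar>D i x - (\<Sum>k\<in>UNIV. w i k * D (dst i k) (x - len k))\<bar> \<le> C * exp (- \<epsilon> * x)"
      using sol unfolding solves_def by blast
    then show ?thesis by linarith
  qed
  have ge: "D j (x0 + t) \<ge> \<beta> / 4" if "t \<in> G" "t \<ge> 0" for j t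
    using persistence[of C \<epsilon> x0 D "\<beta> / 2" t j, OF C \<epsilon> super window that] X2[of x0] x X(3)[of i]
    unfolding K_def x0_def by linarith
  obtain j y where y: "y \<ge> x0" "y - x0 \<in> G" "D j y < \<beta> / 4"
    using coset[of "\<beta> / 4" x0 x0] \<beta>_pos by auto
  then show False using ge[of "y - x0" j] by simp
qed

text \<open>
  Subtracting the limes superior \<open>f\<close> along cosets does not affect the equation, since \<open>f\<close> is
  \<open>G\<close>-periodic and all steps lie in \<open>G\<close>. On each coset \<open>D - f\<close> and \<open>f - D\<close> cannot stay above a positive
  number, by the choice of \<open>f\<close>. So both have limes superior at most \<open>0\<close>, uniformly in the coset.
\<close>

lemma solution_asym_periodic:
  assumes sol: "solves C \<epsilon> D" and C: "C \<ge> 0" and \<epsilon>: "\<epsilon> > 0"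
    and bdd: "\<And>i x. x \<ge> 0 \<Longrightarrow> \<bar>D i x\<bar> \<le> B"
    and hits: "hits_windows (\<lambda>i x. D i x - coset_limsup G D x)"
      "hits_windows (\<lambda>i x. coset_limsup G D x - D i x)"
  shows "asym_periodic G (D i)"
proof -
  let ?f = "coset_limsup G D"
  have per: "?f (x + g) = ?f x" if "g \<in> G" for x g
    using coset_limsup_periodic[OF G that] .
  have per': "?f (x - len k) = ?f x" for x k
    using per[of "- len k" x] len_in G by (auto simp: subgroup_realsD)
  have perd: "?f y = ?f x" if "y - x \<in> G" for x y using per[OF that, of x] by simp
  have sum_f: "(\<Sum>k\<in>UNIV. w i k * (D (dst i k) (x - len k) - ?f (x - len k)))
      = (\<Sum>k\<in>UNIV. w i k * D (dst i k) (x - len k)) - ?f x" for i x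
    by (simp add: per' right_diff_distrib sum_subtractf sum_distrib_right[symmetric] w_sum)
  have sum_f': "(\<Sum>k\<in>UNIV. w i k * (?f (x - len k) - D (dst i k) (x - len k)))
      = ?f x - (\<Sum>k\<in>UNIV. w i k * D (dst i k) (x - len k))" for i x
    by (simp add: per' right_diff_distrib sum_subtractf sum_distrib_right[symmetric] w_sum)
  have g: "len k \<in> G" "len k > 0" for k using len_in len_pos by auto
  note cl = coset_limsup_le[OF G g] coset_limsup_ge[OF G g] coset_limsup_less[OF G g]
  have f_bdd: "\<bar>?f x\<bar> \<le> B" for x
  proof -
    have "?f x \<le> B" by (rule cl(1)[where X = 0 and B = B]) (use bdd in \<open>auto simp: abs_le_iff\<close>)
    moreover have "?f x \<ge> - B"
    proof (rule cl(2)[where X = 0 and B = B])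
      fix i y assume "0 \<le> (y :: real)"
      from bdd[OF this, of i] show "\<bar>D i y\<bar> \<le> B" "D i y \<ge> - B" by linarith+
    qed
    ultimately show ?thesis by auto
  qed
  have 1: "\<exists>X. \<forall>i. \<forall>x\<ge>X. D i x - ?f x \<le> \<eta>" if "\<eta> > 0" for \<eta>
  proof (rule solution_limsup_le_0[OF _ C \<epsilon> _ hits(1) _ that])
    show "solves C \<epsilon> (\<lambda>i x. D i x - ?f x)" using sol unfolding solves_def sum_f by simp
    show "\<bar>D i x - ?f x\<bar> \<le> 2 * B" if "x \<ge> 0" for i x
      using bdd[OF that, of i] f_bdd[of x] by linarith
    show "\<exists>i. \<exists>y\<ge>X. y - x \<in> G \<and> D i y - ?f y < \<theta>" if \<theta>: "\<theta> > 0" for x \<theta> X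
    proof -
      obtain X' where X': "\<And>i y. y \<ge> X' \<Longrightarrow> y - x \<in> G \<Longrightarrow> D i y \<le> ?f x + \<theta> / 2"
        using cl(3)[of 0 x D B "?f x + \<theta> / 2"] bdd \<theta> by auto
      obtain y where "y \<ge> max X X'" "y - x \<in> G"
        using subgroup_reals_unbounded[OF G g] by blast
      then have "y \<ge> X" "D i y - ?f y < \<theta>" for i using X'[of y i] perd[of y x] \<theta> by auto
      then show ?thesis using \<open>y - x \<in> G\<close> by blast
    qed
  qed
  have 2: "\<exists>X. \<forall>i. \<forall>x\<ge>X. ?f x - D i x \<le> \<eta>" if "\<eta> > 0" for \<eta>
  proof (rule solution_limsup_le_0[OF _ C \<epsilon> _ hits(2) _ that])
    show "solves C \<epsilon> (\<lambda>i x. ?f x - D i x)" using sol unfolding solves_def sum_f' by (simp add: abs_minus_commute)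
    show "\<bar>?f x - D i x\<bar> \<le> 2 * B" if "x \<ge> 0" for i x
      using bdd[OF that, of i] f_bdd[of x] by linarith
    show "\<exists>i. \<exists>y\<ge>X. y - x \<in> G \<and> ?f y - D i y < \<theta>" if \<theta>: "\<theta> > 0" for x \<theta> X
    proof (rule ccontr)
      assume "\<not> ?thesis"
      then have **: "\<not> (X \<le> y \<and> y - x \<in> G \<and> ?f y - D i y < \<theta>)" for i y by blast
      have *: "D i y \<le> ?f x - \<theta>" if "y \<ge> max 0 X" "y - x \<in> G" for i y
        using that perd[OF that(2)] **[of y i] by auto
      have "?f x \<le> ?f x - \<theta>"
        by (rule cl(1)[of "max 0 X" x D B]) (use bdd * in auto)
      then show False using \<theta> by simp
    qed
  qed
  show ?thesis
    unfolding asym_periodic_def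
  proof (intro exI[of _ ?f] conjI)
    show "\<forall>x. \<forall>g\<in>G. ?f (x + g) = ?f x" using per by blast
    show "((\<lambda>x. D i x - ?f x) \<longlongrightarrow> 0) at_top"
    proof (rule tendstoI)
      fix \<eta> :: real assume \<eta>: "\<eta> > 0"
      obtain X1 X2 where X1: "\<And>i x. x \<ge> X1 \<Longrightarrow> D i x - ?f x \<le> \<eta> / 2"
        and X2: "\<And>i x. x \<ge> X2 \<Longrightarrow> ?f x - D i x \<le> \<eta> / 2"
        using 1[of "\<eta> / 2"] 2[of "\<eta> / 2"] \<eta> by auto
      show "eventually (\<lambda>x. dist (D i x - ?f x) 0 < \<eta>) at_top"
        unfolding eventually_at_top_linorder
      proof (intro exI[of _ "max X1 X2"] allI impI)
        fix x assume "x \<ge> max X1 X2"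
        then have "D i x - ?f x \<le> \<eta> / 2" "?f x - D i x \<le> \<eta> / 2" using X1 X2 by auto
        then show "dist (D i x - ?f x) 0 < \<eta>" using \<eta> by (simp add: dist_real_def abs_less_iff)
      qed
    qed
  qed
qed

text \<open>
  Here the points of a window on a coset are finite in number, and each of them is reached exactly.
\<close>

theorem renewal_lattice:
  assumes sol: "solves C \<epsilon> D" and C: "C \<ge> 0" and \<epsilon>: "\<epsilon> > 0"
    and bdd: "\<And>i x. x \<ge> 0 \<Longrightarrow> \<bar>D i x\<bar> \<le> B"
    and d: "d > 0" "G = range (\<lambda>n::int. of_int n * d)"
    and arith: "\<And>i j. \<exists>N. \<forall>t\<in>G. t \<ge> N \<longrightarrow> reach i t j"
  shows "asym_periodic G (D i)"
proof -
  have fin: "finite (G \<inter> {0..memory})"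
  proof (rule finite_subset)
    show "G \<inter> {0..memory} \<subseteq> (\<lambda>n::int. of_int n * d) ` {0..\<lfloor>memory / d\<rfloor>}"
      using d(1) by (auto simp: d(2) le_floor_iff field_simps zero_le_mult_iff)
  qed auto
  have hits: "hits_windows E" for E
    unfolding hits_windows_def
  proof (intro allI impI)
    fix i \<eta> assume \<eta>: "\<eta> > (0::real)"
    obtain N where N: "\<And>j t. t \<in> G \<Longrightarrow> t \<ge> N j \<Longrightarrow> reach i t j" using arith[of i] by metis
    obtain s0 where s0: "s0 \<ge> Max (range N)" "s0 - 0 \<in> G"
      using subgroup_reals_unbounded[OF G len_in len_pos] by metis
    define R where "R = (\<lambda>(t, j). (s0 + t, j)) ` ((G \<inter> {0..memory}) \<times> (UNIV :: 'i set))"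
    show "\<exists>s0 R X. finite R \<and> (\<forall>(s, j)\<in>R. reach i s j) \<and>
     (\<forall>x\<ge>X. \<forall>j. \<forall>t\<in>G. 0 \<le> t \<longrightarrow> t \<le> memory \<longrightarrow>
        (\<exists>s. (s, j) \<in> R \<and> E j (x - s0 - t) \<ge> E j (x - s) - \<eta>))"
    proof (rule exI[of _ s0], rule exI[of _ R], rule exI[of _ 0], intro conjI ballI allI impI)
      show "finite R" unfolding R_def using fin by (intro finite_imageI finite_cartesian_product) auto
      fix a assume "a \<in> R"
      then obtain t j where a: "a = (s0 + t, j)" "t \<in> G" "t \<ge> 0" unfolding R_def by auto
      have "N j \<le> s0" using s0(1) by (meson Max_ge finite order_trans rangeI finite_imageI)
      then show "case a of (s, j) \<Rightarrow> reach i s j"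
        using a N[of "s0 + t" j] s0 subgroup_realsD(2)[OF G, of s0 t] by auto
    next
      fix x j t assume "t \<in> G" "0 \<le> t" "t \<le> memory"
      then show "\<exists>s. (s, j) \<in> R \<and> E j (x - s0 - t) \<ge> E j (x - s) - \<eta>"
        using \<eta> unfolding R_def by (intro exI[of _ "s0 + t"]) (auto simp: algebra_simps image_iff)
    qed
  qed
  show ?thesis by (rule solution_asym_periodic[OF sol C \<epsilon> bdd hits hits])
qed

text \<open>
  Place path lengths \<open>\<sigma> n j\<close> at distance about \<open>\<delta>\<close> along an interval longer than \<open>memory\<close>. The
  assumption on \<open>E\<close> transports a bound over all distances in a short interval that begins at \<open>c\<close>, so
  to the right if \<open>c = 0\<close>, and to the left if the interval ends at \<open>0\<close>. The two choices serve \<open>D - f\<close> and \<open>f - D\<close>, for which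
  slow increase points in opposite directions.
\<close>

lemma hits_windows_dense:
  assumes arith: "\<And>i j \<delta>. \<delta> > 0 \<Longrightarrow> \<exists>N. \<forall>t\<ge>N. \<exists>s\<ge>t. s \<le> t + \<delta> \<and> reach i s j"
    and slow: "\<And>\<eta>. \<eta> > 0 \<Longrightarrow> \<exists>c. \<exists>\<delta>>0. \<exists>X. \<forall>i. \<forall>x\<ge>X. \<forall>t. c \<le> t \<longrightarrow> t \<le> c + \<delta> \<longrightarrow> E i x \<ge> E i (x - t) - \<eta>"
  shows "hits_windows E"
  unfolding hits_windows_def
proof (intro allI impI)
  fix i and \<eta> :: real assume \<eta>: "\<eta> > 0"
  obtain c \<delta> X where \<delta>: "\<delta> > 0"
    and slow': "\<And>i x t. x \<ge> X \<Longrightarrow> c \<le> t \<Longrightarrow> t \<le> c + 2 * \<delta> \<Longrightarrow> E i x \<ge> E i (x - t) - \<eta>"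
  proof -
    obtain c \<delta> X where "\<delta> > 0" "\<And>i x t. x \<ge> X \<Longrightarrow> c \<le> t \<Longrightarrow> t \<le> c + \<delta> \<Longrightarrow> E i x \<ge> E i (x - t) - \<eta>"
      using slow[OF \<eta>] by metis
    then show ?thesis using that[of "\<delta> / 2" X c] by auto
  qed
  obtain N where N: "\<And>j t. t \<ge> N j \<Longrightarrow> \<exists>s\<ge>t. s \<le> t + \<delta> \<and> reach i s j"
    using arith[OF \<delta>, of i] by metis
  define M where "M = Max (range N)"
  have M: "N j \<le> M" for j unfolding M_def by auto
  have "\<forall>n j. \<exists>s. M + real n * \<delta> \<le> s \<and> s \<le> M + real n * \<delta> + \<delta> \<and> reach i s j"
    using N M \<delta> by (meson add_increasing2 mult_nonneg_nonneg of_nat_0_le_iff order_less_imp_le)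
  then obtain \<sigma> where \<sigma>: "\<And>n j. M + real n * \<delta> \<le> \<sigma> n j" "\<And>n j. \<sigma> n j \<le> M + real n * \<delta> + \<delta>"
    "\<And>n j. reach i (\<sigma> n j) j"
    by metis
  obtain n1 :: nat where n1: "real n1 * \<delta> > memory" using ex_less_of_nat_mult[OF \<delta>] by blast
  define s0 where "s0 = M - c"
  define R where "R = (\<lambda>(n, j). (\<sigma> n j, j)) ` ({..n1 + 1} \<times> (UNIV :: 'i set))"
  show "\<exists>s0 R X. finite R \<and> (\<forall>(s, j)\<in>R. reach i s j) \<and>
     (\<forall>x\<ge>X. \<forall>j. \<forall>t\<in>G. 0 \<le> t \<longrightarrow> t \<le> memory \<longrightarrow>
        (\<exists>s. (s, j) \<in> R \<and> E j (x - s0 - t) \<ge> E j (x - s) - \<eta>))"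
  proof (rule exI[of _ s0], rule exI[of _ R], rule exI[of _ "X + s0 + memory"], intro conjI ballI allI impI)
    show "finite R" unfolding R_def by auto
    fix a assume "a \<in> R"
    then show "case a of (s, j) \<Rightarrow> reach i s j" unfolding R_def using \<sigma> by auto
  next
    fix x j t assume x: "X + s0 + memory \<le> x" and t: "t \<in> G" "0 \<le> t" "t \<le> memory"
    define n where "n = nat \<lceil>t / \<delta>\<rceil>"
    have n_eq: "real n = of_int \<lceil>t / \<delta>\<rceil>" unfolding n_def using t(2) \<delta>
      by (metis ceiling_mono ceiling_zero divide_nonneg_pos of_int_of_nat_eq nat_0_le)
    have n: "t \<le> real n * \<delta>" "real n * \<delta> \<le> t + \<delta>"
    proof -
      have "t / \<delta> \<le> real n" "real n \<le> t / \<delta> + 1" unfolding n_eq by linarith+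
      then show "t \<le> real n * \<delta>" "real n * \<delta> \<le> t + \<delta>"
        using \<delta> by (simp_all add: field_simps)
    qed
    have "real n < real n1 + 1"
    proof -
      have "real n * \<delta> < (real n1 + 1) * \<delta>" using n n1 t by (simp add: distrib_right)
      then show ?thesis using \<delta> by simp
    qed
    then have "(\<sigma> n j, j) \<in> R" unfolding R_def by force
    moreover have "E j (x - s0 - t) \<ge> E j (x - s0 - t - (\<sigma> n j - s0 - t)) - \<eta>"
      using \<sigma>[of n j] n x t unfolding s0_def by (intro slow') auto
    ultimately show "\<exists>s. (s, j) \<in> R \<and> E j (x - s0 - t) \<ge> E j (x - s) - \<eta>"
      by (intro exI[of _ "\<sigma> n j"]) auto
  qed
qed

theorem renewal_dense:
  assumes sol: "solves C \<epsilon> D" and C: "C \<ge> 0" and \<epsilon>: "\<epsilon> > 0"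
    and bdd: "\<And>i x. x \<ge> 0 \<Longrightarrow> \<bar>D i x\<bar> \<le> B"
    and G_UNIV: "G = UNIV"
    and arith: "\<And>i j \<delta>. \<delta> > 0 \<Longrightarrow> \<exists>N. \<forall>t\<ge>N. \<exists>s\<ge>t. s \<le> t + \<delta> \<and> reach i s j"
    and slow: "\<And>\<eta>. \<eta> > 0 \<Longrightarrow> \<exists>\<delta>>0. \<exists>X. \<forall>i. \<forall>x\<ge>X. \<forall>t. 0 \<le> t \<longrightarrow> t \<le> \<delta> \<longrightarrow> D i (x + t) \<le> D i x + \<eta>"
  shows "asym_periodic G (D i)"
proof -
  have const: "coset_limsup G D x = coset_limsup G D y" for x y
    using coset_limsup_periodic[OF G, of "x - y" D y] G_UNIV by simp
  show ?thesis
  proof (rule solution_asym_periodic[OF sol C \<epsilon> bdd]; (rule hits_windows_dense[OF arith])?)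
    fix \<eta> :: real assume "\<eta> > 0"
    then obtain \<delta> X where \<delta>: "\<delta> > 0"
      and sl: "\<And>i x t. x \<ge> X \<Longrightarrow> 0 \<le> t \<Longrightarrow> t \<le> \<delta> \<Longrightarrow> D i (x + t) \<le> D i x + \<eta>"
      using slow by meson
    show "\<exists>c. \<exists>\<delta>>0. \<exists>X. \<forall>i. \<forall>x\<ge>X. \<forall>t. c \<le> t \<longrightarrow> t \<le> c + \<delta> \<longrightarrow>
        D i x - coset_limsup G D x \<ge> D i (x - t) - coset_limsup G D (x - t) - \<eta>"
    proof (rule exI[of _ "- \<delta>"], rule exI[of _ \<delta>], intro conjI \<delta>, rule exI[of _ X], intro allI impI)
      fix i x t assume "X \<le> x" "- \<delta> \<le> t" "t \<le> - \<delta> + \<delta>"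
      then show "D i x - coset_limsup G D x \<ge> D i (x - t) - coset_limsup G D (x - t) - \<eta>"
        using sl[of x "- t" i] const[of x "x - t"] by simp
    qed
    show "\<exists>c. \<exists>\<delta>>0. \<exists>X. \<forall>i. \<forall>x\<ge>X. \<forall>t. c \<le> t \<longrightarrow> t \<le> c + \<delta> \<longrightarrow>
        coset_limsup G D x - D i x \<ge> coset_limsup G D (x - t) - D i (x - t) - \<eta>"
    proof (rule exI[of _ 0], rule exI[of _ \<delta>], intro conjI \<delta>, rule exI[of _ "X + \<delta>"], intro allI impI)
      fix i x t assume "X + \<delta> \<le> x" "0 \<le> t" "t \<le> 0 + \<delta>"
      then show "coset_limsup G D x - D i x \<ge> coset_limsup G D (x - t) - D i (x - t) - \<eta>"
        using sl[of "x - t" t i] const[of x "x - t"] by simp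
    qed
  qed
qed

end


section \<open>Subgroups of the line and semigroups of lengths\<close>

lemma subgroup_reals_int_mult:
  assumes "subgroup_reals G" "g \<in> G"
  shows "of_int n * g \<in> G"
proof (cases "n \<ge> 0")
  case True
  then show ?thesis using subgroup_reals_mult[OF assms, of "nat n"] by simp
next
  case False
  then have "- (real (nat (- n)) * g) \<in> G"
    using subgroup_reals_mult[OF assms, of "nat (- n)"] subgroup_realsD(3)[OF assms(1)] by blast
  then show ?thesis using False by simp
qed

text \<open>
  Division with remainder by an element \<open>d\<close> for which $\lfloor d/\delta\rfloor$ is least: a nonzero
  remainder \<open>y\<close> satisfies $d - y \ge \delta$, so its quotient would be smaller. Minimizing this
  natural number replaces the infimum of the positive elements.
\<close>

lemma subgroup_reals_cyclic:
  assumes G: "subgroup_reals G" and a: "a \<in> G" "a > 0"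
    and \<delta>: "\<delta> > 0" "\<And>x. x \<in> G \<Longrightarrow> x > 0 \<Longrightarrow> x \<ge> \<delta>"
  obtains d where "d \<in> G" "d > 0" "G = range (\<lambda>n::int. of_int n * d)"
proof -
  \<comment> \<open>the quotient to be minimized\<close>
  define m where "m x = nat \<lfloor>x / \<delta>\<rfloor>" for x :: real
  obtain d where d: "d \<in> G \<and> d > 0" and min: "\<And>x. x \<in> G \<and> x > 0 \<Longrightarrow> m d \<le> m x"
    using ex_has_least_nat[of "\<lambda>x. x \<in> G \<and> x > 0" a m] a by blast
  have "x \<in> range (\<lambda>n::int. of_int n * d)" if x: "x \<in> G" for x
  proof -
    define y where "y = x - of_int \<lfloor>x / d\<rfloor> * d"
    have y: "y \<ge> 0" "y < d"
      unfolding y_def using d floor_divide_lower[of d x] floor_divide_upper[of d x]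
      by (auto simp: algebra_simps)
    have yG: "y \<in> G"
      unfolding y_def using d x by (intro subgroup_realsD(4)[OF G] subgroup_reals_int_mult[OF G]) auto
    have "y = 0"
    proof (rule ccontr)
      assume "y \<noteq> 0"
      then have "y > 0" using y by simp
      have "d - y \<ge> \<delta>" using y yG d by (intro \<delta>(2) subgroup_realsD(4)[OF G]) auto
      then have "y / \<delta> \<le> d / \<delta> - 1" using \<delta>(1) by (simp add: field_simps)
      then have "\<lfloor>y / \<delta>\<rfloor> < \<lfloor>d / \<delta>\<rfloor>" by linarith
      moreover have "\<lfloor>y / \<delta>\<rfloor> \<ge> 0" using y \<delta> by simp
      ultimately have "m y < m d" unfolding m_def by linarith
      then show False using min[of y] y yG \<open>y > 0\<close> by simp
    qed
    then show ?thesis unfolding y_def by auto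
  qed
  then have "G = range (\<lambda>n::int. of_int n * d)"
    using subgroup_reals_int_mult[OF G] d by auto
  then show ?thesis using that d by blast
qed

lemma subgroup_reals_generated:
  "subgroup_reals {of_int m * a + of_int k * b | m k :: int. True}"
  unfolding subgroup_reals_def
proof (intro conjI ballI)
  show "0 \<in> {of_int m * a + of_int k * b | m k :: int. True}"
    by (auto intro!: exI[of _ 0])
next
  fix x y assume "x \<in> {of_int m * a + of_int k * b | m k :: int. True}"
    "y \<in> {of_int m * a + of_int k * b | m k :: int. True}"
  then obtain m k m' k' :: int where "x = of_int m * a + of_int k * b" "y = of_int m' * a + of_int k' * b"
    by auto
  then have "x + y = of_int (m + m') * a + of_int (k + k') * b" by (simp add: algebra_simps)
  then show "x + y \<in> {of_int m * a + of_int k * b | m k :: int. True}" by blast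
next
  fix x assume "x \<in> {of_int m * a + of_int k * b | m k :: int. True}"
  then obtain m k :: int where "x = of_int m * a + of_int k * b" by auto
  then have "- x = of_int (- m) * a + of_int (- k) * b" by simp
  then show "- x \<in> {of_int m * a + of_int k * b | m k :: int. True}" by blast
qed

text \<open>
  Start at the multiple $n(a+b)$ just below \<open>s\<close> and add copies of \<open>\<tau>\<close>. At most \<open>J\<close> copies are
  needed to bridge one period $a + b$, so for large \<open>n\<close> the coefficients of \<open>a\<close> and \<open>b\<close> remain positive
  although \<open>m\<close> or \<open>k\<close> may be negative.
\<close>

lemma semigroup_hits_intervals:
  fixes a b :: real and m k :: int
  assumes ab: "a > 0" "b > 0" and \<tau>: "\<tau> = of_int m * a + of_int k * b" "\<tau> > 0"
  shows "\<exists>N. \<forall>s\<ge>N. \<exists>M K :: nat. 2 \<le> M \<and> s \<le> real M * a + real K * b \<and> real M * a + real K * b < s + \<tau>"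
proof -
  define J where "J = \<lceil>(a + b) / \<tau>\<rceil>"
  have J: "J \<ge> 0" proof -
    have "(a + b) / \<tau> \<ge> 0" using ab \<tau>(2) by simp
    then show ?thesis unfolding J_def by linarith
  qed
  \<comment> \<open>adding \<open>J\<close> copies of \<open>\<tau>\<close> leaves both coefficients at least \<open>2\<close>\<close>
  define B where "B = J * max \<bar>m\<bar> \<bar>k\<bar> + 2"
  show ?thesis
  proof (intro exI[of _ "of_int B * (a + b)"] allI impI)
    fix s assume s: "of_int B * (a + b) \<le> s"
    define n where "n = \<lfloor>s / (a + b)\<rfloor>"
    have n: "of_int n * (a + b) \<le> s" "s < of_int n * (a + b) + (a + b)" "B \<le> n"
      unfolding n_def using ab s floor_divide_lower[of "a + b" s] floor_divide_upper[of "a + b" s]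
      by (auto simp: le_floor_iff field_simps)
    define j where "j = \<lceil>(s - of_int n * (a + b)) / \<tau>\<rceil>"
    have j: "of_int j * \<tau> \<ge> s - of_int n * (a + b)" "of_int j * \<tau> < s - of_int n * (a + b) + \<tau>"
      unfolding j_def using \<tau>(2) ceiling_divide_upper[of \<tau> "s - of_int n * (a + b)"]
        ceiling_divide_lower[of \<tau> "s - of_int n * (a + b)"]
      by (auto simp: algebra_simps)
    have "j \<ge> 0" proof -
      have "(s - of_int n * (a + b)) / \<tau> \<ge> 0" using n \<tau>(2) by simp
      then show ?thesis unfolding j_def by linarith
    qed
    have "j \<le> J" unfolding j_def J_def using n \<tau> by (intro ceiling_mono divide_right_mono) auto
    have *: "n + j * l \<ge> 2" if "\<bar>l\<bar> \<le> max \<bar>m\<bar> \<bar>k\<bar>" for l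
    proof -
      have "\<bar>j * l\<bar> \<le> J * max \<bar>m\<bar> \<bar>k\<bar>"
        unfolding abs_mult using that \<open>j \<ge> 0\<close> \<open>j \<le> J\<close> by (intro mult_mono) auto
      then show ?thesis using n(3) unfolding B_def by linarith
    qed
    have M: "n + j * m \<ge> 2" "n + j * k \<ge> 2" using * by auto
    have "real (nat (n + j * m)) * a + real (nat (n + j * k)) * b
        = of_int (n + j * m) * a + of_int (n + j * k) * b" using M by simp
    also have "\<dots> = of_int n * (a + b) + of_int j * \<tau>" unfolding \<tau>(1) by (simp add: algebra_simps)
    finally show "\<exists>M K :: nat. 2 \<le> M \<and> s \<le> real M * a + real K * b \<and> real M * a + real K * b < s + \<tau>"
      using j M by (intro exI[of _ "nat (n + j * m)"] exI[of _ "nat (n + j * k)"]) auto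
  qed
qed


section \<open>The zero of $H(q,\cdot)$\<close>

lemma Q_pos: "w > 0 \<Longrightarrow> s > 0 \<Longrightarrow> Q w s q \<alpha> > 0"
  by (simp add: Q_def)

lemma Q_strict_mono: "w > 0 \<Longrightarrow> 0 < s \<Longrightarrow> s < 1 \<Longrightarrow> \<alpha> < \<beta> \<Longrightarrow> Q w s q \<alpha> < Q w s q \<beta>"
  unfolding Q_def by (intro mult_strict_left_mono powr_less_mono') auto

lemma Q_mult: "0 \<le> w \<Longrightarrow> 0 \<le> w' \<Longrightarrow> 0 \<le> s \<Longrightarrow> 0 \<le> s' \<Longrightarrow> Q (w * w') (s * s') q \<alpha> = Q w s q \<alpha> * Q w' s' q \<alpha>"
  unfolding Q_def by (simp add: powr_mult)

lemma tendsto_Q: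
  assumes "w > 0" "s > 0" "(f \<longlongrightarrow> q) F" "(g \<longlongrightarrow> \<alpha>) F"
  shows "((\<lambda>x. Q w s (f x) (g x)) \<longlongrightarrow> Q w s q \<alpha>) F"
  unfolding Q_def using assms by (auto intro!: tendsto_intros)

lemma Q_tendsto_0_at_bot:
  assumes "0 < s" "s < 1"
  shows "(Q w s q \<longlongrightarrow> 0) at_bot"
proof -
  have "filterlim (\<lambda>a. (- ln s) * a) at_bot at_bot"
    using assms by (intro filterlim_tendsto_pos_mult_at_bot[OF tendsto_const _ filterlim_ident]) auto
  then have "((\<lambda>a. w powr q * exp ((- ln s) * a)) \<longlongrightarrow> w powr q * 0) at_bot"
    by (intro tendsto_mult tendsto_const filterlim_compose[OF exp_at_bot])
  moreover have "Q w s q = (\<lambda>a. w powr q * exp ((- ln s) * a))"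
    using assms by (auto simp: Q_def powr_def[of s] mult.commute)
  ultimately show ?thesis by simp
qed

lemma DERIV_Q_exponent [derivative_intros]:
  assumes "s > 0" "(f has_real_derivative D) (at x)"
  shows "((\<lambda>x. Q w s q (f x)) has_real_derivative (- ln s * Q w s q (f x) * D)) (at x)"
proof -
  have "(Q w s q has_real_derivative - ln s * Q w s q y) (at y)" for y
    unfolding Q_def using assms(1) by (auto intro!: derivative_eq_intros)
  from DERIV_chain2[OF this assms(2)] show ?thesis .
qed

lemma DERIV_Q_power [derivative_intros]:
  assumes "w > 0" "(f has_real_derivative D) (at x)"
  shows "((\<lambda>x. Q w s (f x) \<alpha>) has_real_derivative (ln w * Q w s (f x) \<alpha> * D)) (at x)"
proof -
  have "((\<lambda>y. Q w s y \<alpha>) has_real_derivative ln w * Q w s y \<alpha>) (at y)" for y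
    unfolding Q_def using assms(1) by (auto intro!: derivative_eq_intros)
  from DERIV_chain2[OF this assms(2)] show ?thesis .
qed

text \<open>
  The data of the system without the measures; everything about $H$ depends only on these.
\<close>

locale overlap_weights =
  fixes \<rho> r :: real and p :: "edge \<Rightarrow> real"
  assumes \<rho>: "0 < \<rho>" "\<rho> < 1" and r: "0 < r" "r < 1" and separation: "\<rho> + 2 * r - \<rho> * r \<le> 1"
    and p_pos: "\<And>e. p e > 0" and p_sum1: "p E1 + p E2 + p E3 = 1" and p_sum2: "p E4 + p E5 = 1"
begin

definition w13 :: real where "w13 = p E1 * p E3 + p E2 * p E5"

lemma w13_pos: "w13 > 0"
  unfolding w13_def using p_pos by (simp add: add_pos_pos)

lemma \<rho>r: "0 < \<rho> * r" "\<rho> * r < 1"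
  using \<rho> r mult_strict_mono[of \<rho> 1 r 1] by auto

definition admissible :: "real \<Rightarrow> real \<Rightarrow> bool" where
  "admissible q \<alpha> \<longleftrightarrow> Q (p E4) r q \<alpha> < 1 \<and> H \<rho> r p q \<alpha> = 0"

text \<open>
  The factor of $H$ that belongs to the overlapping block: it is positive exactly if returns to
  $(0,\ell)$ without a visit to $\mu_2$ have total mass less than $1$, as long as $Q_{3,r} < 1$.
\<close>

definition block :: "real \<Rightarrow> real \<Rightarrow> real" where
  "block q \<alpha> = (1 - Q (p E1) \<rho> q \<alpha>) * (1 - Q (p E3) r q \<alpha>) - Q w13 (\<rho> * r) q \<alpha>"

lemma H_block: "H \<rho> r p q \<alpha> = (1 - Q (p E4) r q \<alpha>) * block q \<alpha> - Q (p E2) r q \<alpha> * Q (p E4) r q \<alpha> * Q (p E5) \<rho> q \<alpha>"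
  unfolding H_def block_def w13_def ..

text \<open>
  Since $(p_{e_1}p_{e_3} + p_{e_2}p_{e_5})^q \ge (p_{e_1}p_{e_3})^q$, positivity of the block gives
  $(1 - x)(1 - y) > xy$ for $x = Q_{1,\rho}$, $y = Q_{3,r}$, that is $x + y < 1$. This excludes the
  spurious range in which both factors of the product are negative.
\<close>

lemma block_pos_imp:
  assumes q: "q \<ge> 0" and pos: "block q \<alpha> > 0"
  shows "Q (p E1) \<rho> q \<alpha> < 1" "Q (p E3) r q \<alpha> < 1"
proof -
  let ?x = "Q (p E1) \<rho> q \<alpha>" and ?y = "Q (p E3) r q \<alpha>"
  have xy: "?x > 0" "?y > 0" using Q_pos p_pos \<rho> r by auto
  have "?x * ?y = Q (p E1 * p E3) (\<rho> * r) q \<alpha>"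
    using p_pos \<rho> r by (simp add: Q_mult less_imp_le)
  also have "\<dots> \<le> Q w13 (\<rho> * r) q \<alpha>"
    unfolding Q_def w13_def using p_pos q
    by (intro mult_right_mono powr_mono2) (auto simp: less_imp_le mult_nonneg_nonneg)
  finally have *: "?x * ?y < (1 - ?x) * (1 - ?y)" using pos unfolding block_def by simp
  then have s: "?x + ?y < 1" by (simp add: algebra_simps)
  then show "?x < 1" "?y < 1" using xy by linarith+
qed

text \<open>
  Where $H(q,\beta) \ge 0$ all factors of the first term are positive, and they decrease in the exponent,
  whereas the subtracted term increases. The same factors are then positive for all smaller exponents.
\<close>

lemma H_strict_antimono:
  assumes q: "q \<ge> 0" and less: "\<alpha> < \<beta>" and Q4: "Q (p E4) r q \<beta> < 1" and H: "H \<rho> r p q \<beta> \<ge> 0"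
  shows "H \<rho> r p q \<alpha> > H \<rho> r p q \<beta>"
proof -
  have pos: "Q (p E2) r q x > 0" "Q (p E4) r q x > 0" "Q (p E5) \<rho> q x > 0"
      "Q (p E1) \<rho> q x > 0" "Q (p E3) r q x > 0" "Q w13 (\<rho> * r) q x > 0" for x
    using Q_pos p_pos \<rho> r \<rho>r w13_pos by auto
  have mono: "Q (p E2) r q \<alpha> < Q (p E2) r q \<beta>" "Q (p E4) r q \<alpha> < Q (p E4) r q \<beta>"
      "Q (p E5) \<rho> q \<alpha> < Q (p E5) \<rho> q \<beta>" "Q (p E1) \<rho> q \<alpha> < Q (p E1) \<rho> q \<beta>"
      "Q (p E3) r q \<alpha> < Q (p E3) r q \<beta>" "Q w13 (\<rho> * r) q \<alpha> < Q w13 (\<rho> * r) q \<beta>"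
    using Q_strict_mono p_pos \<rho> r \<rho>r w13_pos less by auto
  have "(1 - Q (p E4) r q \<beta>) * block q \<beta> > 0"
  proof -
    have "Q (p E2) r q \<beta> * Q (p E4) r q \<beta> * Q (p E5) \<rho> q \<beta> > 0" using pos by simp
    then show ?thesis using H unfolding H_block by linarith
  qed
  then have B: "block q \<beta> > 0" using Q4 by (simp add: zero_less_mult_iff)
  note b = block_pos_imp[OF q B]
  have "(1 - Q (p E1) \<rho> q \<beta>) * (1 - Q (p E3) r q \<beta>) \<le> (1 - Q (p E1) \<rho> q \<alpha>) * (1 - Q (p E3) r q \<alpha>)"
    using b mono by (intro mult_mono) auto
  then have "block q \<beta> < block q \<alpha>" unfolding block_def using mono by linarith
  then have "(1 - Q (p E4) r q \<beta>) * block q \<beta> < (1 - Q (p E4) r q \<alpha>) * block q \<alpha>"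
    using B mono Q4 by (intro mult_strict_mono) auto
  moreover have "Q (p E2) r q \<alpha> * Q (p E4) r q \<alpha> * Q (p E5) \<rho> q \<alpha> \<le> Q (p E2) r q \<beta> * Q (p E4) r q \<beta> * Q (p E5) \<rho> q \<beta>"
    using mono pos by (intro mult_mono mult_nonneg_nonneg less_imp_le)
  ultimately show ?thesis unfolding H_block by linarith
qed

lemma H_neg_above:
  assumes "q \<ge> 0" "admissible q \<alpha>" "\<alpha> < \<beta>" "Q (p E4) r q \<beta> < 1"
  shows "H \<rho> r p q \<beta> < 0"
  using H_strict_antimono[OF assms(1,3,4)] assms(2) unfolding admissible_def by linarith

lemma H_pos_below:
  assumes "q \<ge> 0" "admissible q \<alpha>" "\<beta> < \<alpha>"
  shows "H \<rho> r p q \<beta> > 0"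
  using H_strict_antimono[OF assms(1,3)] assms(2) unfolding admissible_def by simp

lemma admissible_unique:
  assumes "q \<ge> 0" "admissible q \<alpha>" "admissible q \<beta>"
  shows "\<alpha> = \<beta>"
  using H_pos_below[OF assms(1,2), of \<beta>] H_pos_below[OF assms(1,3), of \<alpha>] assms
  unfolding admissible_def by (cases \<alpha> \<beta> rule: linorder_cases) auto

text \<open>
  $H(q,\cdot)$ tends to $1$ at $-\infty$ and is negative where $Q_{4,r} = 1$.
\<close>

lemma admissible_exists: "\<exists>\<alpha>. admissible q \<alpha>"
proof -
  \<comment> \<open>the point where $Q_{4,r} = 1$\<close>
  define a0 where "a0 = q * ln (p E4) / ln r"
  have Q4_a0: "Q (p E4) r q a0 = 1"
    using p_pos[of E4] r by (simp add: Q_def a0_def powr_def exp_add[symmetric])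
  have H_a0: "H \<rho> r p q a0 < 0"
    unfolding H_def Q4_a0 using Q_pos[OF p_pos r(1), of E2 q a0] Q_pos[OF p_pos \<rho>(1), of E5 q a0] by simp
  have cont: "continuous_on UNIV (H \<rho> r p q)"
  proof -
    have "isCont (H \<rho> r p q) x" for x
      unfolding isCont_def H_def w13_def[symmetric]
      using p_pos \<rho> r \<rho>r w13_pos by (intro tendsto_intros tendsto_Q) auto
    then show ?thesis by (simp add: continuous_on_eq_continuous_within continuous_at_imp_continuous_at_within)
  qed
  have "(H \<rho> r p q \<longlongrightarrow> (1 - 0) * ((1 - 0) * (1 - 0) - 0) - 0 * 0 * 0) at_bot"
    unfolding H_def using \<rho> r \<rho>r by (intro tendsto_intros Q_tendsto_0_at_bot) auto
  then have "eventually (\<lambda>a. H \<rho> r p q a > 0) at_bot"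
    by (intro order_tendstoD(1)) auto
  then obtain a1 where a1: "a1 < a0" "H \<rho> r p q a1 > 0"
  proof -
    obtain N where "\<And>a. a \<le> N \<Longrightarrow> H \<rho> r p q a > 0"
      using \<open>eventually (\<lambda>a. H \<rho> r p q a > 0) at_bot\<close> unfolding eventually_at_bot_linorder by blast
    then show ?thesis using that[of "min N (a0 - 1)"] by auto
  qed
  obtain \<alpha> where \<alpha>: "a1 \<le> \<alpha>" "\<alpha> \<le> a0" "H \<rho> r p q \<alpha> = 0"
    using IVT2'[of "H \<rho> r p q" a0 0 a1] a1 H_a0 continuous_on_subset[OF cont] by force
  then have "\<alpha> < a0" using H_a0 by (cases "\<alpha> = a0") auto
  then have "Q (p E4) r q \<alpha> < 1" using Q_strict_mono[OF p_pos r] Q4_a0 by metis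
  then show ?thesis using \<alpha> unfolding admissible_def by blast
qed

lemma admissible_bounds:
  assumes "q \<ge> 0" "admissible q \<alpha>"
  shows "Q (p E1) \<rho> q \<alpha> < 1" "Q (p E3) r q \<alpha> < 1" "Q (p E4) r q \<alpha> < 1"
    "(1 - Q (p E4) r q \<alpha>) * block q \<alpha> = Q (p E2) r q \<alpha> * Q (p E4) r q \<alpha> * Q (p E5) \<rho> q \<alpha>"
proof -
  show 1: "(1 - Q (p E4) r q \<alpha>) * block q \<alpha> = Q (p E2) r q \<alpha> * Q (p E4) r q \<alpha> * Q (p E5) \<rho> q \<alpha>"
    using assms unfolding admissible_def H_block by simp
  show 2: "Q (p E4) r q \<alpha> < 1" using assms unfolding admissible_def by simp
  have "Q (p E2) r q \<alpha> * Q (p E4) r q \<alpha> * Q (p E5) \<rho> q \<alpha> > 0"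
    using Q_pos p_pos \<rho> r by auto
  then have "block q \<alpha> > 0" using 1 2 by (metis diff_gt_0_iff_gt zero_less_mult_pos)
  then show "Q (p E1) \<rho> q \<alpha> < 1" "Q (p E3) r q \<alpha> < 1"
    using block_pos_imp[OF assms(1)] by auto
qed

definition H_numerator :: "real \<Rightarrow> real \<Rightarrow> real" where
  "H_numerator q \<alpha> = Q (p E4) r q \<alpha> * ln (p E4) * block q \<alpha>
     + Q (p E2) r q \<alpha> * Q (p E4) r q \<alpha> * Q (p E5) \<rho> q \<alpha> * ln (p E2 * p E4 * p E5)
     + (1 - Q (p E4) r q \<alpha>) * (Q (p E1) \<rho> q \<alpha> * (1 - Q (p E3) r q \<alpha>) * ln (p E1)
         + Q (p E3) r q \<alpha> * (1 - Q (p E1) \<rho> q \<alpha>) * ln (p E3) + Q w13 (\<rho> * r) q \<alpha> * ln w13)"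

definition H_denominator :: "real \<Rightarrow> real \<Rightarrow> real" where
  "H_denominator q \<alpha> = Q (p E4) r q \<alpha> * ln r * block q \<alpha>
     + Q (p E2) r q \<alpha> * Q (p E4) r q \<alpha> * Q (p E5) \<rho> q \<alpha> * ln (\<rho> * r\<^sup>2)
     + (1 - Q (p E4) r q \<alpha>) * (Q (p E1) \<rho> q \<alpha> * (1 - Q (p E3) r q \<alpha>) * ln \<rho>
         + Q (p E3) r q \<alpha> * (1 - Q (p E1) \<rho> q \<alpha>) * ln r + Q w13 (\<rho> * r) q \<alpha> * ln (\<rho> * r))"

lemma tau_deriv_eq: "tau_deriv \<rho> r p q \<alpha> = H_numerator q \<alpha> / H_denominator q \<alpha>"
  unfolding tau_deriv_def Let_def H_numerator_def H_denominator_def block_def w13_def by simp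

lemma DERIV_H_exponent: "(H \<rho> r p q has_real_derivative H_denominator q \<alpha>) (at \<alpha>)"
  unfolding H_def H_denominator_def block_def w13_def[symmetric]
  by (rule derivative_eq_intros refl \<rho> r \<rho>r)+
     (use \<rho> r in \<open>simp add: ln_mult ln_realpow power2_eq_square algebra_simps\<close>)

lemma DERIV_H_power: "((\<lambda>q. H \<rho> r p q \<alpha>) has_real_derivative - H_numerator q \<alpha>) (at q)"
  unfolding H_def H_numerator_def block_def w13_def[symmetric]
  by (rule derivative_eq_intros refl p_pos w13_pos)+
     (use p_pos in \<open>simp add: ln_mult less_imp_neq[THEN not_sym] algebra_simps\<close>)

text \<open>
  For exponents slightly below and above the zero at \<open>q\<close>, the signs of $H$ persist for nearby powers
  \<open>s\<close>, and the zero at \<open>s\<close> separates the signs of $H(s,\cdot)$.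
\<close>

lemma admissible_tendsto:
  assumes q: "q > 0" and A: "\<And>s. s \<ge> 0 \<Longrightarrow> admissible s (A s)"
  shows "(A \<longlongrightarrow> A q) (at q)"
proof (rule tendstoI)
  fix e :: real assume e: "e > 0"
  let ?\<alpha> = "A q"
  have adm: "admissible q ?\<alpha>" using A q by simp
  have "((\<lambda>t. Q (p E4) r q (?\<alpha> + t)) \<longlongrightarrow> Q (p E4) r q (?\<alpha> + 0)) (at_right 0)"
    using p_pos r by (intro tendsto_Q tendsto_intros) auto
  then have "eventually (\<lambda>t. Q (p E4) r q (?\<alpha> + t) < 1) (at_right 0)"
    using adm unfolding admissible_def by (intro order_tendstoD(2)) auto
  moreover have "eventually (\<lambda>t. 0 < t \<and> t < e) (at_right (0::real))"
    using eventually_at_right_real[OF e] by simp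
  ultimately have "eventually (\<lambda>t. Q (p E4) r q (?\<alpha> + t) < 1 \<and> 0 < t \<and> t < e) (at_right 0)"
    by (rule eventually_conj)
  then obtain t where t: "Q (p E4) r q (?\<alpha> + t) < 1" "0 < t" "t < e"
    using eventually_happens[of _ "at_right (0::real)"] by force
  have H_cont: "((\<lambda>s. H \<rho> r p s a) \<longlongrightarrow> H \<rho> r p q a) (at q)" for a
    using DERIV_isCont[OF DERIV_H_power] unfolding isCont_def by blast
  have "eventually (\<lambda>s. H \<rho> r p s (?\<alpha> + t) < 0) (at q)"
    using H_neg_above[OF _ adm, of "?\<alpha> + t"] t q by (intro order_tendstoD(2)[OF H_cont]) auto
  moreover have "eventually (\<lambda>s. H \<rho> r p s (?\<alpha> - t) > 0) (at q)"
    using H_pos_below[OF _ adm, of "?\<alpha> - t"] t q by (intro order_tendstoD(1)[OF H_cont]) auto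
  moreover have "((\<lambda>s. Q (p E4) r s (?\<alpha> + t)) \<longlongrightarrow> Q (p E4) r q (?\<alpha> + t)) (at q)"
    using p_pos r by (intro tendsto_Q tendsto_intros) auto
  then have "eventually (\<lambda>s. Q (p E4) r s (?\<alpha> + t) < 1) (at q)"
    using t by (intro order_tendstoD(2)) auto
  moreover have "eventually (\<lambda>s. s > 0) (at q)"
    using q by (intro order_tendstoD(1)[OF tendsto_ident_at])
  ultimately show "eventually (\<lambda>s. dist (A s) (A q) < e) (at q)"
  proof eventually_elim
    case (elim s)
    have adm_s: "admissible s (A s)" using A elim by simp
    have "A s < ?\<alpha> + t"
      using H_pos_below[OF _ adm_s, of "?\<alpha> + t"] adm_s elim unfolding admissible_def
      by (cases "A s" "?\<alpha> + t" rule: linorder_cases) auto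
    moreover have "A s > ?\<alpha> - t"
    proof (rule ccontr)
      assume "\<not> A s > ?\<alpha> - t"
      moreover have "Q (p E4) r s (?\<alpha> - t) < 1"
        using Q_strict_mono[OF p_pos r, of "?\<alpha> - t" "?\<alpha> + t" E4 s] elim t by simp
      ultimately show False
        using H_neg_above[OF _ adm_s, of "?\<alpha> - t"] adm_s elim unfolding admissible_def
        by (cases "A s = ?\<alpha> - t") auto
    qed
    ultimately show ?case using t by (simp add: dist_real_def abs_less_iff)
  qed
qed

text \<open>
  Implicit differentiation. The mean value theorem in the exponent alone turns
  $H(s,A(s)) = 0 = H(q,A(q))$ into an identity between difference quotients, and continuity of
  \<open>A\<close> is enough to pass to the limit.
\<close>

lemma admissible_has_derivative:
  assumes q: "q > 0" and A: "\<And>s. s \<ge> 0 \<Longrightarrow> admissible s (A s)"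
    and nz: "deriv (H \<rho> r p q) (A q) \<noteq> 0"
  shows "(A has_real_derivative tau_deriv \<rho> r p q (A q)) (at q)"
proof -
  let ?\<alpha> = "A q"
  have nz': "H_denominator q ?\<alpha> \<noteq> 0"
    using nz DERIV_imp_deriv[OF DERIV_H_exponent] by simp
  \<comment> \<open>the intermediate point for the increment in the exponent\<close>
  have "\<exists>\<xi>. \<bar>\<xi> - ?\<alpha>\<bar> \<le> \<bar>A s - ?\<alpha>\<bar> \<and> H \<rho> r p s (A s) - H \<rho> r p s ?\<alpha> = (A s - ?\<alpha>) * H_denominator s \<xi>" for s
  proof (cases "A s" ?\<alpha> rule: linorder_cases)
    case less
    obtain z where "A s < z" "z < ?\<alpha>" "H \<rho> r p s ?\<alpha> - H \<rho> r p s (A s) = (?\<alpha> - A s) * H_denominator s z"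
      using MVT2[OF less, of "H \<rho> r p s" "H_denominator s"] DERIV_H_exponent by blast
    then show ?thesis by (intro exI[of _ z]) (auto simp: algebra_simps)
  next
    case greater
    obtain z where "?\<alpha> < z" "z < A s" "H \<rho> r p s (A s) - H \<rho> r p s ?\<alpha> = (A s - ?\<alpha>) * H_denominator s z"
      using MVT2[OF greater, of "H \<rho> r p s" "H_denominator s"] DERIV_H_exponent by blast
    then show ?thesis by (intro exI[of _ z]) auto
  qed auto
  then obtain \<xi> where \<xi>: "\<And>s. \<bar>\<xi> s - ?\<alpha>\<bar> \<le> \<bar>A s - ?\<alpha>\<bar>"
      "\<And>s. H \<rho> r p s (A s) - H \<rho> r p s ?\<alpha> = (A s - ?\<alpha>) * H_denominator s (\<xi> s)"
    by metis
  have A_lim: "(A \<longlongrightarrow> ?\<alpha>) (at q)" using admissible_tendsto[OF q A] .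
  have "((\<lambda>s. \<xi> s - ?\<alpha>) \<longlongrightarrow> 0) (at q)"
  proof (rule Lim_null_comparison)
    show "((\<lambda>s. \<bar>A s - ?\<alpha>\<bar>) \<longlongrightarrow> 0) (at q)"
      using tendsto_rabs_zero[OF LIM_zero[OF A_lim]] .
  qed (use \<xi>(1) in simp)
  then have \<xi>_lim: "(\<xi> \<longlongrightarrow> ?\<alpha>) (at q)" by (simp add: LIM_zero_iff)
  have den_lim: "((\<lambda>s. H_denominator s (\<xi> s)) \<longlongrightarrow> H_denominator q ?\<alpha>) (at q)"
    unfolding H_denominator_def block_def using p_pos \<rho> r \<rho>r w13_pos \<xi>_lim
    by (intro tendsto_intros tendsto_Q) auto
  have "((\<lambda>s. (H \<rho> r p s ?\<alpha> - H \<rho> r p q ?\<alpha>) / (s - q)) \<longlongrightarrow> - H_numerator q ?\<alpha>) (at q)"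
    using DERIV_H_power[of ?\<alpha> q] unfolding has_field_derivative_iff .
  then have "((\<lambda>s. - ((H \<rho> r p s ?\<alpha> - H \<rho> r p q ?\<alpha>) / (s - q)) / H_denominator s (\<xi> s))
      \<longlongrightarrow> - (- H_numerator q ?\<alpha>) / H_denominator q ?\<alpha>) (at q)"
    by (intro tendsto_divide tendsto_minus den_lim nz')
  moreover have "eventually (\<lambda>s. - ((H \<rho> r p s ?\<alpha> - H \<rho> r p q ?\<alpha>) / (s - q)) / H_denominator s (\<xi> s)
      = (A s - A q) / (s - q)) (at q)"
  proof -
    have "eventually (\<lambda>s. H_denominator s (\<xi> s) \<noteq> 0) (at q)"
      using tendsto_imp_eventually_ne[OF den_lim nz'] .
    moreover have "eventually (\<lambda>s. s > 0) (at q)"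
      using q by (intro order_tendstoD(1)[OF tendsto_ident_at])
    ultimately show ?thesis
    proof eventually_elim
      case (elim s)
      have "H \<rho> r p s (A s) = 0" "H \<rho> r p q ?\<alpha> = 0"
        using A[of s] A[of q] elim q unfolding admissible_def by auto
      then have "- (H \<rho> r p s ?\<alpha> - H \<rho> r p q ?\<alpha>) = (A s - ?\<alpha>) * H_denominator s (\<xi> s)"
        using \<xi>(2)[of s] by simp
      then have "- ((H \<rho> r p s ?\<alpha> - H \<rho> r p q ?\<alpha>) / (s - q)) = (A s - ?\<alpha>) * H_denominator s (\<xi> s) / (s - q)"
        by (metis minus_divide_left)
      then show ?case using elim by simp
    qed
  qed
  ultimately have "((\<lambda>s. (A s - A q) / (s - q)) \<longlongrightarrow> - (- H_numerator q ?\<alpha>) / H_denominator q ?\<alpha>) (at q)"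
    by (rule Lim_transform_eventually)
  then show ?thesis unfolding has_field_derivative_iff tau_deriv_eq by simp
qed

end


section \<open>The measures: support, corners, and self-similarity on balls\<close>

lemma vimage_affine_ball:
  assumes "s > (0::real)"
  shows "(\<lambda>x. s * x + c) -` ball y h = ball ((y - c) / s) (h / s)"
proof (intro set_eqI)
  fix x
  have "dist y (s * x + c) = s * dist ((y - c) / s) x"
  proof -
    have "y - (s * x + c) = s * ((y - c) / s - x)" using assms by (simp add: field_simps)
    then show ?thesis using assms by (simp add: dist_real_def abs_mult)
  qed
  then show "x \<in> (\<lambda>x. s * x + c) -` ball y h \<longleftrightarrow> x \<in> ball ((y - c) / s) (h / s)"
    using assms by (simp add: field_simps)
qed

text \<open>
  \<open>C\<close> is chosen such that $C h^\kappa \ge 1$ for $h \ge s\,h_0$; smaller \<open>h\<close> are reached by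
  repeated scaling with \<open>s\<close>.
\<close>

lemma geometric_decay:
  fixes f :: "real \<Rightarrow> real"
  assumes s: "0 < s" "s < 1" and h0: "h0 > 0" and \<kappa>: "\<kappa> \<ge> 0"
    and P: "0 \<le> P" "P \<le> s powr \<kappa>"
    and rec: "\<And>h. 0 < h \<Longrightarrow> h \<le> h0 \<Longrightarrow> f h \<le> P * f (h / s)" and bnd: "\<And>h. f h \<le> 1"
  shows "\<exists>C. \<forall>h>0. f h \<le> C * h powr \<kappa>"
proof -
  define C where "C = (s * h0) powr (- \<kappa>)"
  have C: "C \<ge> 0" unfolding C_def by simp
  have key: "f h \<le> C * h powr \<kappa>" if "h \<ge> s ^ n * (s * h0)" for n h
    using that
  proof (induction n arbitrary: h)
    case 0
    then have "C * h powr \<kappa> \<ge> C * (s * h0) powr \<kappa>"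
      using s h0 \<kappa> C by (intro mult_left_mono powr_mono2) auto
    moreover have "C * (s * h0) powr \<kappa> = 1"
      unfolding C_def using s h0 by (simp add: powr_minus field_simps)
    ultimately show ?case using bnd[of h] by linarith
  next
    case (Suc n)
    have "s ^ Suc n * (s * h0) > 0" using s h0 by simp
    then have h: "h > 0" using Suc.prems by linarith
    show ?case
    proof (cases "h \<le> h0")
      case True
      have "s ^ n * (s * h0) \<le> h / s" using Suc.prems s by (simp add: field_simps)
      then have "f (h / s) \<le> C * (h / s) powr \<kappa>" by (rule Suc.IH)
      then have "f h \<le> P * (C * (h / s) powr \<kappa>)"
        using rec[OF h True] P mult_left_mono by (meson order_trans)
      also have "\<dots> \<le> s powr \<kappa> * (C * (h / s) powr \<kappa>)"
        using P C by (intro mult_right_mono) auto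
      also have "\<dots> = C * h powr \<kappa>" using s h by (simp add: powr_divide)
      finally show ?thesis .
    next
      case False
      then have "C * h powr \<kappa> \<ge> C * (s * h0) powr \<kappa>"
        using s h0 \<kappa> C by (intro mult_left_mono powr_mono2) (auto simp: mult_le_cancel_right1 intro: order_trans[of _ h0])
      moreover have "C * (s * h0) powr \<kappa> = 1"
        unfolding C_def using s h0 by (simp add: powr_minus field_simps)
      ultimately show ?thesis using bnd[of h] by linarith
    qed
  qed
  have "f h \<le> C * h powr \<kappa>" if "h > 0" for h
  proof -
    have "(\<lambda>n. s ^ n * (s * h0)) \<longlonglongrightarrow> 0 * (s * h0)"
      using s by (intro tendsto_mult LIMSEQ_realpow_zero tendsto_const) auto
    then have "eventually (\<lambda>n. s ^ n * (s * h0) < h) sequentially"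
      using that by (intro order_tendstoD(2)) auto
    then obtain n where "s ^ n * (s * h0) < h" by (auto simp: eventually_sequentially)
    then show ?thesis using key[of n h] by simp
  qed
  then show ?thesis by blast
qed

locale overlap_system = overlap_weights +
  fixes \<mu>1 \<mu>2 :: "real measure"
  assumes gds: "graph_directed_measures \<rho> r p \<mu>1 \<mu>2"
begin

sublocale M1: prob_space \<mu>1
  using gds unfolding graph_directed_measures_def by blast

sublocale M2: prob_space \<mu>2
  using gds unfolding graph_directed_measures_def by blast

lemma sets_\<mu> [simp, measurable_cong]: "sets \<mu>1 = sets borel" "sets \<mu>2 = sets borel"
  using gds unfolding graph_directed_measures_def by blast+

lemma space_\<mu> [simp]: "space \<mu>1 = UNIV" "space \<mu>2 = UNIV"
  using sets_eq_imp_space_eq[OF sets_\<mu>(1)] sets_eq_imp_space_eq[OF sets_\<mu>(2)] by auto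

lemma self_similar:
  assumes "A \<in> sets borel"
  shows "measure \<mu>1 A = p E1 * measure \<mu>1 (S \<rho> r E1 -` A) + p E2 * measure \<mu>2 (S \<rho> r E2 -` A)
            + p E3 * measure \<mu>1 (S \<rho> r E3 -` A)"
    and "measure \<mu>2 A = p E4 * measure \<mu>2 (S \<rho> r E4 -` A) + p E5 * measure \<mu>1 (S \<rho> r E5 -` A)"
  using gds assms unfolding graph_directed_measures_def by blast+

definition \<l> :: real where "\<l> = \<rho> + r - \<rho> * r"

lemma geometry: "\<rho> < \<l>" "\<l> \<le> 1 - r" "\<rho> < 1 - r" "\<l> < 1" "0 < \<l>"
    "\<rho> * \<l> \<le> \<rho> * (1 - r)" "\<rho> < (\<rho> + r) * (1 - r)" "(\<rho> + r) * (1 - r) < \<l>" "\<l> = \<rho> * (1 - r) + r"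
proof -
  have *: "0 < r * (1 - \<rho>)" using \<rho> r by simp
  then show 1: "\<rho> < \<l>" unfolding \<l>_def by (simp add: algebra_simps)
  show 2: "\<l> \<le> 1 - r" unfolding \<l>_def using separation by simp
  show 3: "\<rho> < 1 - r" using 1 2 by simp
  show "\<l> < 1" "0 < \<l>" using 1 2 \<rho> r by auto
  show "\<rho> * \<l> \<le> \<rho> * (1 - r)" using 2 \<rho> by simp
  have "r * \<rho> < r * (1 - r)" using 3 r by simp
  then show "\<rho> < (\<rho> + r) * (1 - r)" by (simp add: algebra_simps)
  have "0 < r * r" using r by simp
  then show "(\<rho> + r) * (1 - r) < \<l>" unfolding \<l>_def by (simp add: algebra_simps)
  show "\<l> = \<rho> * (1 - r) + r" unfolding \<l>_def by (simp add: algebra_simps)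
qed

lemma p_less_1: "p e < 1"
  using p_pos[of E1] p_pos[of E2] p_pos[of E3] p_pos[of E4] p_pos[of E5] p_sum1 p_sum2
  by (cases e) auto

text \<open>
  Let $T(R)$ be the larger mass of the two measures outside $[-R, 1+R]$. All maps send $[-R,1+R]$ into
  $[-cR, 1+cR]$ with $c = \max(\rho,r)$, so $T(cR) \le T(R)$. Hence $T(R) \le T(R/c^n) \to 0$.
\<close>

lemma outside_null: "measure \<mu>1 (- {0..1}) = 0" "measure \<mu>2 (- {0..1}) = 0"
proof -
  define c where "c = max \<rho> r"
  have c: "0 < c" "c < 1" "\<rho> \<le> c" "r \<le> c" unfolding c_def using \<rho> r by auto
  define out where "out R = - {- R..1 + R}" for R :: real
  have out_sets [measurable]: "out R \<in> sets borel" for R unfolding out_def by simp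
  have anti: "out R \<subseteq> out R'" if "R' \<le> R" for R R' unfolding out_def using that by auto
  define T where "T R = max (measure \<mu>1 (out R)) (measure \<mu>2 (out R))" for R
  have shrink: "S \<rho> r e -` out (c * R) \<subseteq> out R" if R: "R \<ge> 0" for e R
  proof
    fix x assume x: "x \<in> S \<rho> r e -` out (c * R)"
    show "x \<in> out R"
    proof (rule ccontr)
      assume "x \<notin> out R"
      then have xR: "- R \<le> x" "x \<le> 1 + R" unfolding out_def by auto
      have 1: "- (\<rho> * R) \<le> \<rho> * x" "\<rho> * x \<le> \<rho> + \<rho> * R" "- (r * R) \<le> r * x" "r * x \<le> r + r * R"
        using mult_left_mono[OF xR(1), of \<rho>] mult_left_mono[OF xR(2), of \<rho>]
          mult_left_mono[OF xR(1), of r] mult_left_mono[OF xR(2), of r] \<rho> r by (auto simp: distrib_left)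
      have 2: "\<rho> * R \<le> c * R" "r * R \<le> c * R" "0 \<le> \<rho> * (1 - r)" "\<rho> * (1 - r) + r \<le> 1"
        using R c \<rho> r geometry by (auto intro: mult_right_mono)
      have "- (c * R) \<le> S \<rho> r e x \<and> S \<rho> r e x \<le> 1 + c * R"
        by (cases e; simp only: S.simps; intro conjI; use 1 2 \<rho> r in linarith)
      then show False using x unfolding out_def by auto
    qed
  qed
  have mono: "T (c * R) \<le> T R" if R: "R \<ge> 0" for R
  proof -
    have m: "measure \<mu>1 (S \<rho> r e -` out (c * R)) \<le> T R" "measure \<mu>2 (S \<rho> r e -` out (c * R)) \<le> T R" for e
      using M1.finite_measure_mono[OF shrink[OF R]] M2.finite_measure_mono[OF shrink[OF R]]
      unfolding T_def by (auto simp: le_max_iff_disj)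
    have "measure \<mu>1 (out (c * R)) \<le> p E1 * T R + p E2 * T R + p E3 * T R"
      unfolding self_similar(1)[of "out (c * R)", simplified] using p_pos m
      by (intro add_mono mult_left_mono) (auto simp: less_imp_le)
    moreover have "measure \<mu>2 (out (c * R)) \<le> p E4 * T R + p E5 * T R"
      unfolding self_similar(2)[of "out (c * R)", simplified] using p_pos m
      by (intro add_mono mult_left_mono) (auto simp: less_imp_le)
    ultimately show ?thesis unfolding T_def[of "c * R"]
      using p_sum1 p_sum2 by (simp add: distrib_right[symmetric])
  qed
  have T0: "T R = 0" if R: "R > 0" for R
  proof -
    have le: "T R \<le> T (R / c ^ n)" for n
    proof (induction n)
      case (Suc n)
      have "T (R / c ^ n) = T (c * (R / c ^ Suc n))" using c by (simp add: field_simps)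
      also have "\<dots> \<le> T (R / c ^ Suc n)" using R c by (intro mono) auto
      finally show ?case using Suc by simp
    qed auto
    have lim0: "(\<lambda>n. measure M (out (R / c ^ n))) \<longlonglongrightarrow> measure M (\<Inter>n. out (R / c ^ n))"
      if "finite_measure M" "sets M = sets borel" for M
    proof (rule finite_measure.finite_Lim_measure_decseq[OF that(1)])
      show "range (\<lambda>n. out (R / c ^ n)) \<subseteq> sets M" unfolding that(2) using out_sets by blast
      have "R / c ^ n \<le> R / c ^ Suc n" for n
      proof (rule divide_left_mono)
        show "c ^ Suc n \<le> c ^ n" using c by (intro power_decreasing) auto
        show "0 \<le> R" "0 < c ^ n * c ^ Suc n" using c R by simp_all
      qed
      then show "decseq (\<lambda>n. out (R / c ^ n))" by (intro decseq_SucI anti)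
    qed
    have "(\<Inter>n. out (R / c ^ n)) = {}"
    proof -
      have "\<exists>n. x \<notin> out (R / c ^ n)" for x
      proof -
        have "filterlim (\<lambda>n. inverse (c ^ n)) at_top sequentially"
          using c by (intro filterlim_inverse_at_top LIMSEQ_realpow_zero) auto
        then have "eventually (\<lambda>n. inverse (c ^ n) \<ge> \<bar>x\<bar> / R) sequentially"
          unfolding filterlim_at_top by blast
        then obtain n where "inverse (c ^ n) \<ge> \<bar>x\<bar> / R" by (auto simp: eventually_sequentially)
        then have "\<bar>x\<bar> \<le> R / c ^ n" using R by (simp add: field_simps)
        then show ?thesis unfolding out_def by (intro exI[of _ n]) auto
      qed
      then show ?thesis by blast
    qed
    then have "(\<lambda>n. T (R / c ^ n)) \<longlonglongrightarrow> max 0 0"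
      unfolding T_def using lim0[of \<mu>1] lim0[of \<mu>2] M1.finite_measure_axioms M2.finite_measure_axioms
      by (intro tendsto_max) auto
    then have "T R \<le> max 0 0" using le by (intro LIMSEQ_le_const) auto
    moreover have "T R \<ge> 0" unfolding T_def by (simp add: le_max_iff_disj)
    ultimately show ?thesis by simp
  qed
  have eq: "- {0..1} = (\<Union>n. out (1 / real (Suc n)))"
  proof -
    have "x \<in> (\<Union>n. out (1 / real (Suc n)))" if "x \<notin> {0..1}" for x
    proof -
      have "max (- x) (x - 1) > 0" using that by auto
      then obtain n where "1 / real (Suc n) < max (- x) (x - 1)" using nat_approx_posE by blast
      then show ?thesis unfolding out_def by (auto intro!: exI[of _ n])
    qed
    moreover have "x \<notin> out (1 / real (Suc n))" if "x \<in> {0..1}" for x n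
    proof -
      have "0 \<le> 1 / real (Suc n)" by simp
      then show ?thesis using that unfolding out_def Compl_iff atLeastAtMost_iff by linarith
    qed
    ultimately show ?thesis by blast
  qed
  have null: "measure M (- {0..1}) = 0" if "finite_measure M" "sets M = sets borel"
    "\<And>R. R > 0 \<Longrightarrow> measure M (out R) = 0" for M
  proof -
    interpret finite_measure M by fact
    have "emeasure M (\<Union>n. out (1 / real (Suc n))) = 0"
      using that by (intro emeasure_UN_eq_0) (auto simp: emeasure_eq_measure)
    then show ?thesis unfolding eq measure_def by simp
  qed
  have "measure \<mu>1 (out R) = 0" "measure \<mu>2 (out R) = 0" if "R > 0" for R
    using T0[OF that] measure_nonneg[of \<mu>1 "out R"] measure_nonneg[of \<mu>2 "out R"]
    unfolding T_def by linarith+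
  then show "measure \<mu>1 (- {0..1}) = 0" "measure \<mu>2 (- {0..1}) = 0"
    using null M1.finite_measure_axioms M2.finite_measure_axioms by auto
qed

definition ball1 :: "real \<Rightarrow> real \<Rightarrow> real" where "ball1 x h = measure \<mu>1 (ball x h)"
definition ball2 :: "real \<Rightarrow> real \<Rightarrow> real" where "ball2 x h = measure \<mu>2 (ball x h)"

lemma ball_bounds: "0 \<le> ball1 x h" "ball1 x h \<le> 1" "0 \<le> ball2 x h" "ball2 x h \<le> 1"
  unfolding ball1_def ball2_def by auto

text \<open>
  Only the part of a ball in $[0,1]$ carries mass.
\<close>

lemma ball_mono_support:
  assumes "\<And>y. 0 \<le> y \<Longrightarrow> y \<le> 1 \<Longrightarrow> \<bar>y - x\<bar> < h \<Longrightarrow> \<bar>y - x'\<bar> < h'"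
  shows "ball1 x h \<le> ball1 x' h'" "ball2 x h \<le> ball2 x' h'"
proof -
  have sub: "ball x h \<subseteq> ball x' h' \<union> - {0..1}"
    using assms by (auto simp: dist_real_def abs_minus_commute)
  have "measure M (ball x h) \<le> measure M (ball x' h')"
    if "finite_measure M" "sets M = sets borel" "measure M (- {0..1}) = 0" for M
  proof -
    interpret finite_measure M by fact
    have "measure M (ball x h) \<le> measure M (ball x' h' \<union> - {0..1})"
      using sub that by (intro finite_measure_mono) auto
    also have "\<dots> \<le> measure M (ball x' h') + measure M (- {0..1})"
      using that by (intro measure_subadditive) (auto simp: emeasure_eq_measure)
    finally show ?thesis using that by simp
  qed
  then show "ball1 x h \<le> ball1 x' h'" "ball2 x h \<le> ball2 x' h'"
    unfolding ball1_def ball2_def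
    using outside_null M1.finite_measure_axioms M2.finite_measure_axioms by auto
qed

lemma ball_null:
  assumes "x + h \<le> 0 \<or> 1 \<le> x - h"
  shows "ball1 x h = 0" "ball2 x h = 0"
proof -
  have "ball1 x h \<le> ball1 0 0" "ball2 x h \<le> ball2 0 0"
    by (rule ball_mono_support; use assms in auto)+
  moreover have "ball1 0 0 = 0" "ball2 0 0 = 0" unfolding ball1_def ball2_def by auto
  ultimately show "ball1 x h = 0" "ball2 x h = 0" using ball_bounds by (metis order_antisym)+
qed

lemma ball_null_scaled:
  assumes "s > 0" "x + h \<le> 0 \<or> s \<le> x - h"
  shows "ball1 (x / s) (h / s) = 0" "ball2 (x / s) (h / s) = 0"
proof -
  have "(x + h) / s \<le> 0 \<or> 1 \<le> (x - h) / s" using assms by (simp add: divide_le_0_iff le_divide_eq)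
  then show "ball1 (x / s) (h / s) = 0" "ball2 (x / s) (h / s) = 0"
    unfolding add_divide_distrib diff_divide_distrib by (auto intro: ball_null)
qed

lemma ball_full:
  assumes "x - h < 0" "1 < x + h"
  shows "ball1 x h = 1" "ball2 x h = 1"
proof -
  have "measure M (ball x h) = 1" if "prob_space M" "sets M = sets borel" "measure M (- {0..1}) = 0" for M
  proof -
    interpret prob_space M by fact
    have sp: "space M = UNIV" using sets_eq_imp_space_eq[OF that(2)] by simp
    have "prob (- ball x h) \<le> prob (- {0..1})"
      using assms that by (intro finite_measure_mono) (auto simp: dist_real_def)
    then have "prob (space M - ball x h) \<le> 0" using that
      by (simp add: sp Compl_eq_Diff_UNIV)
    then show ?thesis using prob_compl[of "ball x h"] that prob_le_1[of "ball x h"] by auto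
  qed
  then show "ball1 x h = 1" "ball2 x h = 1"
    unfolding ball1_def ball2_def using outside_null M1.prob_space_axioms M2.prob_space_axioms by auto
qed

lemma ball1_rec: "ball1 x h = p E1 * ball1 (x / \<rho>) (h / \<rho>) + p E2 * ball2 ((x - \<rho> * (1 - r)) / r) (h / r)
    + p E3 * ball1 ((x - (1 - r)) / r) (h / r)"
  and ball2_rec: "ball2 x h = p E4 * ball2 ((x - (1 - r)) / r) (h / r) + p E5 * ball1 (x / \<rho>) (h / \<rho>)"
proof -
  have S: "S \<rho> r E1 = (\<lambda>x. \<rho> * x + 0)" "S \<rho> r E2 = (\<lambda>x. r * x + \<rho> * (1 - r))"
    "S \<rho> r E3 = (\<lambda>x. r * x + (1 - r))" "S \<rho> r E4 = (\<lambda>x. r * x + (1 - r))" "S \<rho> r E5 = (\<lambda>x. \<rho> * x + 0)"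
    by (auto simp: fun_eq_iff)
  show "ball1 x h = p E1 * ball1 (x / \<rho>) (h / \<rho>) + p E2 * ball2 ((x - \<rho> * (1 - r)) / r) (h / r)
    + p E3 * ball1 ((x - (1 - r)) / r) (h / r)"
    "ball2 x h = p E4 * ball2 ((x - (1 - r)) / r) (h / r) + p E5 * ball1 (x / \<rho>) (h / \<rho>)"
    unfolding ball1_def ball2_def self_similar[of "ball x h", simplified] S
      vimage_affine_ball[OF \<rho>(1)] vimage_affine_ball[OF r(1)] by auto
qed

text \<open>
  The slowest decay of the masses of balls centred at the end points of $[0,1]$.
\<close>

definition \<kappa> :: real where
  "\<kappa> = min (ln (p E1) / ln \<rho>) (min (ln (p E3) / ln r) (ln (p E4) / ln r))"

lemma \<kappa>_pos: "\<kappa> > 0" and p_le_\<kappa>: "p E1 \<le> \<rho> powr \<kappa>" "p E3 \<le> r powr \<kappa>" "p E4 \<le> r powr \<kappa>"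
proof -
  have ln: "ln \<rho> < 0" "ln r < 0" "ln (p e) < 0" for e
    using \<rho> r p_pos[of e] p_less_1[of e] by auto
  show "\<kappa> > 0" unfolding \<kappa>_def using ln by (simp add: divide_neg_neg)
  have *: "p e \<le> s powr \<kappa>" if "0 < s" "s < 1" "\<kappa> \<le> ln (p e) / ln s" for e s
  proof -
    have "ln (p e) \<le> \<kappa> * ln s" using that ln_less_zero[of s] by (simp add: neg_le_divide_eq)
    then have "exp (ln (p e)) \<le> exp (\<kappa> * ln s)" by simp
    then show ?thesis using p_pos[of e] that by (simp add: powr_def)
  qed
  show "p E1 \<le> \<rho> powr \<kappa>" "p E3 \<le> r powr \<kappa>" "p E4 \<le> r powr \<kappa>"
    using \<rho> r *[of \<rho> E1] *[of r E3] *[of r E4] unfolding \<kappa>_def by auto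
qed

text \<open>
  The exceptional points are the end points of the cells. Decay of the mass near a point follows from
  decay near its preimages, and a point outside $(0,1)$ sees only the corners of $[0,1]$.
\<close>

definition decays1 :: "real \<Rightarrow> bool" where "decays1 e \<longleftrightarrow> (\<exists>C. \<forall>h>0. ball1 e h \<le> C * h powr \<kappa>)"
definition decays2 :: "real \<Rightarrow> bool" where "decays2 e \<longleftrightarrow> (\<exists>C. \<forall>h>0. ball2 e h \<le> C * h powr \<kappa>)"

lemma power_bound_scale:
  assumes "\<forall>h>0. f h \<le> C * h powr \<kappa>" "s > 0" "h > (0::real)"
  shows "f (h / s) \<le> C * s powr (- \<kappa>) * h powr \<kappa>"
  using assms by (auto simp: powr_divide powr_minus field_simps dest: spec[of _ "h / s"])

lemma decays1_step:
  assumes "decays1 (e / \<rho>)" "decays2 ((e - \<rho> * (1 - r)) / r)" "decays1 ((e - (1 - r)) / r)"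
  shows "decays1 e"
proof -
  obtain C1 C2 C3 where C: "\<forall>h>0. ball1 (e / \<rho>) h \<le> C1 * h powr \<kappa>"
    "\<forall>h>0. ball2 ((e - \<rho> * (1 - r)) / r) h \<le> C2 * h powr \<kappa>"
    "\<forall>h>0. ball1 ((e - (1 - r)) / r) h \<le> C3 * h powr \<kappa>"
    using assms unfolding decays1_def decays2_def by blast
  have "ball1 e h \<le> (p E1 * (C1 * \<rho> powr (- \<kappa>)) + p E2 * (C2 * r powr (- \<kappa>)) + p E3 * (C3 * r powr (- \<kappa>))) * h powr \<kappa>"
    if "h > 0" for h
  proof -
    have "ball1 e h \<le> p E1 * (C1 * \<rho> powr (- \<kappa>) * h powr \<kappa>) + p E2 * (C2 * r powr (- \<kappa>) * h powr \<kappa>)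
        + p E3 * (C3 * r powr (- \<kappa>) * h powr \<kappa>)"
      unfolding ball1_rec[of e h] using p_pos that \<rho> r power_bound_scale[OF C(1)] power_bound_scale[OF C(2)] power_bound_scale[OF C(3)]
      by (intro add_mono mult_left_mono) (auto simp: less_imp_le)
    then show ?thesis by (simp add: algebra_simps)
  qed
  then show ?thesis unfolding decays1_def by blast
qed

lemma decays2_step:
  assumes "decays2 ((e - (1 - r)) / r)" "decays1 (e / \<rho>)"
  shows "decays2 e"
proof -
  obtain C1 C2 where C: "\<forall>h>0. ball2 ((e - (1 - r)) / r) h \<le> C1 * h powr \<kappa>"
    "\<forall>h>0. ball1 (e / \<rho>) h \<le> C2 * h powr \<kappa>"
    using assms unfolding decays1_def decays2_def by blast
  have "ball2 e h \<le> (p E4 * (C1 * r powr (- \<kappa>)) + p E5 * (C2 * \<rho> powr (- \<kappa>))) * h powr \<kappa>" if "h > 0" for h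
  proof -
    have "ball2 e h \<le> p E4 * (C1 * r powr (- \<kappa>) * h powr \<kappa>) + p E5 * (C2 * \<rho> powr (- \<kappa>) * h powr \<kappa>)"
      unfolding ball2_rec[of e h] using p_pos that \<rho> r power_bound_scale[OF C(1)] power_bound_scale[OF C(2)]
      by (intro add_mono mult_left_mono) (auto simp: less_imp_le)
    then show ?thesis by (simp add: algebra_simps)
  qed
  then show ?thesis unfolding decays2_def by blast
qed

lemma decays1_0: "decays1 0"
  unfolding decays1_def
proof (rule geometric_decay[OF \<rho> _ _ _ p_le_\<kappa>(1)])
  show "0 < \<rho> * (1 - r)" using \<rho> r by simp
  fix h assume h: "0 < h" "h \<le> \<rho> * (1 - r)"
  have *: "\<rho> * (1 - r) \<le> 1 - r" using \<rho> r by (simp add: mult_left_le_one_le)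
  have "ball2 ((0 - \<rho> * (1 - r)) / r) (h / r) = 0" "ball1 ((0 - (1 - r)) / r) (h / r) = 0"
    by (rule ball_null_scaled[OF r(1)], use h * in linarith)+
  then show "ball1 0 h \<le> p E1 * ball1 0 (h / \<rho>)" using ball1_rec[of 0 h] by simp
qed (use \<kappa>_pos p_pos[of E1] ball_bounds in \<open>auto simp: less_imp_le\<close>)

lemma decays1_1: "decays1 1"
  unfolding decays1_def
proof (rule geometric_decay[OF r _ _ _ p_le_\<kappa>(2)])
  show "0 < min (1 - \<rho>) (1 - \<l>)" using \<rho> geometry by simp
  fix h assume h: "0 < h" "h \<le> min (1 - \<rho>) (1 - \<l>)"
  have "ball2 ((1 - \<rho> * (1 - r)) / r) (h / r) = 0" "ball1 (1 / \<rho>) (h / \<rho>) = 0"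
    using h r \<rho> geometry(9) by (auto intro!: ball_null simp: diff_divide_distrib[symmetric] le_divide_eq)
  then show "ball1 1 h \<le> p E3 * ball1 1 (h / r)" using ball1_rec[of 1 h] r by simp
qed (use \<kappa>_pos p_pos[of E3] ball_bounds in auto)

lemma decays2_1: "decays2 1"
  unfolding decays2_def
proof (rule geometric_decay[OF r _ _ _ p_le_\<kappa>(3)])
  show "0 < 1 - \<rho>" using \<rho> by simp
  fix h assume h: "0 < h" "h \<le> 1 - \<rho>"
  have "ball1 (1 / \<rho>) (h / \<rho>) = 0"
    using h \<rho> by (auto intro!: ball_null simp: diff_divide_distrib[symmetric] le_divide_eq)
  then show "ball2 1 h \<le> p E4 * ball2 1 (h / r)" using ball2_rec[of 1 h] r by simp
qed (use \<kappa>_pos p_pos[of E4] ball_bounds in auto)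

lemma decays_mono:
  assumes "\<And>h. ball1 e h \<le> ball1 e' h" "\<And>h. ball2 e h \<le> ball2 e' h"
  shows "decays1 e' \<Longrightarrow> decays1 e" "decays2 e' \<Longrightarrow> decays2 e"
  using assms unfolding decays1_def decays2_def by (meson order_trans)+

lemma decays1_outside: "e \<le> 0 \<or> 1 \<le> e \<Longrightarrow> decays1 e"
proof (erule disjE)
  assume "e \<le> 0"
  then show ?thesis
    by (intro decays_mono(1)[OF _ _ decays1_0]; intro ball_mono_support) auto
next
  assume "1 \<le> e"
  then show ?thesis
    by (intro decays_mono(1)[OF _ _ decays1_1]; intro ball_mono_support) auto
qed

lemma decays2_ge_1: "1 \<le> e \<Longrightarrow> decays2 e"
  by (rule decays_mono(2)[OF _ _ decays2_1]; rule ball_mono_support; linarith)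

lemma decays2_neg_aux: "e < 0 \<Longrightarrow> decays2 e"
proof -
  assume e: "e < 0"
  have "ball2 e h \<le> (- e) powr (- \<kappa>) * h powr \<kappa>" if h: "h > 0" for h
  proof (cases "h \<le> - e")
    case True
    then show ?thesis using ball_null[of e h] by simp
  next
    case False
    then have "(- e) powr (- \<kappa>) * h powr \<kappa> \<ge> (- e) powr (- \<kappa>) * (- e) powr \<kappa>"
      using e \<kappa>_pos by (intro mult_left_mono powr_mono2) auto
    moreover have "(- e) powr (- \<kappa>) * (- e) powr \<kappa> = 1" using e by (simp add: powr_minus)
    ultimately show ?thesis using ball_bounds(4)[of e h] by linarith
  qed
  then show ?thesis unfolding decays2_def by blast
qed

text \<open>
  The corner $0$ of the second measure is the image of the corner $0$ of the first one, and the other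
  preimage is negative.
\<close>

lemma decays2_0: "decays2 0"
  using r by (intro decays2_step[of 0] decays2_neg_aux[of "(0 - (1 - r)) / r"]) (auto simp: decays1_0 divide_less_0_iff)

lemma decays2_outside: "e \<le> 0 \<or> 1 \<le> e \<Longrightarrow> decays2 e"
  using decays2_0 decays2_neg_aux decays2_ge_1 by (cases "e = 0") auto

lemma decays_1mr: "decays1 (1 - r)" "decays2 (1 - r)"
proof -
  have 1: "1 \<le> (1 - r) / \<rho>" using geometry(3) \<rho> by (simp add: le_divide_eq)
  have 2: "1 \<le> (1 - r - \<rho> * (1 - r)) / r" using geometry(2,9) r by (simp add: le_divide_eq)
  show "decays1 (1 - r)"
    by (rule decays1_step) (use 1 2 in \<open>auto intro!: decays1_outside decays2_outside\<close>)
  show "decays2 (1 - r)"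
    by (rule decays2_step) (use 1 in \<open>auto intro!: decays1_outside decays2_outside\<close>)
qed

lemma decays_\<rho>: "decays1 \<rho>" "decays2 \<rho>"
proof -
  have 1: "(\<rho> - (1 - r)) / r \<le> 0" using geometry(3) r by (simp add: divide_le_0_iff)
  show 2: "decays2 \<rho>"
    by (rule decays2_step) (use 1 \<rho> in \<open>auto intro!: decays1_outside decays2_outside\<close>)
  have 3: "(\<rho> - \<rho> * (1 - r)) / r = \<rho>" using r by (simp add: field_simps)
  show "decays1 \<rho>"
    by (rule decays1_step) (use 1 2 3 \<rho> in \<open>auto intro!: decays1_outside\<close>)
qed

lemma decays_\<l>: "decays1 \<l>" "decays2 \<l>"
proof -
  have 1: "1 \<le> \<l> / \<rho>" "(\<l> - (1 - r)) / r \<le> 0" "(\<l> - \<rho> * (1 - r)) / r = 1"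
    using geometry(1,2,9) r \<rho> by (auto simp: le_divide_eq divide_le_0_iff)
  show "decays1 \<l>"
    by (rule decays1_step) (use 1 in \<open>auto intro!: decays1_outside decays2_outside\<close>)
  show "decays2 \<l>"
    by (rule decays2_step) (use 1 in \<open>auto intro!: decays1_outside decays2_outside\<close>)
qed

lemma decays_\<rho>1mr: "decays1 (\<rho> * (1 - r))" "decays2 (\<rho> * (1 - r))"
proof -
  have "\<rho> * (1 - r) \<le> 1 - r" using \<rho> r by (simp add: mult_left_le_one_le)
  then have 1: "(\<rho> * (1 - r) - (1 - r)) / r \<le> 0" "\<rho> * (1 - r) / \<rho> = 1 - r"
    using r \<rho> by (auto simp: divide_le_0_iff)
  show "decays1 (\<rho> * (1 - r))"
    by (rule decays1_step) (use 1 decays_1mr in \<open>auto intro!: decays1_outside decays2_outside\<close>)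
  show "decays2 (\<rho> * (1 - r))"
    by (rule decays2_step) (use 1 decays_1mr in \<open>auto intro!: decays1_outside decays2_outside\<close>)
qed

lemma decays_\<rho>\<l>: "decays1 (\<rho> * \<l>)" "decays2 (\<rho> * \<l>)"
proof -
  have "\<rho> * \<l> \<le> 1 - r" "\<rho> * \<l> \<le> \<rho> * (1 - r)"
    using \<rho> r geometry(6) mult_left_le_one_le[of "1 - r" \<rho>] by linarith+
  then have 1: "(\<rho> * \<l> - (1 - r)) / r \<le> 0" "(\<rho> * \<l> - \<rho> * (1 - r)) / r \<le> 0" "\<rho> * \<l> / \<rho> = \<l>"
    using r \<rho> by (auto simp: divide_le_0_iff)
  show "decays1 (\<rho> * \<l>)"
    by (rule decays1_step) (use 1 decays_\<l> in \<open>auto intro!: decays1_outside decays2_outside\<close>)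
  show "decays2 (\<rho> * \<l>)"
    by (rule decays2_step) (use 1 decays_\<l> in \<open>auto intro!: decays1_outside decays2_outside\<close>)
qed

lemma decays_corner: "decays1 ((\<rho> + r) * (1 - r))" "decays2 ((\<rho> + r) * (1 - r))"
proof -
  have 1: "1 \<le> (\<rho> + r) * (1 - r) / \<rho>" "((\<rho> + r) * (1 - r) - (1 - r)) / r \<le> 0"
    "((\<rho> + r) * (1 - r) - \<rho> * (1 - r)) / r = 1 - r"
    using geometry(2,7,8) r \<rho> by (auto simp: le_divide_eq divide_le_0_iff) (simp add: field_simps)
  show "decays1 ((\<rho> + r) * (1 - r))"
    by (rule decays1_step) (use 1 decays_1mr in \<open>auto intro!: decays1_outside decays2_outside\<close>)
  show "decays2 ((\<rho> + r) * (1 - r))"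
    by (rule decays2_step) (use 1 decays_1mr in \<open>auto intro!: decays1_outside decays2_outside\<close>)
qed

end


section \<open>Integrals of powers of ball masses\<close>

context overlap_system
begin

definition mix :: "real \<Rightarrow> real \<Rightarrow> real \<Rightarrow> real \<Rightarrow> real" where
  "mix a b x h = a * ball1 x h + b * ball2 x h"

text \<open>
  For \<open>a = b = 1\<close> and a cell $(u,v)$ this is $\varphi_\ell$.
\<close>

definition Lint :: "real \<Rightarrow> real \<Rightarrow> real \<Rightarrow> real \<Rightarrow> real \<Rightarrow> real \<Rightarrow> real" where
  "Lint q a b u v h = (LINT x:{u<..<v}|lborel. mix a b x h powr q)"

lemma mix_nonneg: "a \<ge> 0 \<Longrightarrow> b \<ge> 0 \<Longrightarrow> mix a b x h \<ge> 0"
  unfolding mix_def using ball_bounds by simp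

lemma mix_le: "a \<ge> 0 \<Longrightarrow> b \<ge> 0 \<Longrightarrow> mix a b x h \<le> a + b"
  unfolding mix_def using ball_bounds by (intro add_mono) (auto intro: mult_left_le)

lemma mix_mono_support:
  assumes "a \<ge> 0" "b \<ge> 0" "\<And>y. 0 \<le> y \<Longrightarrow> y \<le> 1 \<Longrightarrow> \<bar>y - x\<bar> < h \<Longrightarrow> \<bar>y - x'\<bar> < h'"
  shows "mix a b x h \<le> mix a b x' h'"
  unfolding mix_def using assms(1,2) ball_mono_support[OF assms(3)]
  by (intro add_mono mult_left_mono) auto

lemma borel_measurable_ball:
  assumes [measurable_cong]: "sets M = sets borel" and "finite_measure M"
  shows "(\<lambda>x::real. measure M (ball x h)) \<in> borel_measurable borel"
proof (cases "h > 0")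
  case True
  interpret finite_measure M by fact
  have "measure M (ball x h) = measure M {..<x + h} - measure M {..x - h}" for x
  proof -
    have "ball x h = {..<x + h} - {..x - h}" by (auto simp: dist_real_def)
    then show ?thesis using True assms by (subst finite_measure_Diff[symmetric]) auto
  qed
  moreover have "mono (\<lambda>x. measure M {..<x + h})" "mono (\<lambda>x. measure M {..x - h})"
    by (intro monoI finite_measure_mono; simp add: assms(1))+
  then have "(\<lambda>x. measure M {..<x + h}) \<in> borel_measurable borel" "(\<lambda>x. measure M {..x - h}) \<in> borel_measurable borel"
    by (auto intro: borel_measurable_mono)
  ultimately show ?thesis by simp
next
  case False
  then have "ball x h = {}" for x :: real by simp
  then show ?thesis by (simp only: measure_empty) simp
qed

lemma mix_measurable [measurable]: "(\<lambda>x. mix a b x h) \<in> borel_measurable borel"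
proof -
  have [measurable]: "(\<lambda>x. ball1 x h) \<in> borel_measurable borel" "(\<lambda>x. ball2 x h) \<in> borel_measurable borel"
    unfolding ball1_def ball2_def
    by (auto intro!: borel_measurable_ball M1.finite_measure_axioms M2.finite_measure_axioms)
  show ?thesis unfolding mix_def by measurable
qed

lemma Lint_integrable:
  assumes "a \<ge> 0" "b \<ge> 0" "q \<ge> 0"
  shows "set_integrable lborel {u<..<v} (\<lambda>x. mix a b x h powr q)"
  unfolding set_integrable_def
proof (rule integrableI_bounded_set_indicator[where B = "(a + b) powr q"])
  show "emeasure lborel {u<..<v} < \<infinity>" by (cases "u \<le> v") auto
  show "AE x in lborel. x \<in> {u<..<v} \<longrightarrow> norm (mix a b x h powr q) \<le> (a + b) powr q"
    using assms by (auto intro!: powr_mono2 mix_nonneg mix_le)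
qed auto

lemma Lint_nonneg: "Lint q a b u v h \<ge> 0"
  unfolding Lint_def set_lebesgue_integral_def by (intro Bochner_Integration.integral_nonneg) auto

lemma Lint_split:
  assumes "a \<ge> 0" "b \<ge> 0" "q \<ge> 0" "u \<le> v" "v \<le> w"
  shows "Lint q a b u w h = Lint q a b u v h + Lint q a b v w h"
proof -
  have "Lint q a b u v h + Lint q a b v w h
      = (LINT x|lborel. indicator {u<..<v} x * mix a b x h powr q + indicator {v<..<w} x * mix a b x h powr q)"
    unfolding Lint_def set_lebesgue_integral_def
    using Lint_integrable[OF assms(1-3), of u v h] Lint_integrable[OF assms(1-3), of v w h]
    by (subst Bochner_Integration.integral_add) (auto simp: set_integrable_def)
  also have "\<dots> = (LINT x|lborel. indicator {u<..<w} x * mix a b x h powr q)"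
  proof (rule integral_cong_AE)
    show "AE x in lborel. indicator {u<..<v} x * mix a b x h powr q + indicator {v<..<w} x * mix a b x h powr q
        = indicator {u<..<w} x * mix a b x h powr q"
      using AE_lborel_singleton[of v] by eventually_elim (use assms in \<open>auto simp: indicator_def\<close>)
  qed auto
  finally show ?thesis unfolding Lint_def set_lebesgue_integral_def by simp
qed

lemma Lint_mono:
  assumes "a \<ge> 0" "b \<ge> 0" "q \<ge> 0" "h \<le> h'"
  shows "Lint q a b u v h \<le> Lint q a b u v h'"
  unfolding Lint_def
  using assms by (intro set_integral_mono Lint_integrable powr_mono2 mix_nonneg mix_mono_support) auto

lemma Lint_affine:
  assumes s: "s > 0"
  shows "(LINT x:{c<..<s * l + c}|lborel. mix a b ((x - c) / s) (h / s) powr q) = s * Lint q a b 0 l (h / s)"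
proof -
  have ind: "indicator {c<..<s * l + c} (c + s * x) = (indicator {0<..<l} x :: real)" for x
    using s by (auto simp: indicator_def zero_less_mult_iff)
  show ?thesis
    unfolding Lint_def set_lebesgue_integral_def
    using s by (subst lborel_integral_real_affine[where c = s and t = c]) (simp_all add: ind)
qed

text \<open>
  The lower inequality carries no error. This is what later keeps the solution of the renewal system away
  from \<open>0\<close>.
\<close>

definition close_above :: "real \<Rightarrow> (real \<Rightarrow> real) \<Rightarrow> (real \<Rightarrow> real) \<Rightarrow> bool" where
  "close_above q f g \<longleftrightarrow> (\<exists>C. \<forall>h>0. g h \<le> f h \<and> f h \<le> g h + C * h powr (1 + q * \<kappa>))"

lemma close_above_add:
  assumes "close_above q f g" "close_above q f' g'"
  shows "close_above q (\<lambda>h. f h + f' h) (\<lambda>h. g h + g' h)"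
proof -
  obtain C C' where "\<And>h. h > 0 \<Longrightarrow> g h \<le> f h \<and> f h \<le> g h + C * h powr (1 + q * \<kappa>)"
    "\<And>h. h > 0 \<Longrightarrow> g' h \<le> f' h \<and> f' h \<le> g' h + C' * h powr (1 + q * \<kappa>)"
    using assms unfolding close_above_def by blast
  then have "g h + g' h \<le> f h + f' h \<and> f h + f' h \<le> g h + g' h + (C + C') * h powr (1 + q * \<kappa>)" if "h > 0" for h
    using that by (fastforce simp: distrib_right)
  then show ?thesis unfolding close_above_def by blast
qed

lemma decays_mix:
  assumes "decays1 e" "decays2 e" "a \<ge> 0" "b \<ge> 0"
  shows "\<exists>C\<ge>0. \<forall>h>0. mix a b e h \<le> C * h powr \<kappa>"
proof -
  obtain C1 C2 where C: "\<And>h. h > 0 \<Longrightarrow> ball1 e h \<le> C1 * h powr \<kappa>" "\<And>h. h > 0 \<Longrightarrow> ball2 e h \<le> C2 * h powr \<kappa>"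
    using assms unfolding decays1_def decays2_def by blast
  have "0 \<le> C1" "0 \<le> C2" using C[of 1] ball_bounds(1,3)[of e 1] by auto
  moreover have "mix a b e h \<le> (a * C1 + b * C2) * h powr \<kappa>" if "h > 0" for h
    unfolding mix_def using mult_left_mono[OF C(1)[OF that] assms(3)] mult_left_mono[OF C(2)[OF that] assms(4)]
    by (simp add: algebra_simps)
  ultimately show ?thesis using assms by (intro exI[of _ "a * C1 + b * C2"]) auto
qed

text \<open>
  On the cell $(u,v)$ the measure is at least \<open>k\<close> times the affine image of another combination, with
  equality for balls inside the cell. Balls that leave the cell have centres within \<open>h\<close> of \<open>u\<close> or \<open>v\<close>,
  a set of length $2h$, and are contained in a ball of radius $2h$ around that end point. This is the
  error $O(h \cdot h^{q\kappa})$; it is nonnegative, as it comes from mass of other cells.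
\<close>

lemma cell_approximation:
  assumes q: "q \<ge> 0" and ab: "a \<ge> 0" "b \<ge> 0" "a' \<ge> 0" "b' \<ge> 0" "k \<ge> 0" and s: "s > 0" and v: "v = s * l + u"
    and uv: "u \<le> v" and good: "decays1 u" "decays2 u" "decays1 v" "decays2 v"
    and lower: "\<And>x h. k * mix a' b' ((x - u) / s) (h / s) \<le> mix a b x h"
    and exact: "\<And>x h. h > 0 \<Longrightarrow> u \<le> x - h \<Longrightarrow> x + h \<le> v \<Longrightarrow> mix a b x h = k * mix a' b' ((x - u) / s) (h / s)"
  shows "close_above q (Lint q a b u v) (\<lambda>h. k powr q * s * Lint q a' b' 0 l (h / s))"
proof -
  obtain C1 C2 where C1: "C1 \<ge> 0" "\<And>h. h > 0 \<Longrightarrow> mix a b u h \<le> C1 * h powr \<kappa>"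
    and C2: "C2 \<ge> 0" "\<And>h. h > 0 \<Longrightarrow> mix a b v h \<le> C2 * h powr \<kappa>"
    using decays_mix[OF good(1,2) ab(1,2)] decays_mix[OF good(3,4) ab(1,2)] by blast
  \<comment> \<open>the factor \<open>2 powr \<kappa>\<close> accounts for balls of radius $2h$ around the end points\<close>
  define C where "C = max C1 C2 * 2 powr \<kappa>"
  have C: "C \<ge> 0" unfolding C_def using C1 by simp
  define f g where "f h x = mix a b x h powr q" and "g h x = (k * mix a' b' ((x - u) / s) (h / s)) powr q" for h x
  have int_g: "set_integrable lborel {u<..<v} (g h)" for h
    unfolding set_integrable_def
  proof (rule integrableI_bounded_set_indicator[where B = "(k * (a' + b')) powr q"])
    show "emeasure lborel {u<..<v} < \<infinity>" using uv by auto
    show "AE x in lborel. x \<in> {u<..<v} \<longrightarrow> norm (g h x) \<le> (k * (a' + b')) powr q"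
      unfolding g_def using ab q by (auto intro!: powr_mono2 mult_nonneg_nonneg mult_left_mono mix_nonneg mix_le)
    show "g h \<in> borel_measurable lborel" unfolding g_def
      using measurable_compose[OF _ mix_measurable[of a' b' "h / s"], of "\<lambda>x. (x - u) / s" borel] by simp
  qed auto
  have int_f: "set_integrable lborel {u<..<v} (f h)" for h
    unfolding f_def by (rule Lint_integrable[OF ab(1,2) q])
  have f_eq: "Lint q a b u v h = (LINT x:{u<..<v}|lborel. f h x)" for h
    unfolding Lint_def f_def ..
  have g_eq: "k powr q * s * Lint q a' b' 0 l (h / s) = (LINT x:{u<..<v}|lborel. g h x)" for h
  proof -
    have "(LINT x:{u<..<v}|lborel. g h x)
        = (LINT x:{u<..<v}|lborel. k powr q * mix a' b' ((x - u) / s) (h / s) powr q)"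
      unfolding g_def using ab by (intro set_lebesgue_integral_cong) (auto simp: powr_mult mix_nonneg)
    also have "\<dots> = k powr q * (s * Lint q a' b' 0 l (h / s))"
      using Lint_affine[OF s, of u l a' b' h q] unfolding v by simp
    finally show ?thesis by simp
  qed
  have le: "g h x \<le> f h x" for h x
    unfolding f_def g_def using ab q lower by (intro powr_mono2) (auto intro!: mult_nonneg_nonneg mix_nonneg)
  have upper: "f h x \<le> g h x + C powr q * h powr (q * \<kappa>) * (indicator {u<..<u + h} x + indicator {v - h<..<v} x)"
    if h: "h > 0" and x: "x \<in> {u<..<v}" for h x
  proof (cases "u + h \<le> x \<and> x \<le> v - h")
    case True
    then have "f h x = g h x" unfolding f_def g_def using exact[OF h, of x] by simp
    then show ?thesis by simp
  next
    case False
    have "mix a b x h \<le> max C1 C2 * (2 * h) powr \<kappa>"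
    proof (cases "u + h \<le> x")
      case True
      have "mix a b x h \<le> mix a b v (2 * h)"
        by (rule mix_mono_support) (use ab True False x h in auto)
      also have "\<dots> \<le> C2 * (2 * h) powr \<kappa>" using C2(2)[of "2 * h"] h by simp
      also have "\<dots> \<le> max C1 C2 * (2 * h) powr \<kappa>" by (intro mult_right_mono) auto
      finally show ?thesis .
    next
      case False
      have "mix a b x h \<le> mix a b u (2 * h)"
        by (rule mix_mono_support) (use ab False x h in auto)
      also have "\<dots> \<le> C1 * (2 * h) powr \<kappa>" using C1(2)[of "2 * h"] h by simp
      also have "\<dots> \<le> max C1 C2 * (2 * h) powr \<kappa>" by (intro mult_right_mono) auto
      finally show ?thesis .
    qed
    then have "f h x \<le> (C * h powr \<kappa>) powr q"
      unfolding f_def C_def using ab q h by (intro powr_mono2) (auto simp: powr_mult mix_nonneg mult.assoc)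
    also have "\<dots> = C powr q * h powr (q * \<kappa>)" using C by (simp add: powr_mult powr_powr mult.commute)
    also have "\<dots> \<le> C powr q * h powr (q * \<kappa>) * (indicator {u<..<u + h} x + indicator {v - h<..<v} x)"
    proof -
      have "(1::real) \<le> indicator {u<..<u + h} x + indicator {v - h<..<v} x"
        using False x by (auto simp: indicator_def)
      then have "C powr q * h powr (q * \<kappa>) * 1
          \<le> C powr q * h powr (q * \<kappa>) * (indicator {u<..<u + h} x + indicator {v - h<..<v} x)"
        by (intro mult_left_mono) auto
      then show ?thesis by simp
    qed
    finally show ?thesis unfolding g_def using powr_ge_zero by (smt (verit))
  qed
  show ?thesis
    unfolding close_above_def
  proof (intro exI[of _ "2 * C powr q"] allI impI conjI)
    fix h :: real assume h: "h > 0"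
    show "k powr q * s * Lint q a' b' 0 l (h / s) \<le> Lint q a b u v h"
      unfolding f_eq g_eq by (intro set_integral_mono int_f int_g le)
    have "Lint q a b u v h \<le> (LINT x|lborel. indicator {u<..<v} x * g h x
        + C powr q * h powr (q * \<kappa>) * (indicator {u<..<u + h} x + indicator {v - h<..<v} x))"
      unfolding f_eq set_lebesgue_integral_def
    proof (rule integral_mono)
      show "integrable lborel (\<lambda>x. indicator {u<..<v} x *\<^sub>R f h x)" using int_f unfolding set_integrable_def .
      show "integrable lborel (\<lambda>x. indicator {u<..<v} x * g h x
        + C powr q * h powr (q * \<kappa>) * (indicator {u<..<u + h} x + indicator {v - h<..<v} x))"
        using int_g[of h] h unfolding set_integrable_def
        by (intro Bochner_Integration.integrable_add integrable_mult_right) auto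
      fix x
      have "0 \<le> C powr q * h powr (q * \<kappa>) * (indicator {u<..<u + h} x + indicator {v - h<..<v} x)"
        by simp
      then show "indicator {u<..<v} x *\<^sub>R f h x \<le> indicator {u<..<v} x * g h x
        + C powr q * h powr (q * \<kappa>) * (indicator {u<..<u + h} x + indicator {v - h<..<v} x)"
        using upper[OF h, of x] by (cases "x \<in> {u<..<v}") auto
    qed
    also have "\<dots> = (LINT x:{u<..<v}|lborel. g h x) + C powr q * h powr (q * \<kappa>) * (h + h)"
      using int_g[of h] h unfolding set_integrable_def set_lebesgue_integral_def
      by (subst Bochner_Integration.integral_add) (auto simp: algebra_simps)
    also have "C powr q * h powr (q * \<kappa>) * (h + h) = 2 * C powr q * h powr (1 + q * \<kappa>)"
      using h by (simp add: powr_add)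
    finally show "Lint q a b u v h \<le> k powr q * s * Lint q a' b' 0 l (h / s) + 2 * C powr q * h powr (1 + q * \<kappa>)"
      unfolding g_eq .
  qed
qed

subsection \<open>The decomposition into four cells\<close>

lemma scaled_interval:
  assumes "s > (0::real)"
  shows "x + h - c \<le> k * s \<Longrightarrow> (x - c) / s + h / s \<le> k"
    and "k * s \<le> x - h - c \<Longrightarrow> k \<le> (x - c) / s - h / s"
proof -
  show "(x - c) / s + h / s \<le> k" if "x + h - c \<le> k * s"
    unfolding add_divide_distrib[symmetric] pos_divide_le_eq[OF assms] using that by linarith
  show "k \<le> (x - c) / s - h / s" if "k * s \<le> x - h - c"
    unfolding diff_divide_distrib[symmetric] pos_le_divide_eq[OF assms] using that by linarith
qed

lemma ball1_right:
  assumes "\<l> \<le> x - h"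
  shows "ball1 x h = p E3 * ball1 ((x - (1 - r)) / r) (h / r)"
proof -
  have "ball1 (x / \<rho>) (h / \<rho>) = 0" "ball2 ((x - \<rho> * (1 - r)) / r) (h / r) = 0"
    using assms geometry(1,9) by (auto intro!: ball_null_scaled \<rho> r)
  then show ?thesis using ball1_rec[of x h] by simp
qed

lemma ball2_right:
  assumes "\<rho> \<le> x - h"
  shows "ball2 x h = p E4 * ball2 ((x - (1 - r)) / r) (h / r)"
proof -
  have "ball1 (x / \<rho>) (h / \<rho>) = 0" using assms by (auto intro!: ball_null_scaled \<rho> r)
  then show ?thesis using ball2_rec[of x h] by simp
qed

lemma ball2_left:
  assumes "x + h \<le> 1 - r"
  shows "ball2 x h = p E5 * ball1 (x / \<rho>) (h / \<rho>)"
proof -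
  have "ball2 ((x - (1 - r)) / r) (h / r) = 0" using assms by (auto intro!: ball_null_scaled r)
  then show ?thesis using ball2_rec[of x h] by simp
qed

lemma ball_gap:
  assumes "x + h \<le> 1 - r"
  shows "\<l> \<le> x - h \<Longrightarrow> ball1 x h = 0" "\<rho> \<le> x - h \<Longrightarrow> ball2 x h = 0"
  using assms ball1_right[of x h] ball2_right[of x h] ball_null_scaled[of r "x - (1 - r)" h] r by auto

text \<open>
  On the right end $(1-r,1)$ both measures are images under the same map, so the combination is
  transformed as a whole. Everywhere else it becomes a multiple of images of the two single measures.
\<close>

lemma mix_rec: "mix a b x h = (a * p E1 + b * p E5) * ball1 (x / \<rho>) (h / \<rho>)
    + a * p E2 * ball2 ((x - \<rho> * (1 - r)) / r) (h / r) + mix (a * p E3) (b * p E4) ((x - (1 - r)) / r) (h / r)"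
  unfolding mix_def ball1_rec[of x h] ball2_rec[of x h] by (simp add: algebra_simps)

definition part1 :: "real \<Rightarrow> real \<Rightarrow> real \<Rightarrow> real \<Rightarrow> real" where
  "part1 q a b h = (a * p E1 + b * p E5) powr q * \<rho> * Lint q 1 0 0 \<l> (h / \<rho>)"
definition part2 :: "real \<Rightarrow> real \<Rightarrow> real \<Rightarrow> real \<Rightarrow> real" where
  "part2 q a b h = ((a * p E1 + b * p E5) * p E3 + a * p E2 * p E5) powr q * (\<rho> * r) * Lint q 1 0 0 1 (h / (\<rho> * r))"
definition part3 :: "real \<Rightarrow> real \<Rightarrow> real \<Rightarrow> real \<Rightarrow> real" where
  "part3 q a b h = (a * p E2 * p E4) powr q * (r * r) * Lint q 0 1 0 1 (h / (r * r))"
definition part4 :: "real \<Rightarrow> real \<Rightarrow> real \<Rightarrow> real \<Rightarrow> real" where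
  "part4 q a b h = r * Lint q (a * p E3) (b * p E4) 0 1 (h / r)"

context
  fixes q a b :: real
  assumes q: "q \<ge> 0" and ab: "a \<ge> 0" "b \<ge> 0"
begin

lemma p_nonneg: "0 \<le> p e" using p_pos[of e] by simp

lemma mix_ge_parts:
  "(a * p E1 + b * p E5) * ball1 (x / \<rho>) (h / \<rho>) \<le> mix a b x h"
  "a * p E2 * ball2 ((x - \<rho> * (1 - r)) / r) (h / r) \<le> mix a b x h"
  "(a * p E1 + b * p E5) * ball1 (x / \<rho>) (h / \<rho>) + a * p E2 * ball2 ((x - \<rho> * (1 - r)) / r) (h / r) \<le> mix a b x h"
  "mix (a * p E3) (b * p E4) ((x - (1 - r)) / r) (h / r) \<le> mix a b x h"
proof -
  have "0 \<le> (a * p E1 + b * p E5) * ball1 (x / \<rho>) (h / \<rho>)"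
    "0 \<le> a * p E2 * ball2 ((x - \<rho> * (1 - r)) / r) (h / r)"
    "0 \<le> mix (a * p E3) (b * p E4) ((x - (1 - r)) / r) (h / r)"
    using ab p_nonneg ball_bounds by (auto intro!: mult_nonneg_nonneg add_nonneg_nonneg mix_nonneg)
  then show
    "(a * p E1 + b * p E5) * ball1 (x / \<rho>) (h / \<rho>) \<le> mix a b x h"
    "a * p E2 * ball2 ((x - \<rho> * (1 - r)) / r) (h / r) \<le> mix a b x h"
    "(a * p E1 + b * p E5) * ball1 (x / \<rho>) (h / \<rho>) + a * p E2 * ball2 ((x - \<rho> * (1 - r)) / r) (h / r) \<le> mix a b x h"
    "mix (a * p E3) (b * p E4) ((x - (1 - r)) / r) (h / r) \<le> mix a b x h"
    unfolding mix_rec[of a b x h] by linarith+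
qed

lemma mix_left:
  assumes "x + h \<le> 1 - r"
  shows "mix a b x h = (a * p E1 + b * p E5) * ball1 (x / \<rho>) (h / \<rho>) + a * p E2 * ball2 ((x - \<rho> * (1 - r)) / r) (h / r)"
proof -
  have "mix (a * p E3) (b * p E4) ((x - (1 - r)) / r) (h / r) = 0"
    unfolding mix_def using assms ball_null_scaled[of r "x - (1 - r)" h] r by auto
  then show ?thesis using mix_rec[of a b x h] by simp
qed

lemma cell1_approximation: "close_above q (Lint q a b 0 (\<rho> * \<l>)) (part1 q a b)"
proof -
  have "close_above q (Lint q a b 0 (\<rho> * \<l>)) (\<lambda>h. (a * p E1 + b * p E5) powr q * \<rho> * Lint q 1 0 0 \<l> (h / \<rho>))"
  proof (rule cell_approximation[OF q ab])
    fix x h assume h: "h > 0" "0 \<le> x - h" "x + h \<le> \<rho> * \<l>"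
    have "\<rho> * \<l> \<le> 1 - r" using geometry(6) \<rho> r mult_left_le_one_le[of "1 - r" \<rho>] by linarith
    moreover have "ball2 ((x - \<rho> * (1 - r)) / r) (h / r) = 0"
      using h geometry(6) by (intro ball_null_scaled r) auto
    ultimately show "mix a b x h = (a * p E1 + b * p E5) * mix 1 0 ((x - 0) / \<rho>) (h / \<rho>)"
      using mix_left[of x h] h by (simp add: mix_def)
  qed (use mix_ge_parts(1) ab p_nonneg \<rho> geometry decays_\<rho>\<l> in \<open>auto simp: mix_def[of 1 0] decays1_outside decays2_outside\<close>)
  then show ?thesis unfolding part1_def .
qed

text \<open>
  The cell of the exact overlap: it is reached through $S_{e_1}S_{e_3}$ and $S_{e_5}S_{e_3}$ from the
  first term of \<open>mix_rec\<close>, and through $S_{e_2}S_{e_5}$ from the second one.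
\<close>

lemma cell2_approximation: "close_above q (Lint q a b (\<rho> * (1 - r)) \<rho>) (part2 q a b)"
proof -
  let ?k = "(a * p E1 + b * p E5) * p E3 + a * p E2 * p E5"
  have arg: "(x / \<rho> - (1 - r)) / r = (x - \<rho> * (1 - r)) / (\<rho> * r)" "(x - \<rho> * (1 - r)) / r / \<rho> = (x - \<rho> * (1 - r)) / (\<rho> * r)"
    for x using \<rho> r by (auto simp: field_simps)
  have "close_above q (Lint q a b (\<rho> * (1 - r)) \<rho>) (\<lambda>h. ?k powr q * (\<rho> * r) * Lint q 1 0 0 1 (h / (\<rho> * r)))"
  proof (rule cell_approximation[OF q ab])
    fix x h
    have "p E3 * ball1 ((x - \<rho> * (1 - r)) / (\<rho> * r)) (h / (\<rho> * r)) \<le> ball1 (x / \<rho>) (h / \<rho>)"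
      using ball1_rec[of "x / \<rho>" "h / \<rho>"] p_nonneg ball_bounds unfolding arg by (simp add: mult.commute)
    moreover have "p E5 * ball1 ((x - \<rho> * (1 - r)) / (\<rho> * r)) (h / (\<rho> * r)) \<le> ball2 ((x - \<rho> * (1 - r)) / r) (h / r)"
      using ball2_rec[of "(x - \<rho> * (1 - r)) / r" "h / r"] p_nonneg ball_bounds unfolding arg by (simp add: mult.commute)
    ultimately have "?k * ball1 ((x - \<rho> * (1 - r)) / (\<rho> * r)) (h / (\<rho> * r))
      \<le> (a * p E1 + b * p E5) * ball1 (x / \<rho>) (h / \<rho>) + a * p E2 * ball2 ((x - \<rho> * (1 - r)) / r) (h / r)"
      using ab p_nonneg by (simp only: distrib_right mult.assoc) (intro add_mono mult_left_mono; simp add: distrib_right[symmetric])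
    then show "?k * mix 1 0 ((x - \<rho> * (1 - r)) / (\<rho> * r)) (h / (\<rho> * r)) \<le> mix a b x h"
      using mix_ge_parts(3)[of x h] by (simp add: mix_def[of 1 0])
  next
    fix x h assume h: "h > 0" "\<rho> * (1 - r) \<le> x - h" "x + h \<le> \<rho>"
    have "1 - r \<le> x / \<rho> - h / \<rho>" using h \<rho> by (simp add: field_simps)
    then have 1: "ball1 (x / \<rho>) (h / \<rho>) = p E3 * ball1 ((x - \<rho> * (1 - r)) / (\<rho> * r)) (h / (\<rho> * r))"
      using ball1_right[of "x / \<rho>" "h / \<rho>"] geometry(2) unfolding arg by (simp add: mult.commute)
    have "(x - \<rho> * (1 - r)) / r + h / r \<le> 1 - r"
      by (rule scaled_interval(1)[OF r(1)]) (use h geometry(7) in \<open>simp add: algebra_simps\<close>)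
    then have 2: "ball2 ((x - \<rho> * (1 - r)) / r) (h / r) = p E5 * ball1 ((x - \<rho> * (1 - r)) / (\<rho> * r)) (h / (\<rho> * r))"
      using ball2_left[of "(x - \<rho> * (1 - r)) / r" "h / r"] unfolding arg by (simp add: mult.commute)
    show "mix a b x h = ?k * mix 1 0 ((x - \<rho> * (1 - r)) / (\<rho> * r)) (h / (\<rho> * r))"
      using mix_left[of x h] h geometry(3) unfolding 1 2 by (simp add: mix_def[of 1 0] algebra_simps)
  next
    show "\<rho> = \<rho> * r * 1 + \<rho> * (1 - r)" by (simp add: algebra_simps)
    show "\<rho> * (1 - r) \<le> \<rho>" using \<rho> r by simp
  qed (use ab p_nonneg \<rho> r decays_\<rho>1mr decays_\<rho> in auto)
  then show ?thesis unfolding part2_def .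
qed

lemma cell3_approximation: "close_above q (Lint q a b ((\<rho> + r) * (1 - r)) \<l>) (part3 q a b)"
proof -
  have arg: "((x - \<rho> * (1 - r)) / r - (1 - r)) / r = (x - (\<rho> + r) * (1 - r)) / (r * r)" for x
    using r by (simp add: field_simps)
  have "close_above q (Lint q a b ((\<rho> + r) * (1 - r)) \<l>) (\<lambda>h. (a * p E2 * p E4) powr q * (r * r) * Lint q 0 1 0 1 (h / (r * r)))"
  proof (rule cell_approximation[OF q ab])
    fix x h
    have "p E4 * ball2 ((x - (\<rho> + r) * (1 - r)) / (r * r)) (h / (r * r)) \<le> ball2 ((x - \<rho> * (1 - r)) / r) (h / r)"
      using ball2_rec[of "(x - \<rho> * (1 - r)) / r" "h / r"] p_nonneg ball_bounds unfolding arg by simp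
    then have "a * p E2 * (p E4 * ball2 ((x - (\<rho> + r) * (1 - r)) / (r * r)) (h / (r * r)))
        \<le> a * p E2 * ball2 ((x - \<rho> * (1 - r)) / r) (h / r)"
      using ab p_nonneg by (intro mult_left_mono) auto
    then show "a * p E2 * p E4 * mix 0 1 ((x - (\<rho> + r) * (1 - r)) / (r * r)) (h / (r * r)) \<le> mix a b x h"
      using mix_ge_parts(2)[of x h] by (simp add: mix_def[of 0 1] mult.assoc)
  next
    fix x h assume h: "h > 0" "(\<rho> + r) * (1 - r) \<le> x - h" "x + h \<le> \<l>"
    have 1: "ball1 (x / \<rho>) (h / \<rho>) = 0" using h geometry(7) by (intro ball_null_scaled \<rho>) auto
    have "\<rho> \<le> (x - \<rho> * (1 - r)) / r - h / r"
      by (rule scaled_interval(2)[OF r(1)]) (use h geometry(7) in \<open>simp add: algebra_simps\<close>)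
    then have 2: "ball2 ((x - \<rho> * (1 - r)) / r) (h / r) = p E4 * ball2 ((x - (\<rho> + r) * (1 - r)) / (r * r)) (h / (r * r))"
      using ball2_right[of "(x - \<rho> * (1 - r)) / r" "h / r"] unfolding arg by simp
    show "mix a b x h = a * p E2 * p E4 * mix 0 1 ((x - (\<rho> + r) * (1 - r)) / (r * r)) (h / (r * r))"
      using mix_left[of x h] h geometry(2) unfolding 1 2 by (simp add: mix_def[of 0 1])
  next
    show "\<l> = r * r * 1 + (\<rho> + r) * (1 - r)" unfolding \<l>_def by (simp add: algebra_simps)
  qed (use ab p_nonneg r geometry(8) decays_\<l> decays_corner in auto)
  then show ?thesis unfolding part3_def .
qed

lemma cell4_approximation: "close_above q (Lint q a b (1 - r) 1) (part4 q a b)"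
proof -
  have "close_above q (Lint q a b (1 - r) 1) (\<lambda>h. 1 powr q * r * Lint q (a * p E3) (b * p E4) 0 1 (h / r))"
  proof (rule cell_approximation[OF q ab])
    fix x h assume h: "h > 0" "1 - r \<le> x - h" "x + h \<le> 1"
    then show "mix a b x h = 1 * mix (a * p E3) (b * p E4) ((x - (1 - r)) / r) (h / r)"
      using ball1_right[of x h] ball2_right[of x h] geometry(2,3) by (simp add: mix_def)
  qed (use mix_ge_parts(4) ab p_nonneg r decays_1mr in \<open>auto simp: decays1_outside decays2_outside\<close>)
  then show ?thesis unfolding part4_def by simp
qed

text \<open>
  A gap between cells is a cell with factor \<open>0\<close>.
\<close>

lemma gap_negligible:
  assumes "u \<le> v" "decays1 u" "decays2 u" "decays1 v" "decays2 v"
    and "\<And>x h. h > 0 \<Longrightarrow> u \<le> x - h \<Longrightarrow> x + h \<le> v \<Longrightarrow> mix a b x h = 0"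
  shows "close_above q (Lint q a b u v) (\<lambda>h. 0)"
proof -
  have "close_above q (Lint q a b u v) (\<lambda>h. 0 powr q * 1 * Lint q 1 0 0 (v - u) (h / 1))"
    by (rule cell_approximation[OF q ab, where l = "v - u"])
       (use assms mix_nonneg[OF ab] in auto)
  then show ?thesis by simp
qed

lemma gap1_negligible: "close_above q (Lint q a b (\<rho> * \<l>) (\<rho> * (1 - r))) (\<lambda>h. 0)"
proof (rule gap_negligible[OF geometry(6) decays_\<rho>\<l> decays_\<rho>1mr])
  fix x h assume h: "h > 0" "\<rho> * \<l> \<le> x - h" "x + h \<le> \<rho> * (1 - r)"
  have "x / \<rho> + h / \<rho> \<le> 1 - r" "\<l> \<le> x / \<rho> - h / \<rho>" using h \<rho> by (simp_all add: field_simps)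
  then have "ball1 (x / \<rho>) (h / \<rho>) = 0" by (intro ball_gap)
  moreover have "ball2 ((x - \<rho> * (1 - r)) / r) (h / r) = 0" using h by (intro ball_null_scaled r) auto
  moreover have "\<rho> * (1 - r) \<le> 1 - r" using \<rho> r by (simp add: mult_left_le_one_le)
  ultimately show "mix a b x h = 0" using mix_left[of x h] h by simp
qed

lemma gap2_negligible: "close_above q (Lint q a b \<rho> ((\<rho> + r) * (1 - r))) (\<lambda>h. 0)"
proof (rule gap_negligible[OF less_imp_le[OF geometry(7)] decays_\<rho> decays_corner])
  fix x h assume h: "h > 0" "\<rho> \<le> x - h" "x + h \<le> (\<rho> + r) * (1 - r)"
  have 1: "ball1 (x / \<rho>) (h / \<rho>) = 0" using h by (intro ball_null_scaled \<rho>) auto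
  have "(x - \<rho> * (1 - r)) / r + h / r \<le> 1 - r" "\<rho> \<le> (x - \<rho> * (1 - r)) / r - h / r"
    by (rule scaled_interval[OF r(1)], use h in \<open>simp add: algebra_simps\<close>)+
  then have "ball2 ((x - \<rho> * (1 - r)) / r) (h / r) = 0" by (intro ball_gap)
  then show "mix a b x h = 0" using mix_left[of x h] h 1 geometry(2,8) by simp
qed

lemma gap3_negligible: "close_above q (Lint q a b \<l> (1 - r)) (\<lambda>h. 0)"
proof (rule gap_negligible[OF geometry(2) decays_\<l> decays_1mr])
  fix x h assume "h > 0" "\<l> \<le> x - h" "x + h \<le> 1 - r"
  then show "mix a b x h = 0" using ball_gap[of x h] geometry(1) by (simp add: mix_def)
qed

lemma Lint_left_cell: "close_above q (Lint q a b 0 \<rho>) (\<lambda>h. part1 q a b h + part2 q a b h)"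
proof -
  have s: "0 \<le> \<rho> * \<l>" "\<rho> * \<l> \<le> \<rho> * (1 - r)" "\<rho> * (1 - r) \<le> \<rho>"
    using geometry \<rho> r by auto
  have "Lint q a b 0 \<rho> h = Lint q a b 0 (\<rho> * \<l>) h + Lint q a b (\<rho> * \<l>) (\<rho> * (1 - r)) h + Lint q a b (\<rho> * (1 - r)) \<rho> h" for h
    using Lint_split[OF ab q, of 0 "\<rho> * \<l>" \<rho> h] Lint_split[OF ab q, of "\<rho> * \<l>" "\<rho> * (1 - r)" \<rho> h] s by simp
  then have "Lint q a b 0 \<rho> = (\<lambda>h. Lint q a b 0 (\<rho> * \<l>) h + Lint q a b (\<rho> * \<l>) (\<rho> * (1 - r)) h + Lint q a b (\<rho> * (1 - r)) \<rho> h)" by (rule ext)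
  then show ?thesis
    using close_above_add[OF close_above_add[OF cell1_approximation gap1_negligible] cell2_approximation] by simp
qed

lemma Lint_first_block: "close_above q (Lint q a b 0 \<l>) (\<lambda>h. part1 q a b h + part2 q a b h + part3 q a b h)"
proof -
  have "Lint q a b 0 \<l> h = Lint q a b 0 \<rho> h + Lint q a b \<rho> ((\<rho> + r) * (1 - r)) h + Lint q a b ((\<rho> + r) * (1 - r)) \<l> h" for h
    using Lint_split[OF ab q, of 0 \<rho> \<l> h] Lint_split[OF ab q, of \<rho> "(\<rho> + r) * (1 - r)" \<l> h] geometry(1,7,8) \<rho> by simp
  then have "Lint q a b 0 \<l> = (\<lambda>h. Lint q a b 0 \<rho> h + Lint q a b \<rho> ((\<rho> + r) * (1 - r)) h + Lint q a b ((\<rho> + r) * (1 - r)) \<l> h)" by (rule ext)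
  then show ?thesis
    using close_above_add[OF close_above_add[OF Lint_left_cell gap2_negligible] cell3_approximation] by simp
qed

lemma Lint_whole: "close_above q (Lint q a b 0 1)
    (\<lambda>h. part1 q a b h + part2 q a b h + part3 q a b h + part4 q a b h)"
proof -
  have "Lint q a b 0 1 h = Lint q a b 0 \<l> h + Lint q a b \<l> (1 - r) h + Lint q a b (1 - r) 1 h" for h
    using Lint_split[OF ab q, of 0 \<l> 1 h] Lint_split[OF ab q, of \<l> "1 - r" 1 h] geometry(2,4,5) r by simp
  then have "Lint q a b 0 1 = (\<lambda>h. Lint q a b 0 \<l> h + Lint q a b \<l> (1 - r) h + Lint q a b (1 - r) 1 h)" by (rule ext)
  then show ?thesis
    using close_above_add[OF close_above_add[OF Lint_first_block gap3_negligible] cell4_approximation] by simp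
qed

end

end


section \<open>The renewal system of the graph-directed measures\<close>

datatype state = Left | One | Two

datatype piece = P1 | P2 | P3 | P4

lemma UNIV_state: "UNIV = {Left, One, Two}"
  using state.exhaust by auto

lemma UNIV_piece: "UNIV = {P1, P2, P3, P4}"
  using piece.exhaust by auto

instance state :: finite
  by standard (simp add: UNIV_state)

instance piece :: finite
  by standard (simp add: UNIV_piece)

locale overlap_spectrum = overlap_system +
  fixes q \<alpha> :: real
  assumes q: "q \<ge> 0" and adm: "admissible q \<alpha>"
begin

text \<open>
  The exponential rate at which the end points of the cells become negligible.
\<close>

definition \<epsilon> :: real where "\<epsilon> = q * \<kappa> - \<alpha>"

lemma \<epsilon>_pos: "\<epsilon> > 0"
proof -
  have *: "q * (ln (p e) / ln s) > \<alpha>" if "Q (p e) s q \<alpha> < 1" "0 < s" "s < 1" for e s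
  proof -
    have "Q (p e) s q \<alpha> = exp (q * ln (p e) - \<alpha> * ln s)"
      unfolding Q_def using p_pos[of e] that by (simp add: powr_def exp_add[symmetric])
    then have "q * ln (p e) < \<alpha> * ln s" using that by simp
    moreover have "ln s < 0" using that by simp
    ultimately show ?thesis by (simp add: neg_less_divide_eq)
  qed
  have "q * (ln (p E1) / ln \<rho>) > \<alpha>" "q * (ln (p E3) / ln r) > \<alpha>" "q * (ln (p E4) / ln r) > \<alpha>"
    using admissible_bounds[OF q adm] \<rho> r by (auto intro!: * simp del: times_divide_eq_right)
  then show ?thesis unfolding \<epsilon>_def \<kappa>_def by (auto simp: min_def)
qed

text \<open>
  The integral of the \<open>q\<close>-th powers over $(u,v)$ in the logarithmic scale $h = e^{-x}$, normalized to
  its expected order.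
\<close>

definition N :: "real \<Rightarrow> real \<Rightarrow> real \<Rightarrow> real \<Rightarrow> real \<Rightarrow> real" where
  "N a b u v x = exp ((1 + \<alpha>) * x) * Lint q a b u v (exp (- x))"

lemma N_nonneg: "N a b u v x \<ge> 0"
  unfolding N_def using Lint_nonneg by simp

text \<open>
  Contraction by \<open>s\<close> with weight \<open>k\<close> becomes translation by $-\ln s$ with factor $k^q s^{-\alpha}$.
\<close>

lemma N_rescale:
  assumes "s > 0"
  shows "exp ((1 + \<alpha>) * x) * (k powr q * s * Lint q a b u v (exp (- x) / s)) = Q k s q \<alpha> * N a b u v (x + ln s)"
proof -
  have "exp (- (x + ln s)) = exp (- x) / s"
  proof -
    have "exp (- (x + ln s)) = exp (- x) * exp (- ln s)" by (simp add: exp_add[symmetric])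
    then show ?thesis using assms by (simp add: exp_minus[of "ln s"] divide_inverse)
  qed
  moreover have "exp ((1 + \<alpha>) * (x + ln s)) = exp ((1 + \<alpha>) * x) * s powr (1 + \<alpha>)"
    using assms by (simp add: powr_def exp_add[symmetric] algebra_simps)
  ultimately have "Q k s q \<alpha> * N a b u v (x + ln s)
      = (s powr (- \<alpha>) * s powr (1 + \<alpha>)) * (k powr q * exp ((1 + \<alpha>) * x) * Lint q a b u v (exp (- x) / s))"
    unfolding N_def Q_def by (simp add: ac_simps)
  also have "s powr (- \<alpha>) * s powr (1 + \<alpha>) = s"
    using assms by (simp add: powr_add[symmetric])
  finally show ?thesis by (simp add: ac_simps)
qed

definition la :: real where "la = - ln \<rho>"
definition lb :: real where "lb = - ln r"

lemma la_lb_pos: "la > 0" "lb > 0"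
  unfolding la_def lb_def using \<rho> r by auto

lemma N_close_above:
  assumes "close_above q (Lint q a b u v) g"
  shows "\<exists>C\<ge>0. \<forall>x. exp ((1 + \<alpha>) * x) * g (exp (- x)) \<le> N a b u v x \<and>
    N a b u v x \<le> exp ((1 + \<alpha>) * x) * g (exp (- x)) + C * exp (- \<epsilon> * x)"
proof -
  obtain C where C: "\<And>h. h > 0 \<Longrightarrow> g h \<le> Lint q a b u v h \<and> Lint q a b u v h \<le> g h + C * h powr (1 + q * \<kappa>)"
    using assms unfolding close_above_def by blast
  have "0 \<le> C" using C[of 1] by simp
  moreover have "exp ((1 + \<alpha>) * x) * g (exp (- x)) \<le> N a b u v x \<and>
    N a b u v x \<le> exp ((1 + \<alpha>) * x) * g (exp (- x)) + C * exp (- \<epsilon> * x)" for x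
  proof -
    have eq: "exp ((1 + \<alpha>) * x) * (C * exp (- x) powr (1 + q * \<kappa>)) = C * exp (- \<epsilon> * x)"
      unfolding \<epsilon>_def powr_def by (simp add: exp_add[symmetric] algebra_simps)
    have "g (exp (- x)) \<le> Lint q a b u v (exp (- x))"
      and le: "Lint q a b u v (exp (- x)) \<le> g (exp (- x)) + C * exp (- x) powr (1 + q * \<kappa>)"
      using C[of "exp (- x)"] by auto
    then have "exp ((1 + \<alpha>) * x) * g (exp (- x)) \<le> exp ((1 + \<alpha>) * x) * Lint q a b u v (exp (- x))"
      by (intro mult_left_mono) auto
    moreover have "exp ((1 + \<alpha>) * x) * Lint q a b u v (exp (- x))
        \<le> exp ((1 + \<alpha>) * x) * (g (exp (- x)) + C * exp (- x) powr (1 + q * \<kappa>))"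
      using le by (intro mult_left_mono) auto
    ultimately show ?thesis unfolding N_def distrib_left eq by blast
  qed
  ultimately show ?thesis by blast
qed

lemma N_parts:
  "exp ((1 + \<alpha>) * x) * part1 q a b (exp (- x)) = Q (a * p E1 + b * p E5) \<rho> q \<alpha> * N 1 0 0 \<l> (x - la)"
  "exp ((1 + \<alpha>) * x) * part2 q a b (exp (- x))
     = Q ((a * p E1 + b * p E5) * p E3 + a * p E2 * p E5) (\<rho> * r) q \<alpha> * N 1 0 0 1 (x - (la + lb))"
  "exp ((1 + \<alpha>) * x) * part3 q a b (exp (- x)) = Q (a * p E2 * p E4) (r * r) q \<alpha> * N 0 1 0 1 (x - (lb + lb))"
  "exp ((1 + \<alpha>) * x) * part4 q a b (exp (- x)) = r powr (- \<alpha>) * N (a * p E3) (b * p E4) 0 1 (x - lb)"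
proof -
  have ln: "x + ln \<rho> = x - la" "x + ln (\<rho> * r) = x - (la + lb)" "x + ln (r * r) = x - (lb + lb)" "x + ln r = x - lb"
    unfolding la_def lb_def using \<rho> r by (auto simp: ln_mult)
  show "exp ((1 + \<alpha>) * x) * part1 q a b (exp (- x)) = Q (a * p E1 + b * p E5) \<rho> q \<alpha> * N 1 0 0 \<l> (x - la)"
    "exp ((1 + \<alpha>) * x) * part2 q a b (exp (- x))
     = Q ((a * p E1 + b * p E5) * p E3 + a * p E2 * p E5) (\<rho> * r) q \<alpha> * N 1 0 0 1 (x - (la + lb))"
    "exp ((1 + \<alpha>) * x) * part3 q a b (exp (- x)) = Q (a * p E2 * p E4) (r * r) q \<alpha> * N 0 1 0 1 (x - (lb + lb))"
    unfolding part1_def part2_def part3_def ln[symmetric] using \<rho> r by (intro N_rescale; simp)+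
  show "exp ((1 + \<alpha>) * x) * part4 q a b (exp (- x)) = r powr (- \<alpha>) * N (a * p E3) (b * p E4) 0 1 (x - lb)"
    using N_rescale[OF r(1), of x 1 "a * p E3" "b * p E4" 0 1] unfolding part4_def ln by (simp add: Q_def)
qed

lemma Lint_scale:
  assumes "c \<ge> 0" "a \<ge> 0" "b \<ge> 0"
  shows "Lint q (c * a) (c * b) u v h = c powr q * Lint q a b u v h"
proof -
  have "mix (c * a) (c * b) x h powr q = c powr q * mix a b x h powr q" for x
    using assms mix_nonneg[of a b x h] unfolding mix_def by (simp add: powr_mult[symmetric] algebra_simps)
  then show ?thesis unfolding Lint_def by simp
qed

fun ca :: "state \<Rightarrow> real" where "ca Left = 1" | "ca One = 1" | "ca Two = 0"
fun cb :: "state \<Rightarrow> real" where "cb Left = 0" | "cb One = 0" | "cb Two = 1"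
fun ub :: "state \<Rightarrow> real" where "ub Left = \<l>" | "ub One = 1" | "ub Two = 1"

fun dst :: "state \<Rightarrow> piece \<Rightarrow> state" where
  "dst i P1 = Left" | "dst i P2 = One" | "dst i P3 = Two" | "dst i P4 = (case i of Two \<Rightarrow> Two | _ \<Rightarrow> One)"

fun len :: "piece \<Rightarrow> real" where
  "len P1 = la" | "len P2 = la + lb" | "len P3 = lb + lb" | "len P4 = lb"

text \<open>
  The matrix of the renewal system. In the states \<open>One\<close> and \<open>Two\<close> one of the two measures is absent, so
  the piece \<open>P4\<close> only rescales the integral; \<open>Left\<close> ends before that piece.
\<close>

fun mass :: "state \<Rightarrow> piece \<Rightarrow> real" where
  "mass i P1 = Q (ca i * p E1 + cb i * p E5) \<rho> q \<alpha>"
| "mass i P2 = Q ((ca i * p E1 + cb i * p E5) * p E3 + ca i * p E2 * p E5) (\<rho> * r) q \<alpha>"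
| "mass i P3 = Q (ca i * p E2 * p E4) (r * r) q \<alpha>"
| "mass i P4 = (case i of Left \<Rightarrow> 0 | One \<Rightarrow> Q (p E3) r q \<alpha> | Two \<Rightarrow> Q (p E4) r q \<alpha>)"

definition Z :: "state \<Rightarrow> real \<Rightarrow> real" where "Z i = N (ca i) (cb i) 0 (ub i)"

lemma Z_renewal:
  "\<exists>C\<ge>0. \<forall>i x. (\<Sum>k\<in>UNIV. mass i k * Z (dst i k) (x - len k)) \<le> Z i x \<and>
     Z i x \<le> (\<Sum>k\<in>UNIV. mass i k * Z (dst i k) (x - len k)) + C * exp (- \<epsilon> * x)"
proof -
  let ?S = "\<lambda>i x. \<Sum>k\<in>UNIV. mass i k * Z (dst i k) (x - len k)"
  have scale: "r powr (- \<alpha>) * N (p E3) 0 0 1 x = Q (p E3) r q \<alpha> * N 1 0 0 1 x"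
    "r powr (- \<alpha>) * N 0 (p E4) 0 1 x = Q (p E4) r q \<alpha> * N 0 1 0 1 x" for x
    using Lint_scale[of "p E3" 1 0] Lint_scale[of "p E4" 0 1] p_pos unfolding N_def Q_def
    by (simp_all add: less_imp_le)
  have "\<exists>C\<ge>0. \<forall>x. ?S i x \<le> Z i x \<and> Z i x \<le> ?S i x + C * exp (- \<epsilon> * x)" for i
  proof (cases i)
    case Left
    show ?thesis
      using N_close_above[OF Lint_first_block[OF q, of 1 0]]
      by (simp add: Left Z_def UNIV_piece distrib_left N_parts add.assoc)
  next
    case One
    show ?thesis
      using N_close_above[OF Lint_whole[OF q, of 1 0]]
      by (simp add: One Z_def UNIV_piece distrib_left N_parts scale add.assoc)
  next
    case Two
    show ?thesis
      using N_close_above[OF Lint_whole[OF q, of 0 1]]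
      by (simp add: Two Z_def UNIV_piece distrib_left N_parts scale add.assoc)
  qed
  then obtain C where C: "\<And>i. C i \<ge> 0" "\<And>i x. ?S i x \<le> Z i x \<and> Z i x \<le> ?S i x + C i * exp (- \<epsilon> * x)"
    by metis
  have "C i \<le> (\<Sum>i\<in>UNIV. C i)" for i using C(1) by (intro member_le_sum) auto
  then have "C i * exp (- \<epsilon> * x) \<le> (\<Sum>i\<in>UNIV. C i) * exp (- \<epsilon> * x)" for i x by (intro mult_right_mono) auto
  then have "?S i x \<le> Z i x \<and> Z i x \<le> ?S i x + (\<Sum>i\<in>UNIV. C i) * exp (- \<epsilon> * x)" for i x
    using C(2)[of i x] by (meson add_left_mono order_trans)
  moreover have "(\<Sum>i\<in>UNIV. C i) \<ge> 0" using C(1) by (intro sum_nonneg)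
  ultimately show ?thesis by blast
qed

text \<open>
  The equations for \<open>One\<close> and \<open>Left\<close> differ only in the piece \<open>P4\<close>, which gives \<open>eig One\<close>. The equation
  for \<open>Two\<close> gives \<open>eig Two\<close>, and the one for \<open>Left\<close> is then $H = 0$.
\<close>

fun eig :: "state \<Rightarrow> real" where
  "eig Left = 1" | "eig One = 1 / (1 - Q (p E3) r q \<alpha>)"
| "eig Two = Q (p E5) \<rho> q \<alpha> / ((1 - Q (p E4) r q \<alpha>) * (1 - Q (p E3) r q \<alpha>))"

definition w :: "state \<Rightarrow> piece \<Rightarrow> real" where "w i k = mass i k * eig (dst i k) / eig i"

lemma Q_bounds: "Q (p E1) \<rho> q \<alpha> < 1" "Q (p E3) r q \<alpha> < 1" "Q (p E4) r q \<alpha> < 1"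
  using admissible_bounds[OF q adm] by auto

lemma eig_pos: "eig i > 0"
  using Q_bounds Q_pos[OF p_pos \<rho>(1)] by (cases i) auto

lemma mass_nonneg: "mass i k \<ge> 0"
  by (cases k; cases i) (auto simp: Q_def)

lemma mass_pos: "mass i P1 > 0" "mass i P2 > 0" "mass Left P3 > 0" "mass One P4 > 0"
  using p_pos \<rho> r by (cases i; auto intro!: Q_pos add_pos_pos mult_pos_pos)+

lemma mass_eig: "(\<Sum>k\<in>UNIV. mass i k * eig (dst i k)) = eig i"
proof -
  let ?Q1 = "Q (p E1) \<rho> q \<alpha>" and ?Q2 = "Q (p E2) r q \<alpha>" and ?Q3 = "Q (p E3) r q \<alpha>"
    and ?Q4 = "Q (p E4) r q \<alpha>" and ?Q5 = "Q (p E5) \<rho> q \<alpha>" and ?W = "Q w13 (\<rho> * r) q \<alpha>"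
  have eq: "(1 - ?Q4) * ((1 - ?Q1) * (1 - ?Q3) - ?W) = ?Q2 * ?Q4 * ?Q5"
    using admissible_bounds(4)[OF q adm] unfolding block_def .
  have ne: "1 - ?Q3 \<noteq> 0" "1 - ?Q4 \<noteq> 0" using Q_bounds by auto
  \<comment> \<open>$H = 0$, divided by $(1-Q_{4,r})(1-Q_{3,r})$\<close>
  have first: "?Q1 + ?W / (1 - ?Q3) + ?Q2 * ?Q4 * ?Q5 / ((1 - ?Q4) * (1 - ?Q3)) = 1"
    unfolding eq[symmetric] using ne by (simp add: divide_simps) (simp add: algebra_simps)
  have masses: "Q (p E2 * p E4) (r * r) q \<alpha> = ?Q2 * ?Q4" "Q (p E5 * p E3) (\<rho> * r) q \<alpha> = ?Q5 * ?Q3"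
    using p_pos \<rho> r by (simp_all add: Q_mult less_imp_le)
  have zero: "Q 0 s q \<alpha> = 0" for s by (simp add: Q_def)
  show ?thesis
  proof (cases i)
    case Left
    show ?thesis using first unfolding w13_def by (simp add: Left UNIV_piece masses add.assoc)
  next
    case One
    have "?Q1 + ?W / (1 - ?Q3) + ?Q2 * ?Q4 * ?Q5 / ((1 - ?Q4) * (1 - ?Q3)) + ?Q3 / (1 - ?Q3) = 1 / (1 - ?Q3)"
      unfolding first using ne by (simp add: field_simps)
    then show ?thesis unfolding w13_def by (simp add: One UNIV_piece masses add.assoc)
  next
    case Two
    have "?Q5 + ?Q5 * ?Q3 / (1 - ?Q3) + ?Q4 * ?Q5 / ((1 - ?Q4) * (1 - ?Q3)) = ?Q5 / ((1 - ?Q4) * (1 - ?Q3))"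
      using ne by (simp add: divide_simps) (simp add: algebra_simps)
    then show ?thesis by (simp add: Two UNIV_piece masses zero add.assoc)
  qed
qed

lemma len_pos: "len k > 0"
  using la_lb_pos by (cases k) auto

definition D :: "state \<Rightarrow> real \<Rightarrow> real" where "D i x = Z i x / eig i"

lemma D_sum: "(\<Sum>k\<in>UNIV. w i k * D (dst i k) (x - len k)) = (\<Sum>k\<in>UNIV. mass i k * Z (dst i k) (x - len k)) / eig i"
  unfolding w_def D_def sum_divide_distrib using eig_pos by (intro sum.cong) (auto simp: less_imp_neq[THEN not_sym])

lemma renewal: 
  assumes "subgroup_reals G" "la \<in> G" "lb \<in> G"
  shows "renewal_system w len G"
proof
  show "w i k \<ge> 0" for i k unfolding w_def using mass_nonneg eig_pos by (simp add: less_imp_le)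
  show "(\<Sum>k\<in>UNIV. w i k) = 1" for i
    unfolding w_def sum_divide_distrib[symmetric] mass_eig using eig_pos[of i] by simp
  show "len k \<in> G" for k 
    using assms by (cases k; simp only: len.simps; intro subgroup_realsD(2)[OF assms(1)])
qed (use len_pos assms in auto)

lemma UNIV_subgroup: "subgroup_reals UNIV"
  unfolding subgroup_reals_def by simp

sublocale RU: renewal_system w dst len UNIV
  by (rule renewal) (auto simp: UNIV_subgroup)

lemma D_super: "(\<Sum>k\<in>UNIV. w i k * D (dst i k) (x - len k)) \<le> D i x"
proof -
  have "(\<Sum>k\<in>UNIV. mass i k * Z (dst i k) (x - len k)) \<le> Z i x" using Z_renewal by blast
  then show ?thesis unfolding D_sum unfolding D_def using eig_pos[of i] by (simp add: divide_right_mono)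
qed

lemma D_solves: "\<exists>C\<ge>0. RU.solves C \<epsilon> D"
proof -
  obtain C where C: "C \<ge> 0" "\<And>i x. (\<Sum>k\<in>UNIV. mass i k * Z (dst i k) (x - len k)) \<le> Z i x \<and>
     Z i x \<le> (\<Sum>k\<in>UNIV. mass i k * Z (dst i k) (x - len k)) + C * exp (- \<epsilon> * x)"
    using Z_renewal by blast
  define B where "B = Max (range (\<lambda>i. C / eig i))"
  have B: "C / eig i \<le> B" for i unfolding B_def by (intro Max_ge) auto
  have "B \<ge> 0" using B[of Left] C by simp
  moreover have "\<bar>D i x - (\<Sum>k\<in>UNIV. w i k * D (dst i k) (x - len k))\<bar> \<le> B * exp (- \<epsilon> * x)" for i x
  proof -
    have "\<bar>D i x - (\<Sum>k\<in>UNIV. w i k * D (dst i k) (x - len k))\<bar>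
        = (Z i x - (\<Sum>k\<in>UNIV. mass i k * Z (dst i k) (x - len k))) / eig i"
      using D_super[of i x] unfolding D_sum by (simp add: D_def diff_divide_distrib)
    also have "\<dots> \<le> C * exp (- \<epsilon> * x) / eig i"
      using C(2)[of i x] eig_pos[of i] by (intro divide_right_mono) auto
    also have "\<dots> \<le> B * exp (- \<epsilon> * x)" using mult_right_mono[OF B[of i], of "exp (- \<epsilon> * x)"] by simp
    finally show ?thesis .
  qed
  ultimately show ?thesis unfolding RU.solves_def by blast
qed

lemma Lint_full:
  assumes "h \<ge> 1" "0 \<le> v" "v \<le> 1"
  shows "Lint q a b 0 v h = v * (a + b) powr q"
proof -
  have "Lint q a b 0 v h = (LINT x:{0<..<v}|lborel. (a + b) powr q)"
    unfolding Lint_def using assms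
    by (intro set_lebesgue_integral_cong) (auto simp: mix_def ball_full)
  then show ?thesis using assms unfolding set_lebesgue_integral_def by (simp add: mult.commute)
qed

lemma Z_start: "t \<ge> 0 \<Longrightarrow> Z i (- t) = exp (- (1 + \<alpha>) * t) * ub i"
  unfolding Z_def N_def using geometry(4,5) by (cases i) (auto simp: Lint_full algebra_simps)

text \<open>
  For $h \ge 1$ every ball centred in $(0,1)$ has full mass, so on the initial window the solution is
  explicit. From there the lower bound persists without loss, because the errors are nonnegative, and
  persistence for \<open>- D\<close> gives the upper bound.
\<close>

lemma D_two_sided: "\<exists>c>0. \<exists>B. \<forall>i. \<forall>x\<ge>0. c \<le> D i x \<and> D i x \<le> B"
proof -
  \<comment> \<open>on the initial window the normalizing factor lies between \<open>1 / E\<close> and \<open>E\<close>\<close>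
  define E where "E = exp (\<bar>1 + \<alpha>\<bar> * RU.memory)"
  define c where "c = Min (range (\<lambda>i. ub i / eig i)) / E"
  define B where "B = Max (range (\<lambda>i. ub i / eig i)) * E"
  have ub: "ub i > 0" for i using geometry by (cases i) auto
  have "Min (range (\<lambda>i. ub i / eig i)) > 0" using ub eig_pos by (auto simp: Min_gr_iff)
  then have c: "c > 0" unfolding c_def E_def by simp
  have MM: "Min (range (\<lambda>i. ub i / eig i)) \<le> ub i / eig i" "ub i / eig i \<le> Max (range (\<lambda>i. ub i / eig i))" for i
    by auto
  have start: "c \<le> D i (- t) \<and> D i (- t) \<le> B" if t: "0 \<le> t" "t \<le> RU.memory" for i t
  proof -
    have "\<bar>(1 + \<alpha>) * t\<bar> \<le> \<bar>1 + \<alpha>\<bar> * RU.memory" using t by (simp add: abs_mult mult_left_mono)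
    then have "1 / E \<le> exp (- (1 + \<alpha>) * t)" "exp (- (1 + \<alpha>) * t) \<le> E"
      unfolding E_def by (auto simp: exp_minus[symmetric] inverse_eq_divide[symmetric] abs_le_iff algebra_simps)
    then have "ub i / eig i * (1 / E) \<le> ub i / eig i * exp (- (1 + \<alpha>) * t)"
        "ub i / eig i * exp (- (1 + \<alpha>) * t) \<le> ub i / eig i * E"
      using ub[of i] eig_pos[of i] by (intro mult_left_mono; simp)+
    moreover have "D i (- t) = ub i / eig i * exp (- (1 + \<alpha>) * t)"
      unfolding D_def Z_start[OF t(1)] by simp
    moreover have "c \<le> ub i / eig i * (1 / E)"
      unfolding c_def using divide_right_mono[OF MM(1)[of i], of E] by (simp add: E_def)
    moreover have "ub i / eig i * E \<le> B"
      unfolding B_def by (intro mult_right_mono MM) (simp add: E_def)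
    ultimately show ?thesis by linarith
  qed
  obtain C where C: "C \<ge> 0" "RU.solves C \<epsilon> D" using D_solves by blast
  have low: "c \<le> D i x" if "x \<ge> 0" for i x
    using RU.persistence[of 0 \<epsilon> 0 D c x i, OF _ \<epsilon>_pos] D_super start that by simp
  have "D i x \<le> B + C * exp (\<epsilon> * RU.memory) / (exp (\<epsilon> * RU.gap) - 1)" if "x \<ge> 0" for i x
  proof -
    have "- D i (0 + x) \<ge> - B - C * exp (\<epsilon> * RU.memory) / (exp (\<epsilon> * RU.gap) - 1) * exp (- \<epsilon> * 0)"
    proof (rule RU.persistence[OF C(1) \<epsilon>_pos])
      fix i x
      have "D i x - (\<Sum>k\<in>UNIV. w i k * D (dst i k) (x - len k)) \<le> C * exp (- \<epsilon> * x)"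
        using C(2) unfolding RU.solves_def by (meson abs_le_D1)
      then show "(\<Sum>k\<in>UNIV. w i k * - D (dst i k) (x - len k)) - C * exp (- \<epsilon> * x) \<le> - D i x"
        by (simp add: sum_negf)
    qed (use start that in auto)
    then show ?thesis by simp
  qed
  then show ?thesis using c low by blast
qed

text \<open>
  Smaller balls have smaller mass, so only the normalizing factor can increase.
\<close>

lemma D_slow: "0 \<le> t \<Longrightarrow> D i (x + t) \<le> exp (\<bar>1 + \<alpha>\<bar> * t) * D i x"
proof -
  assume t: "0 \<le> t"
  have ab: "ca i \<ge> 0" "cb i \<ge> 0" by (cases i; simp)+
  have "Z i (x + t) \<le> exp (\<bar>1 + \<alpha>\<bar> * t) * Z i x"
  proof -
    have "Z i (x + t) = exp ((1 + \<alpha>) * t) * (exp ((1 + \<alpha>) * x) * Lint q (ca i) (cb i) 0 (ub i) (exp (- (x + t))))"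
      unfolding Z_def N_def by (simp add: exp_add[symmetric] algebra_simps)
    also have "\<dots> \<le> exp (\<bar>1 + \<alpha>\<bar> * t) * (exp ((1 + \<alpha>) * x) * Lint q (ca i) (cb i) 0 (ub i) (exp (- x)))"
    proof (intro mult_mono mult_left_mono Lint_mono ab q)
      show "exp ((1 + \<alpha>) * t) \<le> exp (\<bar>1 + \<alpha>\<bar> * t)" using t by (simp add: mult_right_mono)
      show "exp (- (x + t)) \<le> exp (- x)" using t by simp
    qed (auto simp: Lint_nonneg)
    finally show ?thesis unfolding Z_def N_def .
  qed
  then show ?thesis unfolding D_def using divide_right_mono[of _ _ "eig i"] eig_pos[of i] by fastforce
qed

lemma Lint_mono_coeff:
  assumes "0 \<le> a" "a \<le> a'" "0 \<le> b" "b \<le> b'"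
  shows "Lint q a b u v h \<le> Lint q a' b' u v h"
proof -
  have "mix a b x h powr q \<le> mix a' b' x h powr q" for x
    using assms q ball_bounds
    by (intro powr_mono2 mix_nonneg) (auto simp: mix_def intro!: add_mono mult_right_mono)
  then show ?thesis unfolding Lint_def using assms q by (intro set_integral_mono Lint_integrable) auto
qed

lemma N_11_bounded: "\<exists>B\<ge>0. \<forall>x\<ge>0. N 1 1 0 1 x \<le> B"
proof -
  obtain c B where B: "\<And>i x. x \<ge> 0 \<Longrightarrow> c \<le> D i x \<and> D i x \<le> B" using D_two_sided by blast
  have "Lint q 1 1 0 1 h \<le> 2 powr q * (Lint q 1 0 0 1 h + Lint q 0 1 0 1 h)" for h
  proof -
    have "Lint q 1 1 0 1 h \<le> (LINT x:{0<..<1}|lborel. 2 powr q * (mix 1 0 x h powr q + mix 0 1 x h powr q))"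
      unfolding Lint_def
    proof (rule set_integral_mono)
      show "set_integrable lborel {0<..<1} (\<lambda>x. mix 1 1 x h powr q)" using q by (intro Lint_integrable) auto
      show "set_integrable lborel {0<..<1} (\<lambda>x. 2 powr q * (mix 1 0 x h powr q + mix 0 1 x h powr q))"
        using q by (intro set_integrable_mult_right set_integral_add Lint_integrable) auto
      fix x
      have "mix 1 1 x h powr q \<le> (2 * max (mix 1 0 x h) (mix 0 1 x h)) powr q"
        using q mix_nonneg[of 1 1] by (intro powr_mono2) (auto simp: mix_def)
      also have "\<dots> = 2 powr q * max (mix 1 0 x h) (mix 0 1 x h) powr q"
        by (simp add: powr_mult mix_nonneg le_max_iff_disj)
      also have "\<dots> \<le> 2 powr q * (mix 1 0 x h powr q + mix 0 1 x h powr q)"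
        by (intro mult_left_mono) (auto simp: max_def)
      finally show "mix 1 1 x h powr q \<le> 2 powr q * (mix 1 0 x h powr q + mix 0 1 x h powr q)" .
    qed
    also have "\<dots> = 2 powr q * (Lint q 1 0 0 1 h + Lint q 0 1 0 1 h)"
      unfolding Lint_def using q by (simp add: set_integral_add Lint_integrable)
    finally show ?thesis .
  qed
  then have "N 1 1 0 1 x \<le> 2 powr q * (Z One x + Z Two x)" for x
    unfolding N_def Z_def using mult_left_mono[of _ _ "exp ((1 + \<alpha>) * x)"] by (fastforce simp: algebra_simps)
  moreover have "Z i x \<le> eig i * B" if "x \<ge> 0" for i x
    using B[OF that, of i] eig_pos[of i] unfolding D_def by (simp add: divide_le_eq mult.commute)
  ultimately have "N 1 1 0 1 x \<le> 2 powr q * (eig One * B + eig Two * B)" if "x \<ge> 0" for x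
    using that by (meson add_mono mult_left_mono order_trans powr_ge_zero)
  moreover have "0 \<le> 2 powr q * (eig One * B + eig Two * B)"
    using calculation[of 0] N_nonneg[of 1 1 0 1 0] by linarith
  ultimately show ?thesis by blast
qed

end


section \<open>Asymptotics of the integrals\<close>

context overlap_spectrum
begin

definition lengths_group :: "real set" where
  "lengths_group = {of_int m * la + of_int k * lb | m k :: int. True}"

lemma lengths_group: "subgroup_reals lengths_group" "la \<in> lengths_group" "lb \<in> lengths_group"
proof -
  show "subgroup_reals lengths_group" unfolding lengths_group_def by (rule subgroup_reals_generated)
  have "la = of_int 1 * la + of_int 0 * lb" "lb = of_int 0 * la + of_int 1 * lb" by auto
  then show "la \<in> lengths_group" "lb \<in> lengths_group" unfolding lengths_group_def by blast+
qed

lemma w_pos: "w i P1 > 0" "w Left P2 > 0" "w Left P3 > 0" "w One P4 > 0"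
  unfolding w_def by (intro divide_pos_pos mult_pos_pos mass_pos eig_pos)+

fun offset :: "state \<Rightarrow> real" where
  "offset Left = 0" | "offset One = la + lb" | "offset Two = lb + lb"

lemma reach_edge: "w i k > 0 \<Longrightarrow> RU.reach i (len k) (dst i k)"
  using RU.reach_step[OF _ RU.reach_refl] by fastforce

lemma reach_Left_loop: "RU.reach Left (real m * la) Left"
proof (induction m)
  case 0
  then show ?case using RU.reach_refl by simp
next
  case (Suc m)
  then show ?case using RU.reach_trans[OF reach_edge[OF w_pos(1), of Left]] by (fastforce simp: distrib_right)
qed

lemma reach_One_loop: "RU.reach One (real k * lb) One"
proof (induction k)
  case 0
  then show ?case using RU.reach_refl by simp
next
  case (Suc k)
  then show ?case using RU.reach_trans[OF reach_edge[OF w_pos(4)]] by (fastforce simp: distrib_right)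
qed

text \<open>
  Enter \<open>Left\<close>; take the loop \<open>Left\<close>, \<open>One\<close>, \<open>Left\<close> with \<open>K - 1\<close> rounds at \<open>One\<close>, which uses up two
  of the steps \<open>la\<close>; take the remaining \<open>M - 2\<close> loops at \<open>Left\<close>; leave for \<open>j\<close>.
\<close>

lemma reach_semigroup:
  assumes "2 \<le> M"
  shows "RU.reach i (la + (real M * la + real K * lb) + offset j) j"
proof -
  have enter: "RU.reach i la Left" using reach_edge[OF w_pos(1), of i] by simp
  have exit: "RU.reach Left (offset j) j"
    using reach_edge[OF w_pos(2)] reach_edge[OF w_pos(3)] RU.reach_refl by (cases j) auto
  have "RU.reach Left (real M * la + real K * lb) Left"
  proof (cases K)
    case 0
    then show ?thesis using reach_Left_loop by simp
  next
    case (Suc k)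
    have "RU.reach Left (la + lb) One" "RU.reach One la Left"
      using reach_edge[OF w_pos(2)] reach_edge[OF w_pos(1), of One] by simp_all
    from RU.reach_trans[OF RU.reach_trans[OF RU.reach_trans[OF this(1) reach_One_loop[of k]] this(2)] reach_Left_loop[of "M - 2"]]
    have "RU.reach Left ((la + lb) + real k * lb + la + real (M - 2) * la) Left" .
    also have "(la + lb) + real k * lb + la + real (M - 2) * la = real M * la + real K * lb"
      using assms Suc by (simp add: of_nat_diff algebra_simps)
    finally show ?thesis .
  qed
  from RU.reach_trans[OF RU.reach_trans[OF enter this] exit] show ?thesis .
qed

text \<open>
  The group for which the solution settles down: the group generated by the step lengths if it is cyclic,
  and the whole line if it is dense.
\<close>

definition settle_group :: "real set \<Rightarrow> bool" where
  "settle_group G \<longleftrightarrow> (G = lengths_group \<and> (\<exists>d>0. G = range (\<lambda>n::int. of_int n * d))) \<or>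
     (G = UNIV \<and> (\<forall>\<delta>>0. \<exists>g\<in>lengths_group. 0 < g \<and> g < \<delta>))"

lemma settle_groupD:
  assumes "settle_group G"
  shows "subgroup_reals G" "la \<in> G" "lb \<in> G" "la > 0"
  using assms lengths_group UNIV_subgroup la_lb_pos unfolding settle_group_def by auto

lemma D_asym_periodic:
  assumes "settle_group G"
  shows "asym_periodic G (D i)"
proof -
  interpret R: renewal_system w dst len G
    using renewal settle_groupD[OF assms] by blast
  obtain C where C: "C \<ge> 0" "RU.solves C \<epsilon> D" using D_solves by blast
  obtain c B where "c > 0" and B: "\<And>i x. x \<ge> 0 \<Longrightarrow> c \<le> D i x \<and> D i x \<le> B" using D_two_sided by blast
  then have bdd: "\<bar>D i x\<bar> \<le> B" if "x \<ge> 0" for i x using that by (smt (verit))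
  from assms show ?thesis
    unfolding settle_group_def
  proof (elim disjE conjE exE)
    fix d assume G: "G = lengths_group" and d: "d > 0" "G = range (\<lambda>n::int. of_int n * d)"
    have "d \<in> G" unfolding d(2) by (auto intro!: image_eqI[of _ _ 1])
    then obtain m k :: int where mk: "d = of_int m * la + of_int k * lb" unfolding G lengths_group_def by blast
    obtain N0 where N0: "\<And>s. s \<ge> N0 \<Longrightarrow> \<exists>M K :: nat. 2 \<le> M \<and> s \<le> real M * la + real K * lb \<and> real M * la + real K * lb < s + d"
      using semigroup_hits_intervals[OF la_lb_pos mk d(1)] by blast
    have inG: "real M * la + real K * lb \<in> G" for M K
      using R.G settle_groupD[OF assms] by (intro subgroup_realsD(2) subgroup_reals_mult)
    have offG: "offset j \<in> G" for j
      using settle_groupD[OF assms]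
      by (cases j; simp only: offset.simps; blast intro: subgroup_realsD(1,2))
    show ?thesis
    proof (rule R.renewal_lattice[OF C(2,1) \<epsilon>_pos bdd d])
      fix i j
      show "\<exists>N. \<forall>t\<in>G. N \<le> t \<longrightarrow> RU.reach i t j"
      proof (intro exI[of _ "N0 + la + offset j"] ballI impI)
        fix t assume t: "t \<in> G" "N0 + la + offset j \<le> t"
        define s where "s = t - la - offset j"
        obtain M K :: nat where MK: "2 \<le> M" "s \<le> real M * la + real K * lb" "real M * la + real K * lb < s + d"
          using N0[of s] t unfolding s_def by auto
        have "s \<in> G" unfolding s_def using t offG settle_groupD[OF assms] by (intro subgroup_realsD(4)) auto
        then have "real M * la + real K * lb - s \<in> G" using inG by (intro subgroup_realsD(4)[OF R.G])
        then obtain n :: int where n: "real M * la + real K * lb - s = of_int n * d" unfolding d(2) by blast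
        have "0 \<le> of_int n * d" "of_int n * d < 1 * d" using n MK by linarith+
        then have "0 \<le> n" "n < 1" using d(1) by (simp_all add: zero_le_mult_iff)
        then have "n = 0" by simp
        then have "t = la + (real M * la + real K * lb) + offset j" using n unfolding s_def by simp
        then show "RU.reach i t j" using reach_semigroup[OF MK(1)] by simp
      qed
    qed auto
  next
    assume G: "G = UNIV" and dense: "\<forall>\<delta>>0. \<exists>g\<in>lengths_group. 0 < g \<and> g < \<delta>"
    show ?thesis
    proof (rule R.renewal_dense[OF C(2,1) \<epsilon>_pos bdd G])
      fix i j and \<delta> :: real assume \<delta>: "\<delta> > 0"
      obtain g where g: "g \<in> lengths_group" "0 < g" "g < \<delta>" using dense \<delta> by blast
      obtain m k :: int where mk: "g = of_int m * la + of_int k * lb" using g(1) unfolding lengths_group_def by blast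
      obtain N0 where N0: "\<And>s. s \<ge> N0 \<Longrightarrow> \<exists>M K :: nat. 2 \<le> M \<and> s \<le> real M * la + real K * lb \<and> real M * la + real K * lb < s + g"
        using semigroup_hits_intervals[OF la_lb_pos mk g(2)] by blast
      show "\<exists>N. \<forall>t\<ge>N. \<exists>s\<ge>t. s \<le> t + \<delta> \<and> RU.reach i s j"
      proof (rule exI[of _ "N0 + la + offset j"], intro allI impI)
        fix t assume t: "N0 + la + offset j \<le> t"
        obtain M K :: nat where MK: "2 \<le> M" "t - la - offset j \<le> real M * la + real K * lb"
            "real M * la + real K * lb < t - la - offset j + g"
          using N0[of "t - la - offset j"] t by auto
        then show "\<exists>s\<ge>t. s \<le> t + \<delta> \<and> RU.reach i s j"
          using reach_semigroup[OF MK(1), of i K j] g(3)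
          by (intro exI[of _ "la + (real M * la + real K * lb) + offset j"]) auto
      qed
    next
      fix \<eta> :: real assume \<eta>: "\<eta> > 0"
      have "((\<lambda>t. (exp (\<bar>1 + \<alpha>\<bar> * t) - 1) * \<bar>B\<bar>) \<longlongrightarrow> (exp (\<bar>1 + \<alpha>\<bar> * 0) - 1) * \<bar>B\<bar>) (at_right 0)"
        by (intro tendsto_intros)
      then have "eventually (\<lambda>t. (exp (\<bar>1 + \<alpha>\<bar> * t) - 1) * \<bar>B\<bar> < \<eta>) (at_right 0)"
        using \<eta> by (intro order_tendstoD(2)) auto
      then obtain \<delta> where \<delta>: "\<delta> > 0" "\<And>t. t > 0 \<Longrightarrow> t < \<delta> \<Longrightarrow> (exp (\<bar>1 + \<alpha>\<bar> * t) - 1) * \<bar>B\<bar> < \<eta>"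
        unfolding eventually_at_right_field by auto
      have "D i (x + t) \<le> D i x + \<eta>" if x: "x \<ge> 0" and t: "0 \<le> t" "t \<le> \<delta> / 2" for i x t
      proof (cases "t = 0")
        case True then show ?thesis using \<eta> by simp
      next
        case False
        have "D i (x + t) \<le> D i x + (exp (\<bar>1 + \<alpha>\<bar> * t) - 1) * D i x"
          using D_slow[OF t(1), of i x] by (simp add: algebra_simps)
        moreover have "(exp (\<bar>1 + \<alpha>\<bar> * t) - 1) * D i x \<le> (exp (\<bar>1 + \<alpha>\<bar> * t) - 1) * \<bar>B\<bar>"
          using bdd[OF x, of i] t by (intro mult_left_mono) auto
        ultimately show ?thesis using \<delta>(2)[of t] t False \<delta>(1) by simp
      qed
      then show "\<exists>\<delta>>0. \<exists>X. \<forall>i. \<forall>x\<ge>X. \<forall>t. 0 \<le> t \<longrightarrow> t \<le> \<delta> \<longrightarrow> D i (x + t) \<le> D i x + \<eta>"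
        using \<delta>(1) by (intro exI[of _ "\<delta> / 2"] conjI) (auto intro!: exI[of _ 0])
    qed
  qed
qed

lemma Z_asym_periodic:
  assumes "settle_group G"
  shows "asym_periodic G (Z i)"
proof -
  have "Z i = (\<lambda>x. eig i * D i x)" unfolding D_def using eig_pos[of i] by auto
  then show ?thesis using asym_periodic_cmult[OF D_asym_periodic[OF assms]] by simp
qed

lemma close_above_tendsto:
  assumes "close_above q (Lint q a b u v) g"
  shows "((\<lambda>x. N a b u v x - exp ((1 + \<alpha>) * x) * g (exp (- x))) \<longlongrightarrow> 0) at_top"
proof -
  obtain C where C: "\<And>x. exp ((1 + \<alpha>) * x) * g (exp (- x)) \<le> N a b u v x \<and>
    N a b u v x \<le> exp ((1 + \<alpha>) * x) * g (exp (- x)) + C * exp (- \<epsilon> * x)"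
    using N_close_above[OF assms] by blast
  have "((\<lambda>x. C * exp (- \<epsilon> * x)) \<longlongrightarrow> 0) at_top" by (rule exp_decay[OF \<epsilon>_pos])
  then show ?thesis
    by (rule tendsto_sandwich[rotated 2, OF tendsto_const])
       (use C in \<open>auto intro!: always_eventually simp: algebra_simps\<close>)
qed

context
  fixes G assumes G: "settle_group G"
begin

lemma parts_asym_periodic:
  "asym_periodic G (\<lambda>x. exp ((1 + \<alpha>) * x) * part1 q a b (exp (- x)))"
  "asym_periodic G (\<lambda>x. exp ((1 + \<alpha>) * x) * part2 q a b (exp (- x)))"
  "asym_periodic G (\<lambda>x. exp ((1 + \<alpha>) * x) * part3 q a b (exp (- x)))"
proof -
  have as: "asym_periodic G (\<lambda>x. c * Z i (x - t))" for c i t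
    by (intro asym_periodic_cmult asym_periodic_shift Z_asym_periodic G)
  show "asym_periodic G (\<lambda>x. exp ((1 + \<alpha>) * x) * part1 q a b (exp (- x)))"
    "asym_periodic G (\<lambda>x. exp ((1 + \<alpha>) * x) * part2 q a b (exp (- x)))"
    "asym_periodic G (\<lambda>x. exp ((1 + \<alpha>) * x) * part3 q a b (exp (- x)))"
    unfolding N_parts using as[of _ Left] as[of _ One] as[of _ Two] by (auto simp: Z_def)
qed

lemma N_first_block_asym_periodic:
  assumes "a \<ge> 0" "b \<ge> 0"
  shows "asym_periodic G (N a b 0 \<rho>)" "asym_periodic G (N a b 0 \<l>)"
proof -
  show "asym_periodic G (N a b 0 \<rho>)"
    by (rule asym_periodic_cong_o[OF _ close_above_tendsto[OF Lint_left_cell[OF q assms]]])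
       (unfold distrib_left, intro asym_periodic_add parts_asym_periodic)
  show "asym_periodic G (N a b 0 \<l>)"
    by (rule asym_periodic_cong_o[OF _ close_above_tendsto[OF Lint_first_block[OF q assms]]])
       (unfold distrib_left, intro asym_periodic_add parts_asym_periodic)
qed

lemma asym_periodic_diff:
  assumes "asym_periodic G Y" "asym_periodic G Y'"
  shows "asym_periodic G (\<lambda>x. Y x - Y' x)"
  using asym_periodic_add[OF assms(1) asym_periodic_cmult[OF assms(2), of "- 1"]] by simp

text \<open>
  On $(0,1)$ all pieces but the last are renewal solutions; the last one is the same integral with a
  changed ratio of the measures.
\<close>

lemma N_whole_step:
  assumes "a \<ge> 0" "b \<ge> 0"
  shows "asym_periodic G (\<lambda>x. N a b 0 1 x - r powr (- \<alpha>) * N (a * p E3) (b * p E4) 0 1 (x - lb))"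
proof (rule asym_periodic_cong_o)
  let ?E = "\<lambda>x. exp ((1 + \<alpha>) * x)"
  show "asym_periodic G (\<lambda>x. ?E x * part1 q a b (exp (- x)) + ?E x * part2 q a b (exp (- x)) + ?E x * part3 q a b (exp (- x)))"
    by (intro asym_periodic_add parts_asym_periodic)
  show "((\<lambda>x. N a b 0 1 x - r powr (- \<alpha>) * N (a * p E3) (b * p E4) 0 1 (x - lb) -
      (?E x * part1 q a b (exp (- x)) + ?E x * part2 q a b (exp (- x)) + ?E x * part3 q a b (exp (- x)))) \<longlongrightarrow> 0) at_top"
    using close_above_tendsto[OF Lint_whole[OF q assms]]
    by (simp only: N_parts(4)[symmetric] distrib_left diff_diff_eq ac_simps)
qed

text \<open>
  Unfold the last piece \<open>n\<close> times. The remainder involves $p_{e_3}^n\mu_1 + p_{e_4}^n\mu_2$, which is at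
  most $\max(p_{e_3},p_{e_4})^n(\mu_1 + \mu_2)$, and carries the factor $r^{-n\alpha}$; so it is of
  order $\max(Q_{3,r},Q_{4,r})^n$, uniformly in \<open>x\<close>.
\<close>

lemma N_whole_asym_periodic: "asym_periodic G (N 1 1 0 1)"
proof -
  \<comment> \<open>each unfolding contributes one factor \<open>\<theta>\<close>\<close>
  define \<theta> where "\<theta> = r powr (- \<alpha>)"
  define Y where "Y n = N (p E3 ^ n) (p E4 ^ n) 0 1" for n
  define M where "M = max (p E3) (p E4)"
  have M: "0 < M" "p E3 \<le> M" "p E4 \<le> M" unfolding M_def using p_pos[of E3] by auto
  have \<theta>M: "0 \<le> \<theta> * M powr q" "\<theta> * M powr q < 1"
    using Q_bounds unfolding \<theta>_def M_def Q_def by (auto simp: max_def mult.commute)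
  have step: "asym_periodic G (\<lambda>x. Y 0 x - \<theta> ^ n * Y n (x - real n * lb))" for n
  proof (induction n)
    case 0
    have "asym_periodic G (\<lambda>x. 0)" unfolding asym_periodic_def by (intro exI[of _ "\<lambda>_. 0"]) simp
    then show ?case by simp
  next
    case (Suc n)
    have "asym_periodic G (\<lambda>x. Y n x - \<theta> * Y (Suc n) (x - lb))"
      using N_whole_step[of "p E3 ^ n" "p E4 ^ n"] p_pos unfolding Y_def \<theta>_def by (simp add: mult.commute less_imp_le)
    from asym_periodic_add[OF Suc asym_periodic_cmult[OF asym_periodic_shift[OF this, of "real n * lb"], of "\<theta> ^ n"]]
    show ?case by (simp add: algebra_simps)
  qed
  obtain B where B: "B \<ge> 0" "\<And>x. x \<ge> 0 \<Longrightarrow> N 1 1 0 1 x \<le> B" using N_11_bounded by blast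
  have Y_le: "Y n x \<le> (M powr q) ^ n * B" if "x \<ge> 0" for n x
  proof -
    have "Lint q (p E3 ^ n) (p E4 ^ n) 0 1 h \<le> (M powr q) ^ n * Lint q 1 1 0 1 h" for h
    proof -
      have "Lint q (p E3 ^ n) (p E4 ^ n) 0 1 h \<le> Lint q (M ^ n * 1) (M ^ n * 1) 0 1 h"
        using M p_pos by (intro Lint_mono_coeff) (auto intro!: power_mono simp: less_imp_le)
      also have "\<dots> = (M ^ n) powr q * Lint q 1 1 0 1 h" using M by (intro Lint_scale) auto
      also have "(M ^ n) powr q = (M powr q) ^ n" using M(1) by (simp add: powr_realpow[symmetric] powr_powr mult.commute)
      finally show ?thesis .
    qed
    then have "Y n x \<le> (M powr q) ^ n * N 1 1 0 1 x"
      unfolding Y_def N_def using mult_left_mono[of _ _ "exp ((1 + \<alpha>) * x)"] by (fastforce simp: algebra_simps)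
    also have "\<dots> \<le> (M powr q) ^ n * B" using B(2)[OF that] by (intro mult_left_mono) auto
    finally show ?thesis .
  qed
  have "asym_periodic G (Y 0)"
  proof (rule asym_periodic_uniform_limit[OF settle_groupD(1,2,4)[OF G]])
    fix \<eta> :: real assume \<eta>: "\<eta> > 0"
    have "(\<lambda>n. (\<theta> * M powr q) ^ n * B) \<longlonglongrightarrow> 0 * B"
      using \<theta>M by (intro tendsto_mult LIMSEQ_realpow_zero tendsto_const)
    then have "eventually (\<lambda>n. (\<theta> * M powr q) ^ n * B < \<eta>) sequentially"
      using \<eta> by (intro order_tendstoD(2)) auto
    then obtain n where n: "(\<theta> * M powr q) ^ n * B < \<eta>" by (auto simp: eventually_sequentially)
    have "\<bar>Y 0 x - (Y 0 x - \<theta> ^ n * Y n (x - real n * lb))\<bar> \<le> \<eta>" if x: "x \<ge> real n * lb" for x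
    proof -
      have "\<theta> ^ n * Y n (x - real n * lb) \<le> \<theta> ^ n * ((M powr q) ^ n * B)"
        using x by (intro mult_left_mono Y_le) (auto simp: \<theta>_def)
      moreover have "0 \<le> \<theta> ^ n * Y n (x - real n * lb)"
        unfolding Y_def \<theta>_def by (intro mult_nonneg_nonneg N_nonneg) auto
      ultimately show ?thesis using n by (simp add: power_mult_distrib)
    qed
    then show "\<exists>Y'. asym_periodic G Y' \<and> eventually (\<lambda>x. \<bar>Y 0 x - Y' x\<bar> \<le> \<eta>) at_top"
      using step[of n] unfolding eventually_at_top_linorder by blast
  qed
  then show ?thesis unfolding Y_def by simp
qed

lemma N_right_cell_asym_periodic: "asym_periodic G (N 1 1 (1 - r) 1)"
proof (rule asym_periodic_cong_o)
  show "asym_periodic G (\<lambda>x. r powr (- \<alpha>) * N (1 * p E3) (1 * p E4) 0 1 (x - lb))"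
    using asym_periodic_diff[OF N_whole_asym_periodic N_whole_step[of 1 1]] by simp
  show "((\<lambda>x. N 1 1 (1 - r) 1 x - r powr (- \<alpha>) * N (1 * p E3) (1 * p E4) 0 1 (x - lb)) \<longlongrightarrow> 0) at_top"
    using close_above_tendsto[OF cell4_approximation[OF q, of 1 1]] unfolding N_parts(4) by simp
qed

end

end


section \<open>The $L^q$-spectrum\<close>

lemma msupp_meets_open:
  assumes M: "sets M = sets borel" and U: "open U" "emeasure M U > 0"
  shows "\<exists>x\<in>U. x \<in> msupp M"
proof (rule ccontr)
  assume "\<not> ?thesis"
  then have "\<forall>x\<in>U. \<exists>V. open V \<and> x \<in> V \<and> emeasure M V = 0"
    unfolding msupp_def by (auto simp: not_gr_zero)
  then obtain V where V: "\<And>x. x \<in> U \<Longrightarrow> open (V x)" "\<And>x. x \<in> U \<Longrightarrow> x \<in> V x"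
      "\<And>x. x \<in> U \<Longrightarrow> emeasure M (V x) = 0"
    by metis
  obtain F where F: "F \<subseteq> V ` U" "countable F" "\<Union>F = \<Union>(V ` U)"
    using Lindelof[of "V ` U"] V by blast
  have "(\<Union>X\<in>F. X) \<in> null_sets M"
    using F V M by (intro null_sets_UN' F(2)) (auto simp: null_sets_def)
  moreover have "U \<subseteq> \<Union>F" unfolding F(3) using V by blast
  moreover have "\<Union>F \<in> sets M"
    unfolding M F(3) using V by (intro borel_open open_Union) auto
  ultimately have "emeasure M U \<le> 0"
    using emeasure_mono[of U "\<Union>F" M] by (simp add: null_sets_def)
  then show False using U by simp
qed

lemma log_correction_vanishes: "((\<lambda>h. a + ln b / ln h) \<longlongrightarrow> a) (at_right (0::real))"
  by real_asymp

context overlap_spectrum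
begin

abbreviation \<mu> :: "real measure" where "\<mu> \<equiv> madd \<mu>1 \<mu>2"

lemma sets_\<mu>_sum: "sets \<mu> = sets borel"
  using sets.sigma_sets_eq[of "borel :: real measure"] unfolding madd_def by (simp add: sets_measure_of)

lemma emeasure_\<mu>: "A \<in> sets borel \<Longrightarrow> emeasure \<mu> A = ennreal (measure \<mu>1 A + measure \<mu>2 A)"
  using emeasure_madd[OF sets_\<mu>, of A]
  by (simp add: M1.emeasure_eq_measure M2.emeasure_eq_measure)

lemma measure_\<mu>: "A \<in> sets borel \<Longrightarrow> measure \<mu> A = measure \<mu>1 A + measure \<mu>2 A"
  by (simp only: measure_def[of \<mu> A] emeasure_\<mu>) (rule enn2real_ennreal, simp)

lemma measure_\<mu>_ball: "measure \<mu> (ball x h) = mix 1 1 x h"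
  by (simp add: measure_\<mu> mix_def ball1_def ball2_def)

lemma msupp_\<mu>: "msupp \<mu> \<subseteq> {0..1}"
proof
  fix x assume x: "x \<in> msupp \<mu>"
  show "x \<in> {0..1}"
  proof (rule ccontr)
    assume "x \<notin> {0..1}"
    then have "emeasure \<mu> (- {0..1}) > 0"
      using x unfolding msupp_def by (auto simp: open_Compl)
    then show False using outside_null by (simp add: emeasure_\<mu>)
  qed
qed

text \<open>
  For \<open>y\<close> in $B_h(x)$ the ball $B_{2h}(y)$ contains $B_h(x)$. So the power of the mass of $B_h(x)$
  is at most its average with radius $2h$ over half of that ball, and the halves are disjoint.
\<close>

lemma packing_sum_le:
  assumes h: "0 < h" "h \<le> 1 / 2" and X: "finite X" "X \<subseteq> msupp \<mu>" "disjoint_family_on (\<lambda>x. ball x h) X"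
  shows "(\<Sum>x\<in>X. measure \<mu> (ball x h) powr q) \<le> Lint q 1 1 0 1 (2 * h) / h"
proof -
  \<comment> \<open>the half of the ball that points into the unit interval\<close>
  define c where "c x = (if x \<le> 1 / 2 then x else x - h)" for x
  define J where "J x = {c x<..<c x + h}" for x
  have J_ball: "J x \<subseteq> ball x h" for x unfolding J_def c_def by (auto simp: dist_real_def)
  have J_sub: "J x \<subseteq> {0<..<1}" if "x \<in> X" for x
  proof -
    have "0 \<le> x" "x \<le> 1" using that X(2) msupp_\<mu> by auto
    then show ?thesis using h unfolding J_def c_def by auto
  qed
  have J_disj: "x = x'" if "x \<in> X" "x' \<in> X" "y \<in> J x" "y \<in> J x'" for x x' y
    using X(3) that J_ball unfolding disjoint_family_on_def by blast
  have "(\<Sum>x\<in>X. h * mix 1 1 x h powr q) = (\<Sum>x\<in>X. LINT y|lborel. indicator (J x) y * mix 1 1 x h powr q)"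
    using h by (intro sum.cong) (auto simp: J_def)
  also have "\<dots> = (LINT y|lborel. (\<Sum>x\<in>X. indicator (J x) y * mix 1 1 x h powr q))"
    using h by (intro Bochner_Integration.integral_sum[symmetric]) (auto simp: J_def)
  also have "\<dots> \<le> (LINT y|lborel. indicator {0<..<1} y *\<^sub>R mix 1 1 y (2 * h) powr q)"
  proof (rule integral_mono)
    show "integrable lborel (\<lambda>y. \<Sum>x\<in>X. indicator (J x) y * mix 1 1 x h powr q)"
      using h by (intro Bochner_Integration.integrable_sum integrable_mult_left) (auto simp: J_def)
    show "integrable lborel (\<lambda>y. indicator {0<..<1} y *\<^sub>R mix 1 1 y (2 * h) powr q)"
      using Lint_integrable[of 1 1 q 0 1 "2 * h"] q unfolding set_integrable_def by simp
    fix y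
    show "(\<Sum>x\<in>X. indicator (J x) y * mix 1 1 x h powr q) \<le> indicator {0<..<1} y *\<^sub>R mix 1 1 y (2 * h) powr q"
    proof (cases "\<exists>x\<in>X. y \<in> J x")
      case True
      then obtain x where x: "x \<in> X" "y \<in> J x" by blast
      have "(\<Sum>z\<in>X. indicator (J z) y * mix 1 1 z h powr q) = (\<Sum>z\<in>X. if z = x then mix 1 1 x h powr q else 0)"
      proof (intro sum.cong refl)
        fix z assume z: "z \<in> X"
        show "indicator (J z) y * mix 1 1 z h powr q = (if z = x then mix 1 1 x h powr q else 0)"
        proof (cases "z = x")
          case False
          then have "y \<notin> J z" using J_disj[OF z x(1) _ x(2)] by blast
          then show ?thesis using False by simp
        qed (use x in simp)
      qed
      also have "\<dots> = mix 1 1 x h powr q" using X(1) x by simp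
      also have "\<dots> \<le> mix 1 1 y (2 * h) powr q"
      proof (intro powr_mono2 mix_nonneg mix_mono_support q)
        fix z assume "\<bar>z - x\<bar> < h"
        moreover have "\<bar>x - y\<bar> < h" using J_ball[of x] x(2) by (auto simp: dist_real_def)
        ultimately show "\<bar>z - y\<bar> < 2 * h" by linarith
      qed auto
      finally show ?thesis using J_sub[OF x(1)] x(2) by auto
    next
      case False
      then have "(\<Sum>x\<in>X. indicator (J x) y * mix 1 1 x h powr q) = 0" by (intro sum.neutral) auto
      then show ?thesis by simp
    qed
  qed
  finally have "h * (\<Sum>x\<in>X. mix 1 1 x h powr q) \<le> Lint q 1 1 0 1 (2 * h)"
    unfolding Lint_def set_lebesgue_integral_def by (simp add: sum_distrib_left)
  then show ?thesis unfolding measure_\<mu>_ball using h by (simp add: le_divide_eq mult.commute)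
qed

lemma packing_sup_le:
  assumes h: "0 < h" "h \<le> 1 / 2"
  shows "packing_sup \<mu> q h \<le> Lint q 1 1 0 1 (2 * h) / h"
  unfolding packing_sup_def
proof (rule cSUP_least)
  show "{X. finite X \<and> X \<subseteq> msupp \<mu> \<and> disjoint_family_on (\<lambda>x. ball x h) X} \<noteq> {}"
    by (auto intro!: exI[of _ "{}"] simp: disjoint_family_on_def)
qed (use packing_sum_le[OF h] in auto)

lemma packing_sup_ge:
  assumes h: "0 < h" "h \<le> 1 / 2" and X: "finite X" "X \<subseteq> msupp \<mu>" "disjoint_family_on (\<lambda>x. ball x h) X"
  shows "(\<Sum>x\<in>X. measure \<mu> (ball x h) powr q) \<le> packing_sup \<mu> q h"
  unfolding packing_sup_def
proof (rule cSUP_upper2[of _ _ X])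
  show "bdd_above ((\<lambda>X. \<Sum>x\<in>X. measure \<mu> (ball x h) powr q) `
      {X. finite X \<and> X \<subseteq> msupp \<mu> \<and> disjoint_family_on (\<lambda>x. ball x h) X})"
    using packing_sum_le[OF h] by (intro bdd_aboveI2) auto
qed (use X in auto)

text \<open>
  Cut $(0,1)$ into intervals of length \<open>h\<close>. If the \<open>h\<close>-neighbourhood of such an interval has positive
  mass, it contains a point of the support, and the ball of radius $4h$ about this point covers it.
  Balls that belong to intervals in the same residue class modulo $12$ are disjoint: their centres are at
  least $12h - 3h > 8h$ apart.
\<close>

lemma Lint_le_packing_sup:
  assumes h: "0 < h" "h \<le> 1 / 8"
  shows "Lint q 1 1 0 1 h \<le> 12 * h * packing_sup \<mu> q (4 * h)"
proof -
  define n where "n = nat \<lfloor>1 / h\<rfloor>"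
  \<comment> \<open>the interval \<open>I j\<close>, enlarged by \<open>h\<close> on both sides, is a ball of radius $3h/2$\<close>
  define m where "m j = mix 1 1 ((real j + 1 / 2) * h) (3 * h / 2)" for j :: nat
  define I where "I j = {real j * h..<(real j + 1) * h}" for j :: nat
  have m_nonneg: "m j \<ge> 0" for j unfolding m_def by (intro mix_nonneg) auto
  have "Lint q 1 1 0 1 h \<le> (LINT x|lborel. (\<Sum>j\<le>n. indicator (I j) x * m j powr q))"
    unfolding Lint_def set_lebesgue_integral_def
  proof (rule integral_mono)
    show "integrable lborel (\<lambda>x. indicator {0<..<1} x *\<^sub>R mix 1 1 x h powr q)"
      using Lint_integrable[of 1 1 q 0 1 h] q unfolding set_integrable_def by simp
    show "integrable lborel (\<lambda>x. \<Sum>j\<le>n. indicator (I j) x * m j powr q)"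
      using h by (intro Bochner_Integration.integrable_sum integrable_mult_left) (auto simp: I_def)
    fix x
    show "indicator {0<..<1} x *\<^sub>R mix 1 1 x h powr q \<le> (\<Sum>j\<le>n. indicator (I j) x * m j powr q)"
    proof (cases "x \<in> {0<..<1}")
      case True
      define j where "j = nat \<lfloor>x / h\<rfloor>"
      have "x / h \<ge> 0" using True h by simp
      then have j_eq: "real j = of_int \<lfloor>x / h\<rfloor>" unfolding j_def by simp
      have xj: "real j * h \<le> x" "x < (real j + 1) * h"
        unfolding j_eq using h floor_divide_lower[of h x] floor_divide_upper[of h x] by auto
      have "x / h \<le> 1 / h" using True h by (simp add: divide_right_mono)
      then have "j \<le> n" unfolding j_def n_def by (intro nat_mono floor_mono)
      have "mix 1 1 x h powr q \<le> m j powr q"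
        unfolding m_def
      proof (intro powr_mono2 mix_nonneg mix_mono_support q)
        fix z assume "\<bar>z - x\<bar> < h"
        moreover have "\<bar>x - (real j + 1 / 2) * h\<bar> \<le> h / 2" using xj by (simp only: abs_le_iff distrib_right) linarith
        ultimately show "\<bar>z - (real j + 1 / 2) * h\<bar> < 3 * h / 2" by linarith
      qed auto
      also have "\<dots> = indicator (I j) x * m j powr q" using xj unfolding I_def by simp
      also have "\<dots> \<le> (\<Sum>j\<le>n. indicator (I j) x * m j powr q)"
        using \<open>j \<le> n\<close> by (intro member_le_sum) auto
      finally show ?thesis using True by simp
    next
      case False
      then show ?thesis by (auto intro!: sum_nonneg)
    qed
  qed
  also have "\<dots> = (\<Sum>j\<le>n. h * m j powr q)"
    using h by (subst Bochner_Integration.integral_sum) (auto simp: I_def algebra_simps)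
  also have "\<dots> = h * (\<Sum>c<12. \<Sum>j\<in>{j \<in> {..n}. j mod 12 = c}. m j powr q)"
    by (subst sum.group) (auto simp: sum_distrib_left)
  also have "\<dots> \<le> h * (\<Sum>c<12::nat. packing_sup \<mu> q (4 * h))"
  proof (intro mult_left_mono sum_mono)
    fix c :: nat
    define J where "J = {j \<in> {..n}. j mod 12 = c \<and> m j > 0}"
    have "\<exists>y. y \<in> msupp \<mu> \<and> \<bar>y - (real j + 1 / 2) * h\<bar> < 3 * h / 2" if "j \<in> J" for j
    proof -
      have "measure \<mu> (ball ((real j + 1 / 2) * h) (3 * h / 2)) > 0"
        using that unfolding J_def m_def measure_\<mu>_ball by simp
      then have "emeasure \<mu> (ball ((real j + 1 / 2) * h) (3 * h / 2)) > 0"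
        by (metis less_irrefl measure_eq_0_null_sets null_setsI not_gr_zero sets_\<mu>_sum borel_open open_ball)
      then obtain y where "y \<in> ball ((real j + 1 / 2) * h) (3 * h / 2)" "y \<in> msupp \<mu>"
        using msupp_meets_open[OF sets_\<mu>_sum open_ball] by blast
      then show ?thesis by (auto simp: dist_real_def abs_minus_commute)
    qed
    then obtain y where y: "\<And>j. j \<in> J \<Longrightarrow> y j \<in> msupp \<mu>" "\<And>j. j \<in> J \<Longrightarrow> \<bar>y j - (real j + 1 / 2) * h\<bar> < 3 * h / 2"
      by metis
    have apart: "y j + 8 * h \<le> y j'" if "j \<in> J" "j' \<in> J" "j < j'" for j j'
    proof -
      have "j mod 12 = j' mod 12" using that unfolding J_def by auto
      then have "12 \<le> j' - j" using that(3)
        by (metis dvd_imp_le less_imp_le mod_eq_dvd_iff_nat zero_less_diff)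
      then have "(real j + 12) * h \<le> real j' * h" using h by (intro mult_right_mono) linarith+
      then show ?thesis using y(2)[OF that(1)] y(2)[OF that(2)] h by (simp only: abs_less_iff distrib_right) linarith
    qed
    have inj: "inj_on y J"
      by (rule inj_onI) (use apart h in \<open>metis add_le_same_cancel1 linorder_neqE_nat mult_pos_pos not_less zero_less_numeral\<close>)
    have "(\<Sum>j\<in>{j \<in> {..n}. j mod 12 = c}. m j powr q) = (\<Sum>j\<in>J. m j powr q)"
      using m_nonneg unfolding J_def by (intro sum.mono_neutral_right) (auto simp: less_le)
    also have "\<dots> \<le> (\<Sum>j\<in>J. mix 1 1 (y j) (4 * h) powr q)"
    proof (intro sum_mono)
      fix j assume j: "j \<in> J"
      show "m j powr q \<le> mix 1 1 (y j) (4 * h) powr q"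
        unfolding m_def
      proof (intro powr_mono2 mix_nonneg mix_mono_support q)
        fix z assume "\<bar>z - (real j + 1 / 2) * h\<bar> < 3 * h / 2"
        then show "\<bar>z - y j\<bar> < 4 * h" using y(2)[OF j] by linarith
      qed auto
    qed
    also have "\<dots> = (\<Sum>x\<in>y ` J. measure \<mu> (ball x (4 * h)) powr q)"
      unfolding measure_\<mu>_ball by (simp add: sum.reindex[OF inj])
    also have "\<dots> \<le> packing_sup \<mu> q (4 * h)"
    proof (rule packing_sup_ge)
      have "\<bar>x - x'\<bar> \<ge> 8 * h" if "x \<in> y ` J" "x' \<in> y ` J" "x \<noteq> x'" for x x'
      proof -
        obtain j j' where j: "x = y j" "x' = y j'" "j \<in> J" "j' \<in> J" using \<open>x \<in> y ` J\<close> \<open>x' \<in> y ` J\<close> by blast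
        then show ?thesis using apart[of j j'] apart[of j' j] \<open>x \<noteq> x'\<close> h
          by (cases j j' rule: linorder_cases) auto
      qed
      then show "disjoint_family_on (\<lambda>x. ball x (4 * h)) (y ` J)"
        unfolding disjoint_family_on_def by (force simp: dist_real_def)
    qed (use h y J_def in auto)
    finally show "(\<Sum>j\<in>{j \<in> {..n}. j mod 12 = c}. m j powr q) \<le> packing_sup \<mu> q (4 * h)" .
  qed (use h in simp)
  finally show ?thesis by simp
qed

lemma Lq_spectrum_eq: "Lq_spectrum \<mu> q = ereal \<alpha>"
proof -
  obtain c B where c: "c > 0" and cB: "\<And>i x. x \<ge> 0 \<Longrightarrow> c \<le> D i x \<and> D i x \<le> B" using D_two_sided by blast
  obtain B' where B': "\<And>x. x \<ge> 0 \<Longrightarrow> N 1 1 0 1 x \<le> B'" using N_11_bounded by blast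
  define c' where "c' = c * eig One"
  have c': "c' > 0" unfolding c'_def by (intro mult_pos_pos c eig_pos)
  have Lint_N: "Lint q 1 1 0 1 h = h powr (1 + \<alpha>) * N 1 1 0 1 (- ln h)" if "h > 0" for h
    unfolding N_def using that by (simp add: powr_def exp_add[symmetric] flip: mult.assoc)
  have low: "c' * h powr (1 + \<alpha>) \<le> Lint q 1 1 0 1 h" if h: "0 < h" "h \<le> 1" for h
  proof -
    have "c' \<le> Z One (- ln h)"
    proof -
      have "c \<le> Z One (- ln h) / eig One" using cB[of "- ln h" One] h unfolding D_def by simp
      then show ?thesis unfolding c'_def pos_le_divide_eq[OF eig_pos] .
    qed
    also have "\<dots> \<le> N 1 1 0 1 (- ln h)"
      unfolding Z_def N_def by (intro mult_left_mono) (auto intro!: Lint_mono_coeff)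
    finally show ?thesis unfolding Lint_N[OF h(1)] by (subst mult.commute[of c']) (intro mult_left_mono; simp)
  qed
  have up: "Lint q 1 1 0 1 h \<le> B' * h powr (1 + \<alpha>)" if h: "0 < h" "h \<le> 1" for h
    unfolding Lint_N[OF h(1)] using B'[of "- ln h"] h by (simp add: mult.commute mult_right_mono)
  have B'_pos: "B' > 0" using low[of 1] up[of 1] c' by simp
  \<comment> \<open>from the two comparisons with radii \<open>h / 4\<close> and \<open>2 * h\<close>\<close>
  define b1 where "b1 = c' * (1 / 4) powr (1 + \<alpha>) / 3"
  define b2 where "b2 = B' * 2 powr (1 + \<alpha>)"
  have b: "b1 > 0" "b2 > 0" unfolding b1_def b2_def using c' B'_pos by auto
  have P_up: "packing_sup \<mu> q h \<le> b2 * h powr \<alpha>" if h: "0 < h" "h \<le> 1 / 2" for h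
  proof -
    have "packing_sup \<mu> q h \<le> B' * (2 * h) powr (1 + \<alpha>) / h"
      using packing_sup_le[OF h] divide_right_mono[OF up[of "2 * h"], of h] h by simp
    also have "\<dots> = b2 * h powr \<alpha>" unfolding b2_def using h by (simp add: powr_mult powr_add)
    finally show ?thesis .
  qed
  have P_low: "b1 * h powr \<alpha> \<le> packing_sup \<mu> q h" if h: "0 < h" "h \<le> 1 / 2" for h
  proof -
    have "c' * (h / 4) powr (1 + \<alpha>) \<le> 12 * (h / 4) * packing_sup \<mu> q (4 * (h / 4))"
      using low[of "h / 4"] Lint_le_packing_sup[of "h / 4"] h by linarith
    moreover have "(h / 4) powr (1 + \<alpha>) = (1 / 4) powr (1 + \<alpha>) * (h * h powr \<alpha>)"
      using h powr_mult[of "1 / 4" h "1 + \<alpha>"] by (simp add: powr_add)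
    ultimately have "h * (c' * (1 / 4) powr (1 + \<alpha>) * h powr \<alpha>) \<le> h * (3 * packing_sup \<mu> q h)"
      by (simp add: algebra_simps)
    then have "c' * (1 / 4) powr (1 + \<alpha>) * h powr \<alpha> \<le> 3 * packing_sup \<mu> q h" using h by simp
    then show ?thesis unfolding b1_def by simp
  qed
  have "((\<lambda>h. ln (packing_sup \<mu> q h) / ln h) \<longlongrightarrow> \<alpha>) (at_right 0)"
  proof (rule tendsto_sandwich)
    show "((\<lambda>h. \<alpha> + ln b2 / ln h) \<longlongrightarrow> \<alpha>) (at_right 0)" "((\<lambda>h. \<alpha> + ln b1 / ln h) \<longlongrightarrow> \<alpha>) (at_right 0)"
      using log_correction_vanishes[of \<alpha>] by blast+
    have ev: "eventually (\<lambda>h. 0 < h \<and> h < 1 / 2) (at_right (0::real))"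
      using eventually_at_right_real[of 0 "1/2"] by simp
    have main: "\<alpha> + ln b2 / ln h \<le> ln (packing_sup \<mu> q h) / ln h \<and> ln (packing_sup \<mu> q h) / ln h \<le> \<alpha> + ln b1 / ln h"
      if h: "0 < h" "h < 1 / 2" for h
    proof -
      have P: "b1 * h powr \<alpha> \<le> packing_sup \<mu> q h" "packing_sup \<mu> q h \<le> b2 * h powr \<alpha>"
        using P_low P_up h by auto
      have pos: "b1 * h powr \<alpha> > 0" "b2 * h powr \<alpha> > 0" using b h by auto
      have "ln (b1 * h powr \<alpha>) \<le> ln (packing_sup \<mu> q h)" "ln (packing_sup \<mu> q h) \<le> ln (b2 * h powr \<alpha>)"
        using P pos by auto
      moreover have "ln (b1 * h powr \<alpha>) = ln b1 + \<alpha> * ln h" "ln (b2 * h powr \<alpha>) = ln b2 + \<alpha> * ln h"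
        using b h by (auto simp: ln_mult ln_powr)
      moreover have neg: "ln h < 0" using h by simp
      ultimately have "(ln b2 + \<alpha> * ln h) / ln h \<le> ln (packing_sup \<mu> q h) / ln h"
        "ln (packing_sup \<mu> q h) / ln h \<le> (ln b1 + \<alpha> * ln h) / ln h"
        by (auto intro!: divide_right_mono_neg)
      then show ?thesis using neg by (simp add: add_divide_distrib add.commute)
    qed
    show "eventually (\<lambda>h. \<alpha> + ln b2 / ln h \<le> ln (packing_sup \<mu> q h) / ln h) (at_right 0)"
      "eventually (\<lambda>h. ln (packing_sup \<mu> q h) / ln h \<le> \<alpha> + ln b1 / ln h) (at_right 0)"
      using ev main by (auto elim!: eventually_mono)
  qed
  then show ?thesis unfolding Lq_spectrum_def by (intro lim_imp_Liminf) auto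
qed

end


section \<open>When $\nu_1$ is lattice\<close>

text \<open>
  Finiteness is part of the notion because convolution is a product measure, which needs it.
\<close>

definition carried_by :: "real set \<Rightarrow> real measure \<Rightarrow> bool" where
  "carried_by G M \<longleftrightarrow> sets M = sets borel \<and> finite_measure M \<and> emeasure M (- G) = 0"

lemma sets_msum: "sets (msum I F) = sets borel"
  using sets.sigma_sets_eq[of "borel :: real measure"] unfolding msum_def by (simp add: sets_measure_of)

lemma sets_madd: "sets (madd M N) = sets borel"
  using sets.sigma_sets_eq[of "borel :: real measure"] unfolding madd_def by (simp add: sets_measure_of)

lemma sets_atom: "sets (atom c x) = sets borel"
  unfolding atom_def by simp

lemma emeasure_atom: "A \<in> sets borel \<Longrightarrow> emeasure (atom c x) A = ennreal c * indicator A x"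
  unfolding atom_def by simp

lemma finite_measure_borelI: "sets M = sets borel \<Longrightarrow> emeasure M UNIV \<noteq> \<infinity> \<Longrightarrow> finite_measure M"
  using sets_eq_imp_space_eq[of M borel] by (intro finite_measureI) auto

lemma carried_by_atom: "x \<in> G \<Longrightarrow> G \<in> sets borel \<Longrightarrow> carried_by G (atom c x)"
  unfolding carried_by_def
  by (auto simp: sets_atom emeasure_atom intro!: finite_measure_borelI)

lemma carried_by_null: "carried_by G (null_measure borel)"
  unfolding carried_by_def by (auto intro!: finite_measure_borelI)

lemma carried_by_return: "x \<in> G \<Longrightarrow> G \<in> sets borel \<Longrightarrow> carried_by G (return borel x)"
  unfolding carried_by_def by (auto intro!: finite_measure_borelI)

lemma carried_by_msum:
  assumes G: "G \<in> sets borel" and F: "\<And>i. i \<in> I \<Longrightarrow> carried_by G (F i)"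
    and fin: "(\<integral>\<^sup>+ i. emeasure (F i) UNIV \<partial>count_space I) \<noteq> \<infinity>"
  shows "carried_by G (msum I F)"
proof -
  have s: "\<And>i. i \<in> I \<Longrightarrow> sets (F i) = sets borel" using F unfolding carried_by_def by blast
  have "(\<integral>\<^sup>+ i. emeasure (F i) (- G) \<partial>count_space I) = (\<integral>\<^sup>+ i. 0 \<partial>count_space I)"
    using F by (intro nn_integral_cong) (simp add: carried_by_def)
  then have "emeasure (msum I F) (- G) = 0"
    using G by (subst emeasure_msum[OF s]) auto
  moreover have "emeasure (msum I F) UNIV \<noteq> \<infinity>"
    using fin by (subst emeasure_msum[OF s]) auto
  ultimately show ?thesis unfolding carried_by_def by (auto simp: sets_msum intro!: finite_measure_borelI)
qed

lemma carried_by_msum_finite: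
  assumes "G \<in> sets borel" "finite I" "\<And>i. i \<in> I \<Longrightarrow> carried_by G (F i)"
  shows "carried_by G (msum I F)"
proof (rule carried_by_msum[OF assms(1,3)])
  have "emeasure (F i) UNIV \<noteq> \<infinity>" if "i \<in> I" for i
    using finite_measure.emeasure_finite assms(3)[OF that] unfolding carried_by_def by fastforce
  then show "(\<integral>\<^sup>+ i. emeasure (F i) UNIV \<partial>count_space I) \<noteq> \<infinity>"
    using assms(2) by (simp add: nn_integral_count_space_finite)
qed

lemma carried_by_convolution:
  assumes G: "G \<in> sets borel" "subgroup_reals G" and M: "carried_by G M" and N: "carried_by G N"
  shows "carried_by G (M \<star> N)"
proof -
  have fin: "finite_measure M" "finite_measure N" and s: "sets M = sets borel" "sets N = sets borel"
    using M N unfolding carried_by_def by auto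
  have sp: "space M = UNIV" "space N = UNIV"
    using sets_eq_imp_space_eq[OF s(1)] sets_eq_imp_space_eq[OF s(2)] by auto
  have "emeasure (M \<star> N) (- G) = (\<integral>\<^sup>+ x. emeasure N {a. a + x \<in> - G} \<partial>M)"
    using G fin s sp by (intro convolution_emeasure) auto
  also have "\<dots> = (\<integral>\<^sup>+ x. 0 \<partial>M)"
  proof (rule nn_integral_cong_AE)
    have "AE x in M. x \<notin> - G"
      using M G s by (intro AE_not_in) (auto simp: carried_by_def null_sets_def)
    then show "AE x in M. emeasure N {a. a + x \<in> - G} = 0"
    proof eventually_elim
      case (elim x)
      then have "{a. a + x \<in> - G} \<subseteq> - G" using subgroup_realsD(2)[OF G(2)] by auto
      then have "emeasure N {a. a + x \<in> - G} \<le> emeasure N (- G)"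
        using G s by (intro emeasure_mono) auto
      then show ?case using N unfolding carried_by_def by simp
    qed
  qed
  finally show ?thesis
    using convolution_finite[OF fin s(2,1)] unfolding carried_by_def by simp
qed

lemma convolution_ge_point:
  assumes fin: "finite_measure M" "finite_measure N" and s: "sets M = sets borel" "sets N = sets borel"
    and U: "U \<in> sets borel" "x + y \<in> U"
  shows "emeasure M {x} * emeasure N {y} \<le> emeasure (M \<star> N) U"
proof -
  have sp: "space M = UNIV" "space N = UNIV"
    using sets_eq_imp_space_eq[OF s(1)] sets_eq_imp_space_eq[OF s(2)] by auto
  have "emeasure M {x} * emeasure N {y} = (\<integral>\<^sup>+ t. emeasure N {y} * indicator {x} t \<partial>M)"
    using s by (subst nn_integral_cmult_indicator) (auto simp: mult.commute)
  also have "\<dots> \<le> (\<integral>\<^sup>+ t. emeasure N {a. a + t \<in> U} \<partial>M)"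
  proof (rule nn_integral_mono)
    fix t
    have "(\<lambda>a. a + t) -` U \<inter> space borel \<in> sets borel"
      using U by (intro measurable_sets) auto
    then have "{a. a + t \<in> U} \<in> sets N" unfolding s by (simp add: vimage_def)
    moreover have "{y} \<subseteq> {a. a + t \<in> U}" if "t = x" using that U(2) by (simp add: add.commute)
    ultimately have "emeasure N {y} \<le> emeasure N {a. a + t \<in> U}" if "t = x"
      using that by (intro emeasure_mono) auto
    then show "emeasure N {y} * indicator {x} t \<le> emeasure N {a. a + t \<in> U}"
      by (cases "t = x") auto
  qed
  also have "\<dots> = emeasure (M \<star> N) U"
    using U fin s sp by (intro convolution_emeasure[symmetric]) auto
  finally show ?thesis .
qed

lemma discrete_multiples:
  assumes d: "d > 0"
  shows "topological_space_class.discrete (range (\<lambda>n::int. of_int n * d :: real))"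
proof (rule discreteI)
  fix x :: real assume x: "x \<in> range (\<lambda>n::int. of_int n * d)"
  then obtain n :: int where n: "x = of_int n * d" by blast
  have "y = x" if "y = of_int m * d" "dist x y < d" for y and m :: int
  proof -
    have "x - y = of_int (n - m) * d" unfolding n that(1) by (simp add: algebra_simps)
    then have "\<bar>of_int (n - m) :: real\<bar> * d < 1 * d"
      using that(2) d by (simp add: dist_real_def abs_mult)
    then have "\<bar>of_int (n - m) :: real\<bar> < 1" using d by (simp only: mult_less_cancel_right_pos)
    then have "n = m" by linarith
    then show ?thesis using n that(1) by simp
  qed
  then show "x isolated_in range (\<lambda>n::int. of_int n * d)"
    unfolding isolated_in_dist_Ex_iff using x d by blast
qed

context overlap_spectrum
begin

abbreviation entry :: "cell \<Rightarrow> cell \<Rightarrow> real measure" where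
  "entry \<equiv> renewal_entry \<rho> r p q \<alpha>"

lemma return_weight: "(p E5 * p E3 ^ n) powr q * (\<rho> * r ^ n) powr (- \<alpha>) = Q (p E5) \<rho> q \<alpha> * Q (p E3) r q \<alpha> ^ n"
proof (induction n)
  case (Suc n)
  have "(p E5 * p E3 ^ Suc n) powr q * (\<rho> * r ^ Suc n) powr (- \<alpha>)
      = ((p E5 * p E3 ^ n) powr q * (\<rho> * r ^ n) powr (- \<alpha>)) * Q (p E3) r q \<alpha>"
    using p_pos \<rho> r by (simp add: Q_def powr_mult less_imp_le)
  then show ?case using Suc by simp
qed (simp add: Q_def)

lemma return_length: "- ln (\<rho> * r ^ n) = la + real n * lb"
  using \<rho> r by (simp add: la_def lb_def ln_mult ln_realpow)

text \<open>
  The only infinite sum is the entry from \<open>C3\<close> to \<open>C1\<close>; its total mass is a geometric series with ratio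
  $Q_{3,r} < 1$.
\<close>

lemma carried_by_entry:
  assumes G: "G \<in> sets borel" "subgroup_reals G" "la \<in> G" "lb \<in> G"
  shows "carried_by G (entry i j)"
proof -
  have len: "la + real n * lb \<in> G" for n
    using G by (intro subgroup_realsD(2) subgroup_reals_mult)
  have "carried_by G (entry C3 C1)"
    unfolding renewal_entry.simps
  proof (rule carried_by_msum[OF G(1)])
    fix k :: nat assume "k \<in> {k. 2 \<le> k}"
    show "carried_by G (atom ((p E5 * p E3 ^ (k - 2)) powr q * (\<rho> * r ^ (k - 2)) powr - \<alpha>) (- ln (\<rho> * r ^ (k - 2))))"
      unfolding return_length by (rule carried_by_atom[OF len G(1)])
  next
    let ?f = "\<lambda>n. ennreal (Q (p E5) \<rho> q \<alpha> * Q (p E3) r q \<alpha> ^ n)"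
    have bij: "bij_betw (\<lambda>n. n + 2) UNIV {k::nat. 2 \<le> k}"
      by (rule bij_betwI[of _ _ _ "\<lambda>k. k - 2"]) auto
    have "(\<integral>\<^sup>+ k. emeasure (atom ((p E5 * p E3 ^ (k - 2)) powr q * (\<rho> * r ^ (k - 2)) powr - \<alpha>) (- ln (\<rho> * r ^ (k - 2)))) UNIV
        \<partial>count_space {k. 2 \<le> k}) = (\<integral>\<^sup>+ n. ?f n \<partial>count_space UNIV)"
      by (subst nn_integral_bij_count_space[OF bij, symmetric]) (simp add: emeasure_atom return_weight)
    also have "\<dots> = (\<Sum>n. ?f n)" by (simp add: nn_integral_count_space_nat)
    also have "\<dots> \<noteq> \<infinity>"
    proof -
      have "0 < Q (p E3) r q \<alpha>" "0 < Q (p E5) \<rho> q \<alpha>" using Q_pos p_pos \<rho> r by auto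
      then have "summable (\<lambda>n. Q (p E5) \<rho> q \<alpha> * Q (p E3) r q \<alpha> ^ n)"
        using Q_bounds by (intro summable_mult summable_geometric) auto
      then show ?thesis
        using \<open>0 < Q (p E3) r q \<alpha>\<close> \<open>0 < Q (p E5) \<rho> q \<alpha>\<close>
        unfolding infinity_ennreal_def by (intro ennreal_suminf_neq_top) auto
    qed
    finally show "(\<integral>\<^sup>+ k. emeasure (atom ((p E5 * p E3 ^ (k - 2)) powr q * (\<rho> * r ^ (k - 2)) powr - \<alpha>) (- ln (\<rho> * r ^ (k - 2)))) UNIV
        \<partial>count_space {k. 2 \<le> k}) \<noteq> \<infinity>" .
  qed
  then show ?thesis
    using G carried_by_atom[of la] carried_by_atom[of lb]
    by (cases i; cases j) (auto simp: carried_by_null la_def lb_def)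
qed

lemma carried_by_conv_power:
  assumes G: "G \<in> sets borel" "subgroup_reals G" "la \<in> G" "lb \<in> G" and J: "finite J"
  shows "carried_by G (conv_power J entry n i j)"
proof (induction n arbitrary: j)
  case 0
  then show ?case using G subgroup_realsD(1)[OF G(2)] by (auto intro!: carried_by_return carried_by_null)
next
  case (Suc n)
  then show ?case
    using carried_by_entry[OF G] J by (auto intro!: carried_by_msum_finite carried_by_convolution G(1,2))
qed

lemma nu_outside:
  assumes G: "G \<in> sets borel" "subgroup_reals G" "la \<in> G" "lb \<in> G"
  shows "emeasure (\<nu>\<^sub>1 \<rho> r p q \<alpha>) (- G) = 0"
proof -
  define F where "F = (\<lambda>(n, i, j). entry C1 i \<star> (conv_power {C3, C4} entry n i j \<star> entry j C1))"
  have F: "carried_by G (F a)" for a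
    using carried_by_entry[OF G] carried_by_conv_power[OF G, of "{C3, C4}"]
    unfolding F_def by (cases a) (auto intro!: carried_by_convolution G)
  let ?I = "(UNIV :: nat set) \<times> {C3, C4} \<times> {C3, C4}"
  have "(\<integral>\<^sup>+ a. emeasure (F a) (- G) \<partial>count_space ?I) = (\<integral>\<^sup>+ a. 0 \<partial>count_space ?I)"
    by (rule nn_integral_cong) (use F in \<open>simp add: carried_by_def\<close>)
  then have "emeasure (msum ?I F) (- G) = 0"
    using F G by (subst emeasure_msum) (auto simp: carried_by_def)
  then show ?thesis
    using carried_by_entry[OF G, of C1 C1] G unfolding \<nu>\<^sub>1_def Let_def F_def
    by (subst emeasure_madd) (auto simp: carried_by_def sets_msum)
qed

lemma la_in_msupp: "la \<in> msupp (\<nu>\<^sub>1 \<rho> r p q \<alpha>)"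
  unfolding msupp_def mem_Collect_eq
proof (intro allI impI)
  fix U :: "real set" assume U: "open U" "la \<in> U"
  have "0 < emeasure (entry C1 C1) U"
    using U p_pos \<rho> by (simp add: emeasure_atom la_def less_imp_neq[THEN not_sym])
  then show "0 < emeasure (\<nu>\<^sub>1 \<rho> r p q \<alpha>) U"
    using U unfolding \<nu>\<^sub>1_def Let_def
    by (subst emeasure_madd) (auto simp: sets_msum sets_atom add_pos_nonneg)
qed

text \<open>
  The atom of the path \<open>C1\<close>, \<open>C3\<close>, \<open>C1\<close> with the shortest return, \<open>k = 2\<close>.
\<close>

lemma la_lb_in_msupp: "lb + la \<in> msupp (\<nu>\<^sub>1 \<rho> r p q \<alpha>)"
  unfolding msupp_def mem_Collect_eq
proof (intro allI impI)
  fix U :: "real set" assume U: "open U" "lb + la \<in> U"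
  define F where "F = (\<lambda>(n, i, j). entry C1 i \<star> (conv_power {C3, C4} entry n i j \<star> entry j C1))"
  let ?I = "(UNIV :: nat set) \<times> {C3, C4} \<times> {C3, C4}"
  have C: "carried_by UNIV (entry i j)" "carried_by UNIV (conv_power {C3, C4} entry n i j)" for n i j
    using carried_by_entry[of UNIV] carried_by_conv_power[of UNIV "{C3, C4}"] UNIV_subgroup by auto
  have C': "carried_by UNIV (M \<star> N)" if "carried_by UNIV M" "carried_by UNIV N" for M N
    using carried_by_convolution[OF _ UNIV_subgroup that] by simp
  have s: "sets (F a) = sets borel" for a unfolding F_def by (cases a) simp
  have pos31: "0 < emeasure (entry C3 C1) {la}"
  proof -
    have "emeasure (atom ((p E5 * p E3 ^ (2 - 2)) powr q * (\<rho> * r ^ (2 - 2)) powr (- \<alpha>)) (- ln (\<rho> * r ^ (2 - 2)))) {la}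
        \<le> emeasure (entry C3 C1) {la}"
      unfolding renewal_entry.simps
      by (subst emeasure_msum; (rule nn_integral_ge_point[of "2::nat"])?) (simp_all add: sets_atom)
    moreover have "0 < emeasure (atom ((p E5 * p E3 ^ (2 - 2)) powr q * (\<rho> * r ^ (2 - 2)) powr (- \<alpha>)) (- ln (\<rho> * r ^ (2 - 2)))) {la}"
      using p_pos \<rho> by (simp add: emeasure_atom la_def less_imp_neq[THEN not_sym])
    ultimately show ?thesis by (rule order.strict_trans2[rotated])
  qed
  have "emeasure (return borel 0) {0::real} * emeasure (entry C3 C1) {la} \<le> emeasure (return borel 0 \<star> entry C3 C1) {la}"
    using C(1)[of C3 C1] C(2)[of 0 C3 C3] by (intro convolution_ge_point) (auto simp: carried_by_def)
  then have pos: "0 < emeasure (return borel 0 \<star> entry C3 C1) {la}"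
    using pos31 by (simp add: order.strict_trans2)
  have "0 < emeasure (entry C1 C3) {lb}"
    using p_pos r w13_pos by (simp add: emeasure_atom lb_def w13_def[symmetric] less_imp_neq[THEN not_sym])
  then have "0 < emeasure (entry C1 C3) {lb} * emeasure (return borel 0 \<star> entry C3 C1) {la}"
    using pos by (simp add: ennreal_zero_less_mult_iff)
  also have "\<dots> \<le> emeasure (entry C1 C3 \<star> (return borel 0 \<star> entry C3 C1)) U"
    using C(1)[of C1 C3] C'[OF C(2)[of 0 C3 C3] C(1)[of C3 C1]] U
    by (intro convolution_ge_point) (auto simp: carried_by_def)
  also have "\<dots> = emeasure (F (0, C3, C3)) U" unfolding F_def by simp
  also have "\<dots> \<le> (\<integral>\<^sup>+ a. emeasure (F a) U \<partial>count_space ?I)"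
    by (rule nn_integral_ge_point) simp
  also have "\<dots> = emeasure (msum ?I F) U"
    using U by (intro emeasure_msum[symmetric] s) auto
  finally have "0 < emeasure (msum ?I F) U" .
  then show "0 < emeasure (\<nu>\<^sub>1 \<rho> r p q \<alpha>) U"
    using U unfolding \<nu>\<^sub>1_def Let_def F_def
    by (subst emeasure_madd) (auto simp: sets_msum sets_atom add_nonneg_pos)
qed

lemma lengths_group_cyclic:
  assumes "\<delta> > 0" "\<And>g. g \<in> lengths_group \<Longrightarrow> g > 0 \<Longrightarrow> g \<ge> \<delta>"
  obtains d where "d > 0" "lengths_group = range (\<lambda>n::int. of_int n * d)"
  using subgroup_reals_cyclic[OF lengths_group(1,2) la_lb_pos(1) assms] by metis

text \<open>
  A discrete group that contains the two lengths contains the group generated by them, which then has no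
  small positive elements.
\<close>

lemma lattice_imp_cyclic:
  assumes "lattice_measure (\<nu>\<^sub>1 \<rho> r p q \<alpha>)"
  obtains d where "d > 0" "lengths_group = range (\<lambda>n::int. of_int n * d)"
proof -
  obtain G where G: "0 \<in> G" "\<forall>x\<in>G. \<forall>y\<in>G. x + y \<in> G" "\<forall>x\<in>G. - x \<in> G"
    "topological_space_class.discrete G" "msupp (\<nu>\<^sub>1 \<rho> r p q \<alpha>) \<subseteq> G"
    using assms unfolding lattice_measure_def by blast
  then have sub: "subgroup_reals G" unfolding subgroup_reals_def by blast
  have la: "la \<in> G" using la_in_msupp G(5) by blast
  have "lb + la \<in> G" using la_lb_in_msupp G(5) by blast
  then have lb: "lb \<in> G" using subgroup_realsD(4)[OF sub _ la, of "lb + la"] by simp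
  have le: "lengths_group \<subseteq> G"
    unfolding lengths_group_def using la lb
    by (auto intro!: subgroup_realsD(2)[OF sub] subgroup_reals_int_mult[OF sub])
  obtain e where e: "e > 0" "\<And>y. y \<in> G \<Longrightarrow> dist 0 y < e \<Longrightarrow> y = 0"
    using discreteD[OF G(4,1)] unfolding isolated_in_dist_Ex_iff by blast
  have "g \<ge> e" if "g \<in> lengths_group" "g > 0" for g
    using e(2)[OF subsetD[OF le that(1)]] that by (cases "g < e") (auto simp: dist_real_def)
  from lengths_group_cyclic[OF e(1) this] that show ?thesis by blast
qed

lemma cyclic_imp_lattice:
  assumes d: "d > 0" "lengths_group = range (\<lambda>n::int. of_int n * d)"
  shows "lattice_measure (\<nu>\<^sub>1 \<rho> r p q \<alpha>)"
  unfolding lattice_measure_def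
proof (intro exI[of _ lengths_group] conjI)
  show "0 \<in> lengths_group" "\<forall>x\<in>lengths_group. \<forall>y\<in>lengths_group. x + y \<in> lengths_group"
    "\<forall>x\<in>lengths_group. - x \<in> lengths_group"
    using lengths_group(1) unfolding subgroup_reals_def by blast+
  show "topological_space_class.discrete lengths_group" unfolding d(2) by (rule discrete_multiples[OF d(1)])
  have "countable lengths_group" unfolding d(2) by auto
  then have borel: "lengths_group \<in> sets borel" by (rule sets.countable[rotated]) auto
  show "msupp (\<nu>\<^sub>1 \<rho> r p q \<alpha>) \<subseteq> lengths_group"
  proof
    fix x assume x: "x \<in> msupp (\<nu>\<^sub>1 \<rho> r p q \<alpha>)"
    show "x \<in> lengths_group"
    proof (rule ccontr)
      assume nx: "x \<notin> lengths_group"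
      define n where "n = \<lfloor>x / d\<rfloor>"
      define U where "U = {of_int n * d<..<(of_int n + 1) * d}"
      have "of_int n * d \<le> x" "x < (of_int n + 1) * d"
        unfolding n_def using d(1) floor_divide_lower[of d x] floor_divide_upper[of d x] by auto
      moreover have "of_int n * d \<noteq> x" using nx unfolding d(2) by auto
      ultimately have "x \<in> U" unfolding U_def by simp
      moreover have "U \<subseteq> - lengths_group"
      proof
        fix y assume y: "y \<in> U"
        show "y \<in> - lengths_group"
        proof
          assume "y \<in> lengths_group"
          then obtain m :: int where "y = of_int m * d" unfolding d(2) by blast
          then have "real_of_int n < of_int m" "real_of_int m < of_int n + 1"
            using y d(1) unfolding U_def by simp_all
          then have "real_of_int n < of_int m" "real_of_int m < of_int (n + 1)" by simp_all
          then have "n < m" "m < n + 1" by (simp_all only: of_int_less_iff)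
          then show False by simp
        qed
      qed
      then have "emeasure (\<nu>\<^sub>1 \<rho> r p q \<alpha>) U \<le> emeasure (\<nu>\<^sub>1 \<rho> r p q \<alpha>) (- lengths_group)"
        using borel by (intro emeasure_mono) (auto simp: \<nu>\<^sub>1_def Let_def sets_madd)
      then have "emeasure (\<nu>\<^sub>1 \<rho> r p q \<alpha>) U = 0"
        using nu_outside[OF borel lengths_group] by simp
      moreover have "open U" unfolding U_def by simp
      ultimately show False using x unfolding msupp_def by fastforce
    qed
  qed
qed

lemma lattice_settle: "lattice_measure (\<nu>\<^sub>1 \<rho> r p q \<alpha>) \<Longrightarrow> settle_group lengths_group"
  unfolding settle_group_def by (metis lattice_imp_cyclic)

lemma nonlattice_settle:
  assumes "\<not> lattice_measure (\<nu>\<^sub>1 \<rho> r p q \<alpha>)"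
  shows "settle_group UNIV"
proof -
  have "\<exists>g\<in>lengths_group. 0 < g \<and> g < \<delta>" if "\<delta> > 0" for \<delta>
  proof (rule ccontr)
    assume "\<not> ?thesis"
    then have "\<And>g. g \<in> lengths_group \<Longrightarrow> g > 0 \<Longrightarrow> g \<ge> \<delta>" by force
    then show False using lengths_group_cyclic[OF that] cyclic_imp_lattice assms by metis
  qed
  then show ?thesis unfolding settle_group_def by blast
qed


section \<open>The theorem\<close>

lemma affine_image_unit: "s > 0 \<Longrightarrow> (\<lambda>x. s * x + c) ` {0<..<1::real} = {c<..<s + c}"
proof (intro set_eqI iffI)
  fix y assume s: "s > 0" and y: "y \<in> {c<..<s + c}"
  have "(y - c) / s \<in> {0<..<1}" "y = s * ((y - c) / s) + c" using s y by (auto simp: field_simps)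
  then show "y \<in> (\<lambda>x. s * x + c) ` {0<..<1}" by blast
qed auto

fun cell_left :: "cell \<Rightarrow> real" where
  "cell_left C1 = 0" | "cell_left C3 = 0" | "cell_left C4 = 1 - r"

fun cell_right :: "cell \<Rightarrow> real" where
  "cell_right C1 = \<l>" | "cell_right C3 = \<rho>" | "cell_right C4 = 1"

lemma cell_set_eq: "cell_set \<rho> r l = {cell_left l<..<cell_right l}"
proof -
  have S: "S \<rho> r E1 = (\<lambda>x. \<rho> * x + 0)" "S \<rho> r E2 = (\<lambda>x. r * x + \<rho> * (1 - r))"
    "S \<rho> r E4 = (\<lambda>x. r * x + (1 - r))" "S \<rho> r E5 = (\<lambda>x. \<rho> * x + 0)"
    by (auto simp: fun_eq_iff)
  have "\<rho> * (1 - r) < \<rho>" "0 < \<rho> * (1 - r)" using \<rho> r by auto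
  then show ?thesis
    using geometry(1)
    by (cases l; simp only: cell_set.simps S affine_image_unit[OF \<rho>(1)] affine_image_unit[OF r(1)] cell_left.simps cell_right.simps; auto simp: geometry(9))
qed

lemma \<phi>_eq_N: "exp ((1 + \<alpha>) * x) * \<phi> \<rho> r \<mu> q l (exp (- x)) = N 1 1 (cell_left l) (cell_right l) x"
  unfolding \<phi>_def N_def Lint_def cell_set_eq measure_\<mu>_ball ..

lemma \<phi>_asym_periodic:
  assumes "settle_group G"
  shows "asym_periodic G (\<lambda>x. exp ((1 + \<alpha>) * x) * \<phi> \<rho> r \<mu> q l (exp (- x)))"
  unfolding \<phi>_eq_N using N_first_block_asym_periodic[OF assms, of 1 1] N_right_cell_asym_periodic[OF assms]
  by (cases l) auto

lemma \<phi>_nonlattice: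
  assumes "\<not> lattice_measure (\<nu>\<^sub>1 \<rho> r p q \<alpha>)"
  shows "\<exists>c\<ge>0. ((\<lambda>x. exp ((1 + \<alpha>) * x) * \<phi> \<rho> r \<mu> q l (exp (- x))) \<longlongrightarrow> c) at_top"
proof -
  let ?Y = "\<lambda>x. exp ((1 + \<alpha>) * x) * \<phi> \<rho> r \<mu> q l (exp (- x))"
  obtain f where f: "\<And>x g. f (x + g) = f x" "((\<lambda>x. ?Y x - f x) \<longlongrightarrow> 0) at_top"
    using \<phi>_asym_periodic[OF nonlattice_settle[OF assms], of l] unfolding asym_periodic_def by auto
  have "f x = f 0" for x using f(1)[of 0 x] by simp
  then obtain c where c: "\<And>x. f x = c" by blast
  have lim: "(?Y \<longlongrightarrow> c) at_top" using f(2) unfolding c by (simp add: LIM_zero_iff)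
  have "eventually (\<lambda>x. 0 \<le> ?Y x) at_top" unfolding \<phi>_eq_N by (intro always_eventually allI N_nonneg)
  then have "0 \<le> c" by (intro tendsto_lowerbound[OF lim]) auto
  then show ?thesis using lim by blast
qed

lemma \<phi>_lattice:
  assumes "lattice_measure (\<nu>\<^sub>1 \<rho> r p q \<alpha>)"
  shows "\<exists>f T. T > 0 \<and> (\<forall>x. f (x + T) = f x) \<and>
    ((\<lambda>x. exp ((1 + \<alpha>) * x) * \<phi> \<rho> r \<mu> q l (exp (- x)) - f x) \<longlongrightarrow> 0) at_top"
  using \<phi>_asym_periodic[OF lattice_settle[OF assms], of l] lengths_group(2) la_lb_pos(1)
  unfolding asym_periodic_def by blast

end

theorem corollary1p3:
  fixes \<rho> r :: real and p :: "edge \<Rightarrow> real" and \<mu> \<mu>1 \<mu>2 :: "real measure"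
  assumes "0 < \<rho>" "\<rho> < 1" "0 < r" "r < 1" and "\<rho> + 2 * r - \<rho> * r \<le> 1"
    and "\<And>e. p e > 0" and "p E1 + p E2 + p E3 = 1" and "p E4 + p E5 = 1"
    and "graph_directed_measures \<rho> r p \<mu>1 \<mu>2" and "\<mu> = madd \<mu>1 \<mu>2"
  shows "\<forall>q\<ge>0.
    (\<exists>!\<alpha>. Q (p E4) r q \<alpha> < 1 \<and> H \<rho> r p q \<alpha> = 0) \<and>
    (\<forall>\<alpha>. Q (p E4) r q \<alpha> < 1 \<and> H \<rho> r p q \<alpha> = 0 \<longrightarrow>
       Lq_spectrum \<mu> q = ereal \<alpha> \<and>
       (q > 0 \<and> deriv (H \<rho> r p q) \<alpha> \<noteq> 0 \<longrightarrow>
          ((\<lambda>s. real_of_ereal (Lq_spectrum \<mu> s)) has_real_derivative tau_deriv \<rho> r p q \<alpha>) (at q)) \<and>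
       (\<not> lattice_measure (\<nu>\<^sub>1 \<rho> r p q \<alpha>) \<longrightarrow>
          (\<forall>l. \<exists>c\<ge>0. ((\<lambda>x. exp ((1 + \<alpha>) * x) * \<phi> \<rho> r \<mu> q l (exp (- x))) \<longlongrightarrow> c) at_top)) \<and>
       (lattice_measure (\<nu>\<^sub>1 \<rho> r p q \<alpha>) \<longrightarrow>
          (\<forall>l. \<exists>f T. T > 0 \<and> (\<forall>x. f (x + T) = f x) \<and>
             ((\<lambda>x. exp ((1 + \<alpha>) * x) * \<phi> \<rho> r \<mu> q l (exp (- x)) - f x) \<longlongrightarrow> 0) at_top)))"
proof -
  interpret overlap_system \<rho> r p \<mu>1 \<mu>2
    by unfold_locales (use assms in auto)
  have spec: "overlap_spectrum \<rho> r p \<mu>1 \<mu>2 q \<alpha>" if "q \<ge> 0" "admissible q \<alpha>" for q \<alpha>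
    using that by unfold_locales
  \<comment> \<open>the zero as a function of the power\<close>
  obtain A where A: "\<And>s. admissible s (A s)" using admissible_exists by metis
  have Lq: "Lq_spectrum \<mu> s = ereal (A s)" if "s \<ge> 0" for s
    using overlap_spectrum.Lq_spectrum_eq[OF spec[OF that A]] unfolding assms(10) .
  show ?thesis
    unfolding admissible_def[symmetric]
  proof (intro allI impI conjI)
    fix q :: real assume q: "q \<ge> 0"
    show "\<exists>!\<alpha>. admissible q \<alpha>" using A admissible_unique[OF q] by blast
    fix \<alpha> assume adm: "admissible q \<alpha>"
    have \<alpha>: "\<alpha> = A q" using admissible_unique[OF q adm A] .
    show "Lq_spectrum \<mu> q = ereal \<alpha>" using Lq[OF q] \<alpha> by simp
    note s = spec[OF q adm]
    show "((\<lambda>s. real_of_ereal (Lq_spectrum \<mu> s)) has_real_derivative tau_deriv \<rho> r p q \<alpha>) (at q)"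
      if "q > 0 \<and> deriv (H \<rho> r p q) \<alpha> \<noteq> 0"
    proof (rule has_field_derivative_transform_within_open[where S = "{0<..}" and f = A])
      show "(A has_real_derivative tau_deriv \<rho> r p q \<alpha>) (at q)"
        using admissible_has_derivative[of q A] A that unfolding \<alpha> by blast
    qed (use that Lq in auto)
    show "\<exists>c\<ge>0. ((\<lambda>x. exp ((1 + \<alpha>) * x) * \<phi> \<rho> r \<mu> q l (exp (- x))) \<longlongrightarrow> c) at_top"
      if "\<not> lattice_measure (\<nu>\<^sub>1 \<rho> r p q \<alpha>)" for l
      using overlap_spectrum.\<phi>_nonlattice[OF s that] unfolding assms(10) .
    show "\<exists>f T. T > 0 \<and> (\<forall>x. f (x + T) = f x) \<and>
             ((\<lambda>x. exp ((1 + \<alpha>) * x) * \<phi> \<rho> r \<mu> q l (exp (- x)) - f x) \<longlongrightarrow> 0) at_top"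
      if "lattice_measure (\<nu>\<^sub>1 \<rho> r p q \<alpha>)" for l
      using overlap_spectrum.\<phi>_lattice[OF s that] unfolding assms(10) .
  qed
qed

end
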